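(* Let $\Gamma$ be a finite digraph, $\mathbb F$ a field and $L(\Gamma)$ the Leavitt path algebra of $\Gamma$ over $\mathbb F$. The following are equivalent: (1) $\Gamma$ has a maximal sink or a maximal cycle; (2) $L(\Gamma)$ has UGN (Unbounded Generating Number); (3) $L(\Gamma)$ is algebraically amenable; (4) $L(\Gamma)$ has a nonzero finite dimensional quotient; (5) $L(\Gamma)\oplus L(\Gamma)$ is not isomorphic to a quotient module of $L(\Gamma)$.
   Context: A digraph $\Gamma=(V,E,s,t)$ is finite if its vertex set $V$ and arrow set $E$ are finite; $s,t:E\to V$ are the source and target maps. $L(\Gamma)$ is the $\mathbb F$-algebra generated by $V\sqcup E\sqcup E^*$, where $E^*=\{e^*: e\in E\}$, $s(e^* )=t(e)$, $t(e^* )=s(e)$, subject to: (V) $vw=\delta_{v,w}v$ for $v,w\in V$; (E) $s(e)e=e=e\,t(e)$ for $e\in E\sqcup E^*$; (CK1) $e^*f=\delta_{e,f}\,t(e)$ for $e,f\in E$; (CK2) $v=\sum_{s(e)=v}ee^*$ for every $v\in V$ with $s^{-1}(v)\neq\emptyset$. Its unit is $\sum_{v\in V}v$. Modules are right unital modules. A sink is a vertex $v$ with $s^{-1}(v)=\emptyset$. A cycle is a path $e_1\cdots e_n$, $n>0$ ($t(e_i)=s(e_{i+1})$), with $t(e_n)=s(e_1)$ and $s(e_i)\ne s(e_j)$ for $i\neq j$; cyclic rotations of a cycle are regarded as the same cycle. For $u',u$ each a sink or a cycle, $u'\leadsto u$ means there is a (possibly length $0$) path from a vertex of $u'$ to a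 vertex of $u$. A sink or a cycle $u$ is maximal if $u'\leadsto u$ only if $u'=u$, for $u'$ a sink or cycle. A ring $R$ with $1$ has UGN if $R^m\cong R^n\oplus P$ as $R$-modules implies $m\ge n$. An $\mathbb F$-algebra $A$ is algebraically amenable if for every $\varepsilon>0$ and every finite subset $\mathcal S\subseteq A$ there is a nonzero finite dimensional subspace $W\subseteq A$ with $\dim(aW+W)\le(1+\varepsilon)\dim W$ for all $a\in\mathcal S$. *)

theory Defs
  imports
    "HOL-Library.Poly_Mapping"
    "HOL-Algebra.QuotRing"
    "Graph_Theory.Arc_Walk"
    "Jordan_Normal_Form.VS_Connect"
begin

section \<open>Maximal sinks and cycles\<close>

text \<open>
  Finite digraphs are \<^locale>\<open>fin_digraph\<close>s: loops and parallel arcs are allowed, the source map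
  is \<^const>\<open>tail\<close> and the target map is \<^const>\<open>head\<close>.  A cycle is a list of arcs satisfying
  \<^const>\<open>pre_digraph.cycle\<close>; there it is the targets that are required to be distinct, which for a
  closed walk are the sources up to rotation.  Cycles that are rotations of each other
  are identified, so a cycle enters as its rotation class.
\<close>

datatype ('v, 'e) sink_or_cycle = Sink 'v | Cycle "'e list set"

definition sinks :: "('v, 'e) pre_digraph \<Rightarrow> 'v set" where
  "sinks G = {v \<in> verts G. out_arcs G v = {}}"

definition rotation_class :: "'e list \<Rightarrow> 'e list set" where
  "rotation_class p = range (\<lambda>k. rotate k p)"

definition cycle_classes :: "('v, 'e) pre_digraph \<Rightarrow> 'e list set set" where
  "cycle_classes G = rotation_class ` {p. pre_digraph.cycle G p}"

definition sinks_and_cycles :: "('v, 'e) pre_digraph \<Rightarrow> ('v, 'e) sink_or_cycle set" where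
  "sinks_and_cycles G = Sink ` sinks G \<union> Cycle ` cycle_classes G"

fun vertices_on :: "('v, 'e) pre_digraph \<Rightarrow> ('v, 'e) sink_or_cycle \<Rightarrow> 'v set" where
  "vertices_on G (Sink v) = {v}"
| "vertices_on G (Cycle C) = (\<Union>p\<in>C. tail G ` set p)"

definition leads_to ::
    "('v, 'e) pre_digraph \<Rightarrow> ('v, 'e) sink_or_cycle \<Rightarrow> ('v, 'e) sink_or_cycle \<Rightarrow> bool" where
  "leads_to G u' u \<longleftrightarrow> (\<exists>x\<in>vertices_on G u'. \<exists>y\<in>vertices_on G u. x \<rightarrow>\<^sup>*\<^bsub>G\<^esub> y)"

definition maximal_in :: "('v, 'e) pre_digraph \<Rightarrow> ('v, 'e) sink_or_cycle \<Rightarrow> bool" where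
  "maximal_in G u \<longleftrightarrow>
     u \<in> sinks_and_cycles G \<and> (\<forall>u'\<in>sinks_and_cycles G. leads_to G u' u \<longrightarrow> u' = u)"


section \<open>The Leavitt path algebra\<close>

text \<open>
  The free unital algebra on a set \<open>X\<close> is the monoid algebra of the free monoid on \<open>X\<close>, realised
  by finitely supported functions on words.  An algebra over a field type \<open>'k\<close> is an HOL-Algebra
  \<^type>\<open>module\<close> record, which contains a ring multiplication besides the scalar multiplication.
\<close>

datatype 'x free_word = Word (letters: "'x list")

instantiation free_word :: (type) monoid_add
begin

definition zero_free_word :: "'a free_word" where
  "0 = Word []"

definition plus_free_word :: "'a free_word \<Rightarrow> 'a free_word \<Rightarrow> 'a free_word" where
  "u + v = Word (letters u @ letters v)"

instance
  by standard (simp_all add: zero_free_word_def plus_free_word_def)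

end

definition free_algebra :: "'x set \<Rightarrow> ('k::field, 'x free_word \<Rightarrow>\<^sub>0 'k) module" where
  "free_algebra X =
     \<lparr>carrier = {f. \<forall>w\<in>Poly_Mapping.keys f. set (letters w) \<subseteq> X},
      mult = (*), one = 1, zero = 0, add = (+),
      smult = (\<lambda>a f. Poly_Mapping.single 0 a * f)\<rparr>"

definition letter :: "'x \<Rightarrow> 'x free_word \<Rightarrow>\<^sub>0 'k::field" where
  "letter x = Poly_Mapping.single (Word [x]) 1"

text \<open>The free algebra without unit: no coefficient at the empty word.\<close>

definition nonunital_part :: "'x set \<Rightarrow> ('x free_word \<Rightarrow>\<^sub>0 'k::field) set" where
  "nonunital_part X = {f \<in> carrier (free_algebra X). Poly_Mapping.lookup f 0 = 0}"

definition quotient_algebra :: "('k, 'a) module \<Rightarrow> 'a set \<Rightarrow> ('k, 'a set) module" where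
  "quotient_algebra A I =
     \<lparr>carrier = carrier (A Quot I), mult = mult (A Quot I), one = one (A Quot I),
      zero = zero (A Quot I), add = add (A Quot I),
      smult = (\<lambda>a C. \<Union>x\<in>C. I +>\<^bsub>A\<^esub> (a \<odot>\<^bsub>A\<^esub> x))\<rparr>"

text \<open>\<open>Ghost e\<close> stands for the generator \<open>e\<^sup>*\<close>; \<open>Vert v\<close> has source and target \<open>v\<close>.\<close>

datatype ('v, 'e) generator = Vert 'v | Arc 'e | Ghost 'e

fun gen_source :: "('v, 'e) pre_digraph \<Rightarrow> ('v, 'e) generator \<Rightarrow> 'v" where
  "gen_source G (Vert v) = v"
| "gen_source G (Arc e) = tail G e"
| "gen_source G (Ghost e) = head G e"

fun gen_target :: "('v, 'e) pre_digraph \<Rightarrow> ('v, 'e) generator \<Rightarrow> 'v" where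
  "gen_target G (Vert v) = v"
| "gen_target G (Arc e) = head G e"
| "gen_target G (Ghost e) = tail G e"

definition generators :: "('v, 'e) pre_digraph \<Rightarrow> ('v, 'e) generator set" where
  "generators G = Vert ` verts G \<union> Arc ` arcs G \<union> Ghost ` arcs G"

text \<open>A relation \<open>l = r\<close> is recorded as the element \<open>l - r\<close>.\<close>

inductive_set leavitt_relations ::
    "('v, 'e) pre_digraph \<Rightarrow> (('v, 'e) generator free_word \<Rightarrow>\<^sub>0 'k::field) set"
  for G :: "('v, 'e) pre_digraph" where
  V: "\<lbrakk>v \<in> verts G; w \<in> verts G\<rbrakk> \<Longrightarrow>
      letter (Vert v) * letter (Vert w) - (if v = w then letter (Vert v) else 0)
        \<in> leavitt_relations G"
| E_source: "x \<in> Arc ` arcs G \<union> Ghost ` arcs G \<Longrightarrow>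
      letter (Vert (gen_source G x)) * letter x - letter x \<in> leavitt_relations G"
| E_target: "x \<in> Arc ` arcs G \<union> Ghost ` arcs G \<Longrightarrow>
      letter x * letter (Vert (gen_target G x)) - letter x \<in> leavitt_relations G"
| CK1: "\<lbrakk>e \<in> arcs G; f \<in> arcs G\<rbrakk> \<Longrightarrow>
      letter (Ghost e) * letter (Arc f) - (if e = f then letter (Vert (head G e)) else 0)
        \<in> leavitt_relations G"
| CK2: "\<lbrakk>v \<in> verts G; out_arcs G v \<noteq> {}\<rbrakk> \<Longrightarrow>
      letter (Vert v) - (\<Sum>e\<in>out_arcs G v. letter (Arc e) * letter (Ghost e))
        \<in> leavitt_relations G"

definition leavitt_ideal ::
    "('v, 'e) pre_digraph \<Rightarrow> (('v, 'e) generator free_word \<Rightarrow>\<^sub>0 'k::field) set" where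
  "leavitt_ideal G = Idl\<^bsub>free_algebra (generators G)\<^esub> (leavitt_relations G)"

text \<open>
  The presentation is one of algebras without unit, so only the classes of elements of
  \<^const>\<open>nonunital_part\<close> are taken; this is an algebra whose unit is the class of the sum of
  the vertices, and not the class of the empty word.  As the relations lie in
  \<^const>\<open>nonunital_part\<close>, they generate the same ideal there as in the unital free algebra.
\<close>

definition leavitt_path_algebra ::
    "('v, 'e) pre_digraph \<Rightarrow> ('k::field, (('v, 'e) generator free_word \<Rightarrow>\<^sub>0 'k) set) module" where
  "leavitt_path_algebra G =
     (let F = free_algebra (generators G); I = leavitt_ideal G
      in (quotient_algebra F I)
           \<lparr>carrier := (\<lambda>f. I +>\<^bsub>F\<^esub> f) ` nonunital_part (generators G),
            one := I +>\<^bsub>F\<^esub> (\<Sum>v\<in>verts G. letter (Vert v))\<rparr>)"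


text \<open>
  The following justifies speaking of subspaces and dimensions: the Leavitt path algebra is an
  associative unital algebra over the field.
\<close>

lemma carrier_free_algebra:
  "carrier (free_algebra X) = {f. \<forall>w\<in>Poly_Mapping.keys f. set (letters w) \<subseteq> X}"
  by (simp add: free_algebra_def)

lemma letters_plus [simp]: "letters (u + v) = letters u @ letters v"
  by (simp add: plus_free_word_def)

lemma letters_zero [simp]: "letters 0 = []"
  by (simp add: zero_free_word_def)

lemma free_algebra_mult: "\<lbrakk>f \<in> carrier (free_algebra X); g \<in> carrier (free_algebra X)\<rbrakk> \<Longrightarrow> f * g \<in> carrier (free_algebra X)"
  unfolding carrier_free_algebra
  using keys_mult[of f g] by (fastforce)

lemma free_algebra_add: "\<lbrakk>f \<in> carrier (free_algebra X); g \<in> carrier (free_algebra X)\<rbrakk> \<Longrightarrow> f + g \<in> carrier (free_algebra X)"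
  unfolding carrier_free_algebra
  using Poly_Mapping.keys_add[of f g] by (fastforce)

lemma free_algebra_uminus: "f \<in> carrier (free_algebra X) \<Longrightarrow> - f \<in> carrier (free_algebra X)"
  unfolding carrier_free_algebra by simp

lemma free_algebra_diff: "\<lbrakk>f \<in> carrier (free_algebra X); g \<in> carrier (free_algebra X)\<rbrakk> \<Longrightarrow> f - g \<in> carrier (free_algebra X)"
  using free_algebra_add[of f X "- g"] free_algebra_uminus by auto

lemma free_algebra_zero: "0 \<in> carrier (free_algebra X)" and free_algebra_one: "1 \<in> carrier (free_algebra X)"
  and free_algebra_scalar: "Poly_Mapping.single 0 a \<in> carrier (free_algebra X)"
  and free_algebra_letter: "x \<in> X \<Longrightarrow> letter x \<in> carrier (free_algebra X)"
  unfolding carrier_free_algebra by (auto simp: letter_def)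

lemma free_word_mapping_induct [case_names zero single add]:
  fixes f :: "'w \<Rightarrow>\<^sub>0 'k::comm_monoid_add"
  assumes "P 0" "\<And>w a. P (Poly_Mapping.single w a)" "\<And>f g. P f \<Longrightarrow> P g \<Longrightarrow> P (f + g)"
  shows "P f"
proof (induction f rule: update_induct)
  case const
  show ?case using assms(1) unfolding zero_poly_mapping_def .
next
  case (update f a b)
  have "Poly_Mapping.update a b f = f + Poly_Mapping.single a b"
    using update by (intro poly_mapping_eqI) (auto simp: lookup_update lookup_add lookup_single when_def in_keys_iff)
  moreover have "P (f + Poly_Mapping.single a b)"
    using update assms(2) by (intro assms(3)) blast+
  ultimately show ?case by (simp only:)
qed

lemma scalar_commute: "f * Poly_Mapping.single 0 a = Poly_Mapping.single 0 (a::'k::field) * f"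
  by (induction f rule: free_word_mapping_induct) (simp_all add: mult_single ac_simps algebra_simps)

locale field_algebra = A?: ring A + vectorspace class_ring A
  for A :: "('k::field, 'a) module" (structure) +
  assumes smult_mult: "\<lbrakk>x \<in> carrier A; y \<in> carrier A\<rbrakk> \<Longrightarrow> (a \<odot> x) \<otimes> y = a \<odot> (x \<otimes> y)"
    and mult_smult: "\<lbrakk>x \<in> carrier A; y \<in> carrier A\<rbrakk> \<Longrightarrow> x \<otimes> (a \<odot> y) = a \<odot> (x \<otimes> y)"

lemma field_algebraI:
  fixes A :: "('k::field, 'a) module"
  assumes "ring A"
   and "\<And>a x. x \<in> carrier A \<Longrightarrow> a \<odot>\<^bsub>A\<^esub> x \<in> carrier A"
   and "\<And>a b x. x \<in> carrier A \<Longrightarrow> (a + b) \<odot>\<^bsub>A\<^esub> x = a \<odot>\<^bsub>A\<^esub> x \<oplus>\<^bsub>A\<^esub> b \<odot>\<^bsub>A\<^esub> x"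
   and "\<And>a x y. x \<in> carrier A \<Longrightarrow> y \<in> carrier A \<Longrightarrow> a \<odot>\<^bsub>A\<^esub> (x \<oplus>\<^bsub>A\<^esub> y) = a \<odot>\<^bsub>A\<^esub> x \<oplus>\<^bsub>A\<^esub> a \<odot>\<^bsub>A\<^esub> y"
   and "\<And>a b x. x \<in> carrier A \<Longrightarrow> (a * b) \<odot>\<^bsub>A\<^esub> x = a \<odot>\<^bsub>A\<^esub> (b \<odot>\<^bsub>A\<^esub> x)"
   and "\<And>x. x \<in> carrier A \<Longrightarrow> 1 \<odot>\<^bsub>A\<^esub> x = x"
   and "\<And>a x y. x \<in> carrier A \<Longrightarrow> y \<in> carrier A \<Longrightarrow> (a \<odot>\<^bsub>A\<^esub> x) \<otimes>\<^bsub>A\<^esub> y = a \<odot>\<^bsub>A\<^esub> (x \<otimes>\<^bsub>A\<^esub> y)"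
   and "\<And>a x y. x \<in> carrier A \<Longrightarrow> y \<in> carrier A \<Longrightarrow> x \<otimes>\<^bsub>A\<^esub> (a \<odot>\<^bsub>A\<^esub> y) = a \<odot>\<^bsub>A\<^esub> (x \<otimes>\<^bsub>A\<^esub> y)"
  shows "field_algebra A"
proof -
  interpret ring A by fact
  have "module class_ring A"
    by (rule moduleI) (use assms in \<open>auto simp: class_cring.is_cring is_abelian_group\<close>)
  then have "vectorspace class_ring A"
    by (simp add: vectorspace_def class_field)
  then show ?thesis
    by (intro field_algebra.intro field_algebra_axioms.intro) (use assms in auto)
qed

lemma field_algebra_free_algebra: "field_algebra (free_algebra X :: ('k::field, 'x free_word \<Rightarrow>\<^sub>0 'k) module)"
proof (rule field_algebraI)
  let ?F = "free_algebra X :: ('k, 'x free_word \<Rightarrow>\<^sub>0 'k) module"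
  have [simp]: "mult ?F = (*)" "add ?F = (+)" "one ?F = 1" "zero ?F = 0"
     by (simp_all add: free_algebra_def)
  have "\<exists>y\<in>carrier ?F. y + x = 0" if "x \<in> carrier ?F" for x
     using that free_algebra_uminus[OF that] by (intro bexI[of _ "- x"]) auto
  then show "ring ?F"
    by (intro ringI abelian_groupI monoidI) (auto simp: algebra_simps free_algebra_mult free_algebra_add free_algebra_zero free_algebra_one)
next
  fix a :: 'k and x y :: "'x free_word \<Rightarrow>\<^sub>0 'k"
  have "x * (Poly_Mapping.single 0 a * y) = Poly_Mapping.single 0 a * (x * y)"
    by (simp add: scalar_commute flip: mult.assoc)
  then show "x \<otimes>\<^bsub>free_algebra X\<^esub> (a \<odot>\<^bsub>free_algebra X\<^esub> y) = a \<odot>\<^bsub>free_algebra X\<^esub> (x \<otimes>\<^bsub>free_algebra X\<^esub> y)"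
    by (simp add: free_algebra_def)
next
  fix a :: 'k and x :: "'x free_word \<Rightarrow>\<^sub>0 'k" assume "x \<in> carrier (free_algebra X)"
  then have "Poly_Mapping.single 0 a * x \<in> carrier (free_algebra X)"
    by (intro free_algebra_mult free_algebra_scalar)
  then show "a \<odot>\<^bsub>free_algebra X\<^esub> x \<in> carrier (free_algebra X)"
    by (simp add: free_algebra_def)
qed (simp_all add: free_algebra_def single_add distrib_left distrib_right mult.assoc
      mult_single [where k = 0 and l = 0, simplified, symmetric])

lemma ring_of_equal_fields:
  fixes R :: "('a, 'x) ring_scheme" and S :: "('a, 'y) ring_scheme"
  assumes "ring R" "carrier S = carrier R" "mult S = mult R" "one S = one R" "zero S = zero R" "add S = add R"
  shows "ring S"
proof -
  interpret ring R by fact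
  show ?thesis
  proof (rule ringI)
    show "abelian_group S"
      by (rule abelian_groupI) (use assms(2-) add.l_inv_ex in \<open>simp_all add: add.m_assoc add.m_comm add.m_lcomm\<close>)
    show "monoid S"
      by (rule monoidI) (simp_all add: assms(2-) m_assoc)
  qed (simp_all add: assms(2-) l_distr r_distr)
qed

lemma (in field_algebra) ideal_smult:
  assumes "ideal J A" "x \<in> J" shows "a \<odot> x \<in> J"
proof -
  interpret J: ideal J A by fact
  have x: "x \<in> carrier A" using assms(2) by auto
  have "a \<odot> x = (a \<odot> \<one>) \<otimes> x" using x by (simp add: smult_mult)
  moreover have "(a \<odot> \<one>) \<in> carrier A" by (rule smult_closed) auto
  ultimately show ?thesis using J.I_l_closed assms(2) by metis
qed

lemma (in field_algebra) coset_smult: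
  assumes "ideal J A" "x \<in> carrier A"
  shows "(\<Union>y\<in>J +> x. J +> (a \<odot> y)) = J +> (a \<odot> x)"
proof -
  interpret J: ideal J A by fact
  have "J +> (a \<odot> y) = J +> (a \<odot> x)" if "y \<in> J +> x" for y
  proof -
    from that obtain j where j: "j \<in> J" "y = j \<oplus> x" by (auto simp: a_r_coset_def')
    have jc: "j \<in> carrier A" using j by auto
    have "a \<odot> y = a \<odot> j \<oplus> a \<odot> x" using j jc assms by (simp add: smult_r_distr)
    moreover have "a \<odot> j \<in> J" using ideal_smult assms j by auto
    moreover have "a \<odot> x \<in> carrier A" "a \<odot> y \<in> carrier A" by (rule smult_closed; use assms jc j in simp)+
      ultimately have "a \<odot> y \<in> J +> (a \<odot> x)" "a \<odot> x \<in> carrier A"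
      by (auto simp: a_r_coset_def')
    then show ?thesis
      using abelian_group.a_repr_independence[OF A.is_abelian_group _ _ J.a_subgroup] by metis
  qed
  moreover have "x \<in> J +> x" using assms J.a_rcos_self by auto
  ultimately show ?thesis by blast
qed

lemma (in field_algebra) quotient_field_algebra:
  assumes "ideal J A"
  shows "field_algebra (quotient_algebra A J)"
proof -
  interpret J: ideal J A by fact
  let ?Q = "quotient_algebra A J"
  have c: "carrier ?Q = (\<lambda>x. J +> x) ` carrier A"
    by (auto simp: quotient_algebra_def FactRing_def A_RCOSETS_def RCOSETS_def a_r_coset_def)
  have s: "a \<odot>\<^bsub>?Q\<^esub> (J +> x) = J +> (a \<odot> x)" if "x \<in> carrier A" for a x
    using coset_smult[OF assms that] by (simp add: quotient_algebra_def)
  have m: "(J +> x) \<otimes>\<^bsub>?Q\<^esub> (J +> y) = J +> (x \<otimes> y)" if "x \<in> carrier A" "y \<in> carrier A" for x y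
    using that J.rcoset_mult_add by (simp add: quotient_algebra_def FactRing_def)
  have p: "(J +> x) \<oplus>\<^bsub>?Q\<^esub> (J +> y) = J +> (x \<oplus> y)" if "x \<in> carrier A" "y \<in> carrier A" for x y
    using that J.a_rcos_sum by (simp add: quotient_algebra_def FactRing_def)
  have r: "ring ?Q"
    by (rule ring_of_equal_fields[OF J.quotient_is_ring]) (simp_all add: quotient_algebra_def)
  have sc: "a \<odot> x \<in> carrier A" if "x \<in> carrier A" for a x
    by (rule smult_closed) (use that in auto)
  show ?thesis
    by (rule field_algebraI)
      (use r sc smult_l_distr smult_r_distr smult_assoc1 smult_one smult_mult mult_smult in \<open>auto simp: c s m p\<close>)
qed

lemma generatorsI:
  "v \<in> verts G \<Longrightarrow> Vert v \<in> generators G"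
  "e \<in> arcs G \<Longrightarrow> Arc e \<in> generators G"
  "e \<in> arcs G \<Longrightarrow> Ghost e \<in> generators G"
  by (auto simp: generators_def)

lemma free_algebra_sum: "(\<And>i. i \<in> S \<Longrightarrow> f i \<in> carrier (free_algebra X)) \<Longrightarrow> sum f S \<in> carrier (free_algebra X)"
  by (induction S rule: infinite_finite_induct) (auto simp: free_algebra_zero free_algebra_add)

lemma lookup_mult_zero_word:
  "Poly_Mapping.lookup (f * g) (0 :: 'x free_word) = Poly_Mapping.lookup f 0 * (Poly_Mapping.lookup g 0 :: 'k::field)"
proof (induction f rule: free_word_mapping_induct)
  case (single u a)
  show ?case
  proof (induction g rule: free_word_mapping_induct)
    case (single w b)
    have "u + w = 0 \<longleftrightarrow> u = 0 \<and> w = 0" 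
      by (cases u; cases w) (auto simp: plus_free_word_def zero_free_word_def)
    then show ?case by (auto simp: mult_single lookup_single when_def)
  qed (simp_all add: algebra_simps lookup_add)
qed (simp_all add: algebra_simps lookup_add)

lemma lookup_letter_zero [simp]: "Poly_Mapping.lookup (letter x) 0 = 0"
  by (simp add: letter_def lookup_single when_def zero_free_word_def)

lemma lookup_sum_word: "Poly_Mapping.lookup (sum f S) k = (\<Sum>i\<in>S. Poly_Mapping.lookup (f i) k)"
  by (induction S rule: infinite_finite_induct) (auto simp: lookup_add)

lemma (in fin_digraph) leavitt_relations_nonunital:
  "leavitt_relations G \<subseteq> nonunital_part (generators G)"
proof
  fix x assume "x \<in> leavitt_relations G"
  then show "x \<in> nonunital_part (generators G)"
    by (induction rule: leavitt_relations.induct)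
      (auto simp: nonunital_part_def lookup_minus lookup_mult_zero_word lookup_sum_word
        intro!: free_algebra_diff free_algebra_mult free_algebra_sum free_algebra_letter free_algebra_zero generatorsI)
qed

lemma (in fin_digraph) ideal_leavitt:
  "ideal (leavitt_ideal G :: (_ \<Rightarrow>\<^sub>0 'k::field) set) (free_algebra (generators G))"
proof -
  interpret F: field_algebra "free_algebra (generators G) :: ('k, _) module"
    by (rule field_algebra_free_algebra)
  show ?thesis unfolding leavitt_ideal_def
    by (rule F.A.genideal_ideal) (use leavitt_relations_nonunital in \<open>auto simp: nonunital_part_def\<close>)
qed

lemma (in field_algebra) coset_eqI:
  assumes "ideal J A" "x \<in> carrier A" "y \<in> carrier A" "j \<in> J" "x = j \<oplus> y"
  shows "J +> x = J +> y"
proof -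
  interpret J: ideal J A by fact
  have "x \<in> J +> y" using assms by (auto simp: a_r_coset_def')
  then show ?thesis
    using abelian_group.a_repr_independence[OF A.is_abelian_group _ assms(3) J.a_subgroup] by metis
qed

context fin_digraph
begin

context
  fixes F :: "('k::field, ('a, 'b) generator free_word \<Rightarrow>\<^sub>0 'k) module"
    and I N :: "(('a, 'b) generator free_word \<Rightarrow>\<^sub>0 'k) set"
    and U :: "('a, 'b) generator free_word \<Rightarrow>\<^sub>0 'k"
  defines "F \<equiv> free_algebra (generators G)"
    and "I \<equiv> leavitt_ideal G"
    and "N \<equiv> nonunital_part (generators G)"
    and "U \<equiv> (\<Sum>v\<in>verts G. letter (Vert v))"
begin

lemma F_ops: "mult F = (*)" "add F = (+)" "one F = 1" "zero F = 0" "smult F = (\<lambda>a f. Poly_Mapping.single 0 a * f)"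
  by (simp_all add: F_def free_algebra_def)

lemma fa: "field_algebra F"
  unfolding F_def by (rule field_algebra_free_algebra)

lemma I_ideal: "ideal I F"
  unfolding F_def I_def by (rule ideal_leavitt)

lemma I_closed:
  "i \<in> I \<Longrightarrow> j \<in> I \<Longrightarrow> i + j \<in> I" "0 \<in> I"
  "i \<in> I \<Longrightarrow> c \<in> carrier F \<Longrightarrow> c * i \<in> I" 
  "i \<in> I \<Longrightarrow> c \<in> carrier F \<Longrightarrow> i * c \<in> I" 
proof -
  interpret ideal I F by (rule I_ideal)
  show "i \<in> I \<Longrightarrow> j \<in> I \<Longrightarrow> i + j \<in> I" "0 \<in> I"
  "i \<in> I \<Longrightarrow> c \<in> carrier F \<Longrightarrow> c * i \<in> I" 
  "i \<in> I \<Longrightarrow> c \<in> carrier F \<Longrightarrow> i * c \<in> I"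
    using additive_subgroup.a_closed[OF is_additive_subgroup, of i j]
      additive_subgroup.zero_closed[OF is_additive_subgroup] I_l_closed[of i c] I_r_closed[of i c] by (auto simp: F_ops)
qed

lemma I_minus: "i \<in> I \<Longrightarrow> - i \<in> I"
  using I_closed(3)[of i "- 1"] free_algebra_uminus[OF free_algebra_one, of "generators G"] unfolding F_def by simp

lemma I_sum: "(\<And>x. x \<in> S \<Longrightarrow> f x \<in> I) \<Longrightarrow> sum f S \<in> I"
  by (induction S rule: infinite_finite_induct) (auto simp: I_closed)

lemma rel_I: "r \<in> leavitt_relations G \<Longrightarrow> r \<in> I"
proof -
  assume r: "r \<in> leavitt_relations G"
  interpret F: field_algebra F by (rule fa)
  have "leavitt_relations G \<subseteq> carrier F"
    unfolding F_def using leavitt_relations_nonunital by (auto simp: nonunital_part_def)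
  then show ?thesis
    unfolding I_def leavitt_ideal_def using F.A.genideal_self r by (auto simp: F_def)
qed

lemma U_in: "U \<in> N" "U \<in> carrier F"
  unfolding U_def N_def nonunital_part_def F_def
  by (auto simp: lookup_sum_word intro!: free_algebra_sum free_algebra_letter generatorsI)

lemma U_vert:
  assumes "v \<in> verts G" 
  shows "U * letter (Vert v) - letter (Vert v) \<in> I" "letter (Vert v) * U - letter (Vert v) \<in> I"
proof -
  have e: "(\<Sum>w\<in>verts G. if w = v then letter (Vert v) else 0) = (letter (Vert v) :: _ \<Rightarrow>\<^sub>0 'k)"
    using assms by (simp add: sum.delta)
  have "(\<Sum>w\<in>verts G. letter (Vert w) * letter (Vert v) - (if w = v then letter (Vert v) else 0)) \<in> I"
  proof (intro I_sum rel_I)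
    fix w assume "w \<in> verts G"
    from leavitt_relations.V[OF this assms, where ?'k = 'k]
    show "letter (Vert w) * letter (Vert v) - (if w = v then letter (Vert v) else 0) \<in> (leavitt_relations G :: (_ \<Rightarrow>\<^sub>0 'k) set)"
      by (cases "w = v") simp_all
  qed
  then show "U * letter (Vert v) - letter (Vert v) \<in> I"
    unfolding sum_subtractf e U_def sum_distrib_right .
  have "(\<Sum>w\<in>verts G. letter (Vert v) * letter (Vert w) - (if w = v then letter (Vert v) else 0)) \<in> I"
  proof (intro I_sum rel_I)
    fix w assume "w \<in> verts G"
    from leavitt_relations.V[OF assms this, where ?'k = 'k]
    show "letter (Vert v) * letter (Vert w) - (if w = v then letter (Vert v) else 0) \<in> (leavitt_relations G :: (_ \<Rightarrow>\<^sub>0 'k) set)"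
      by (cases "w = v") simp_all
  qed
  then show "letter (Vert v) * U - letter (Vert v) \<in> I"
    unfolding sum_subtractf e U_def sum_distrib_left .
qed

lemma U_letter:
  assumes "x \<in> generators G" 
  shows "U * letter x - letter x \<in> I" "letter x * U - letter x \<in> I"
proof -
  have "U * letter x - letter x \<in> I \<and> letter x * U - letter x \<in> I"
  proof (cases "x \<in> Vert ` verts G")
    case True
    then show ?thesis using U_vert by auto
  next
    case False
    then have x: "x \<in> Arc ` arcs G \<union> Ghost ` arcs G" using assms by (auto simp: generators_def)
    then have st: "gen_source G x \<in> verts G" "gen_target G x \<in> verts G" by auto
    let ?s = "letter (Vert (gen_source G x)) :: _ \<Rightarrow>\<^sub>0 'k" and ?t = "letter (Vert (gen_target G x)) :: _ \<Rightarrow>\<^sub>0 'k"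
    have xc: "letter x \<in> carrier F" using assms by (simp add: F_def free_algebra_letter)
    have 1: "?s * letter x - letter x \<in> I" "letter x * ?t - letter x \<in> I"
      using x by (auto intro!: rel_I leavitt_relations.intros)
    have "U * letter x - letter x = - (U * (?s * letter x - letter x)) + (U * ?s - ?s) * letter x + (?s * letter x - letter x)"
      by (simp add: algebra_simps)
    also have "\<dots> \<in> I" using 1 U_vert[OF st(1)] U_in xc by (intro I_closed I_minus)
    finally have 2: "U * letter x - letter x \<in> I" .
    have "letter x * U - letter x = - ((letter x * ?t - letter x) * U) + letter x * (?t * U - ?t) + (letter x * ?t - letter x)"
      by (simp add: algebra_simps)
    also have "\<dots> \<in> I" using 1 U_vert[OF st(2)] U_in xc by (intro I_closed I_minus)
    finally show ?thesis using 2 by simp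
  qed
  then show "U * letter x - letter x \<in> I" "letter x * U - letter x \<in> I" by auto
qed

lemma U_single:
  assumes "set (letters w) \<subseteq> generators G" "w \<noteq> 0"
  shows "U * Poly_Mapping.single w a - Poly_Mapping.single w a \<in> I" 
    "Poly_Mapping.single w a * U - Poly_Mapping.single w a \<in> I"
proof -
  obtain xs where w: "w = Word xs" by (cases w)
  then have ne: "xs \<noteq> []" using assms by (auto simp: zero_free_word_def)
  have s: "Poly_Mapping.single w a = letter (hd xs) * Poly_Mapping.single (Word (tl xs)) a"
    "Poly_Mapping.single w a = Poly_Mapping.single (Word (butlast xs)) a * letter (last xs)"
    using ne by (auto simp: letter_def mult_single plus_free_word_def w)
  have g: "hd xs \<in> generators G" "last xs \<in> generators G" "set (tl xs) \<subseteq> generators G" "set (butlast xs) \<subseteq> generators G"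
    using ne assms by (auto simp: w list.set_sel dest: in_set_butlastD list.set_sel(2)[rotated])
  have c: "Poly_Mapping.single (Word (tl xs)) a \<in> carrier F" "Poly_Mapping.single (Word (butlast xs)) a \<in> carrier F"
    using g(3,4) by (auto simp: F_def carrier_free_algebra)
  have "(U * letter (hd xs) - letter (hd xs)) * Poly_Mapping.single (Word (tl xs)) a \<in> I"
    by (intro I_closed U_letter g c)
  then show "U * Poly_Mapping.single w a - Poly_Mapping.single w a \<in> I"
    unfolding s(1) by (simp add: algebra_simps)
  have "Poly_Mapping.single (Word (butlast xs)) a * (letter (last xs) * U - letter (last xs)) \<in> I"
    by (intro I_closed U_letter g c)
  then show "Poly_Mapping.single w a * U - Poly_Mapping.single w a \<in> I"
    unfolding s(2) by (simp add: algebra_simps)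
qed

lemma U_unit:
  assumes "f \<in> N"
  shows "U * f - f \<in> I" "f * U - f \<in> I"
proof -
  have f: "f = (\<Sum>w\<in>Poly_Mapping.keys f. Poly_Mapping.single w (Poly_Mapping.lookup f w))"
    by (intro poly_mapping_eqI) (simp add: lookup_sum_word lookup_single when_def in_keys_iff)
  have w: "set (letters w) \<subseteq> generators G" "w \<noteq> 0" if "w \<in> Poly_Mapping.keys f" for w
    using assms that by (auto simp: N_def nonunital_part_def carrier_free_algebra in_keys_iff)
  have "(\<Sum>w\<in>Poly_Mapping.keys f. U * Poly_Mapping.single w (Poly_Mapping.lookup f w) - Poly_Mapping.single w (Poly_Mapping.lookup f w)) \<in> I"
    by (intro I_sum U_single w)
  then show "U * f - f \<in> I"
    by (subst f, subst (2) f) (simp add: sum_subtractf sum_distrib_left)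
  have "(\<Sum>w\<in>Poly_Mapping.keys f. Poly_Mapping.single w (Poly_Mapping.lookup f w) * U - Poly_Mapping.single w (Poly_Mapping.lookup f w)) \<in> I"
    by (intro I_sum U_single w)
  then show "f * U - f \<in> I"
    by (subst f, subst (2) f) (simp add: sum_subtractf sum_distrib_right)
qed

lemma N_closed:
  "f \<in> N \<Longrightarrow> f \<in> carrier F"
  "f \<in> N \<Longrightarrow> g \<in> N \<Longrightarrow> f + g \<in> N" "f \<in> N \<Longrightarrow> g \<in> N \<Longrightarrow> f * g \<in> N" "0 \<in> N" "f \<in> N \<Longrightarrow> - f \<in> N"
  "f \<in> N \<Longrightarrow> Poly_Mapping.single 0 a * f \<in> N"
  by (auto simp: N_def nonunital_part_def F_def lookup_add lookup_mult_zero_word free_algebra_zero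
      intro!: free_algebra_add free_algebra_mult free_algebra_uminus free_algebra_scalar)

lemma leavitt_field_algebra: "field_algebra (leavitt_path_algebra G :: ('k, _) module)"
proof -
  let ?L = "leavitt_path_algebra G :: ('k, (('a, 'b) generator free_word \<Rightarrow>\<^sub>0 'k) set) module"
  let ?Q = "quotient_algebra F I"
  let ?c = "\<lambda>f. I +>\<^bsub>F\<^esub> f"
  interpret F: field_algebra F by (rule fa)
  interpret I: ideal I F by (rule I_ideal)
  interpret Q: field_algebra ?Q by (rule F.quotient_field_algebra[OF I_ideal])
  have L: "?L = ?Q\<lparr>carrier := ?c ` N, one := ?c U\<rparr>"
    by (simp add: leavitt_path_algebra_def Let_def F_def I_def N_def U_def)
  have car: "carrier ?L = ?c ` N" and one: "one ?L = ?c U" and z: "zero ?L = ?c 0"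
    using I.a_rcos_const[of 0] I_closed(2) by (auto simp: L quotient_algebra_def FactRing_def)
  have ops: "mult ?L = mult ?Q" "add ?L = add ?Q" "smult ?L = smult ?Q" by (simp_all add: L)
  have m: "?c f \<otimes>\<^bsub>?L\<^esub> ?c g = ?c (f * g)" if "f \<in> N" "g \<in> N" for f g
    using that I.rcoset_mult_add[of f g] N_closed(1) by (simp add: L quotient_algebra_def FactRing_def F_ops)
  have p: "?c f \<oplus>\<^bsub>?L\<^esub> ?c g = ?c (f + g)" if "f \<in> N" "g \<in> N" for f g
    using that I.a_rcos_sum[of f g] N_closed(1) by (simp add: L quotient_algebra_def FactRing_def F_ops)
  have s: "a \<odot>\<^bsub>?L\<^esub> ?c f = ?c (Poly_Mapping.single 0 a * f)" if "f \<in> N" for a f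
    using F.coset_smult[OF I_ideal N_closed(1)[OF that], of a] by (simp add: L quotient_algebra_def F_ops)
  have u: "?c (U * f) = ?c f" "?c (f * U) = ?c f" if "f \<in> N" for f
  proof -
    have "U * f \<in> N" "f * U \<in> N" using that N_closed U_in by auto
    then show "?c (U * f) = ?c f" "?c (f * U) = ?c f"
      using U_unit[OF that] N_closed(1) that
      by (intro F.coset_eqI[OF I_ideal, where j = "U * f - f"]
          F.coset_eqI[OF I_ideal, where j = "f * U - f"]; simp add: F_ops)+
  qed
  have "\<exists>y\<in>N. ?c y \<oplus>\<^bsub>?L\<^esub> ?c f = ?c 0" if "f \<in> N" for f
    using that N_closed by (intro bexI[of _ "- f"]) (simp_all add: p)
  then have "ring ?L"
    by (intro ringI abelian_groupI monoidI)
      (auto simp: car one z m p N_closed u U_in algebra_simps)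
  then show ?thesis
  proof (rule field_algebraI)
    have sm: "x * (Poly_Mapping.single 0 a * y) = Poly_Mapping.single 0 a * (x * y)" for a :: 'k and x y :: "('a, 'b) generator free_word \<Rightarrow>\<^sub>0 'k"
      by (simp add: scalar_commute flip: mult.assoc)
    show "x \<otimes>\<^bsub>?L\<^esub> (a \<odot>\<^bsub>?L\<^esub> y) = a \<odot>\<^bsub>?L\<^esub> (x \<otimes>\<^bsub>?L\<^esub> y)" if "x \<in> carrier ?L" "y \<in> carrier ?L" for a x y
      using that by (auto simp: car m s N_closed sm)
  qed (auto simp: car one m p s N_closed single_add distrib_left distrib_right mult.assoc
      mult_single [where k = 0 and l = 0, simplified, symmetric])
qed

end

end


section \<open>Right modules\<close>

text \<open>The fields \<^const>\<open>mult\<close> and \<^const>\<open>one\<close> are irrelevant, as for HOL-Algebra's modules.\<close>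

record ('r, 'm) right_module = "'m ring" +
  rsmult :: "['m, 'r] \<Rightarrow> 'm" (infixl \<open>\<star>\<index>\<close> 70)

locale right_module = R?: ring R + M?: abelian_group M
  for R :: "('r, 'x) ring_scheme" (structure)
    and M :: "('r, 'm, 'y) right_module_scheme" (structure) +
  assumes rsmult_closed [simp, intro]:
      "\<lbrakk>x \<in> carrier M; r \<in> carrier R\<rbrakk> \<Longrightarrow> x \<star>\<^bsub>M\<^esub> r \<in> carrier M"
    and rsmult_l_distr:
      "\<lbrakk>x \<in> carrier M; y \<in> carrier M; r \<in> carrier R\<rbrakk> \<Longrightarrow>
       (x \<oplus>\<^bsub>M\<^esub> y) \<star>\<^bsub>M\<^esub> r = x \<star>\<^bsub>M\<^esub> r \<oplus>\<^bsub>M\<^esub> y \<star>\<^bsub>M\<^esub> r"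
    and rsmult_r_distr:
      "\<lbrakk>x \<in> carrier M; r \<in> carrier R; s \<in> carrier R\<rbrakk> \<Longrightarrow>
       x \<star>\<^bsub>M\<^esub> (r \<oplus>\<^bsub>R\<^esub> s) = x \<star>\<^bsub>M\<^esub> r \<oplus>\<^bsub>M\<^esub> x \<star>\<^bsub>M\<^esub> s"
    and rsmult_assoc:
      "\<lbrakk>x \<in> carrier M; r \<in> carrier R; s \<in> carrier R\<rbrakk> \<Longrightarrow>
       x \<star>\<^bsub>M\<^esub> (r \<otimes>\<^bsub>R\<^esub> s) = x \<star>\<^bsub>M\<^esub> r \<star>\<^bsub>M\<^esub> s"
    and rsmult_one [simp]:
      "x \<in> carrier M \<Longrightarrow> x \<star>\<^bsub>M\<^esub> \<one>\<^bsub>R\<^esub> = x"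

definition regular_module :: "('r, 'x) ring_scheme \<Rightarrow> ('r, 'r) right_module" where
  "regular_module R =
     \<lparr>carrier = carrier R, mult = undefined, one = undefined, zero = \<zero>\<^bsub>R\<^esub>, add = add R,
      rsmult = mult R\<rparr>"

definition free_module :: "('r, 'x) ring_scheme \<Rightarrow> nat \<Rightarrow> ('r, nat \<Rightarrow> 'r) right_module" where
  "free_module R n =
     \<lparr>carrier = {..<n} \<rightarrow>\<^sub>E carrier R, mult = undefined, one = undefined,
      zero = (\<lambda>i\<in>{..<n}. \<zero>\<^bsub>R\<^esub>),
      add = (\<lambda>f g. \<lambda>i\<in>{..<n}. f i \<oplus>\<^bsub>R\<^esub> g i),
      rsmult = (\<lambda>f r. \<lambda>i\<in>{..<n}. f i \<otimes>\<^bsub>R\<^esub> r)\<rparr>"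

definition module_sum ::
    "('r, 'm, 'y) right_module_scheme \<Rightarrow> ('r, 'n, 'z) right_module_scheme \<Rightarrow>
     ('r, 'm \<times> 'n) right_module" where
  "module_sum M N =
     \<lparr>carrier = carrier M \<times> carrier N, mult = undefined, one = undefined,
      zero = (\<zero>\<^bsub>M\<^esub>, \<zero>\<^bsub>N\<^esub>),
      add = (\<lambda>(x, y) (x', y'). (x \<oplus>\<^bsub>M\<^esub> x', y \<oplus>\<^bsub>N\<^esub> y')),
      rsmult = (\<lambda>(x, y) r. (x \<star>\<^bsub>M\<^esub> r, y \<star>\<^bsub>N\<^esub> r))\<rparr>"

definition right_submodule ::
    "('r, 'x) ring_scheme \<Rightarrow> 'm set \<Rightarrow> ('r, 'm, 'y) right_module_scheme \<Rightarrow> bool" where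
  "right_submodule R N M \<longleftrightarrow>
     additive_subgroup N M \<and> (\<forall>x\<in>N. \<forall>r\<in>carrier R. x \<star>\<^bsub>M\<^esub> r \<in> N)"

definition quotient_module ::
    "('r, 'm, 'y) right_module_scheme \<Rightarrow> 'm set \<Rightarrow> ('r, 'm set) right_module" where
  "quotient_module M N =
     \<lparr>carrier = a_rcosets\<^bsub>M\<^esub> N, mult = undefined, one = undefined, zero = N, add = set_add M,
      rsmult = (\<lambda>C r. \<Union>x\<in>C. N +>\<^bsub>M\<^esub> (x \<star>\<^bsub>M\<^esub> r))\<rparr>"

definition right_module_iso ::
    "('r, 'x) ring_scheme \<Rightarrow> ('r, 'm, 'y) right_module_scheme \<Rightarrow>
     ('r, 'n, 'z) right_module_scheme \<Rightarrow> bool" where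
  "right_module_iso R M N \<longleftrightarrow>
     (\<exists>h \<in> iso (add_monoid M) (add_monoid N).
        \<forall>x\<in>carrier M. \<forall>r\<in>carrier R. h (x \<star>\<^bsub>M\<^esub> r) = h x \<star>\<^bsub>N\<^esub> r)"


section \<open>The properties of algebras\<close>

text \<open>
  The module \<open>P\<close> has elements of the same type as \<open>R\<^sup>m\<close>.  This is no restriction:
  see lemma \<open>UGN_any_universe\<close> below.
\<close>

definition UGN :: "('r, 'x) ring_scheme \<Rightarrow> bool" where
  "UGN R \<longleftrightarrow>
     (\<forall>m n (P :: ('r, nat \<Rightarrow> 'r) right_module).
        right_module R P \<and>
        right_module_iso R (free_module R m) (module_sum (free_module R n) P) \<longrightarrow> m \<ge> n)"

lemma UGN_any_universe:
  fixes P :: "('r, 'p) right_module"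
  assumes "UGN R" "right_module R P"
    and "right_module_iso R (free_module R m) (module_sum (free_module R n) P)"
  shows "m \<ge> n"
proof -
  interpret P: right_module R P by fact
  obtain h where h: "h \<in> iso (add_monoid (free_module R m)) (add_monoid (module_sum (free_module R n) P))"
    and hr: "\<And>x r. x \<in> carrier (free_module R m) \<Longrightarrow> r \<in> carrier R \<Longrightarrow>
      h (x \<star>\<^bsub>free_module R m\<^esub> r) = h x \<star>\<^bsub>module_sum (free_module R n) P\<^esub> r"
    using assms(3) unfolding right_module_iso_def by blast
  let ?M = "free_module R m" and ?N = "free_module R n"
  have hom: "h \<in> hom (add_monoid ?M) (add_monoid (module_sum ?N P))" 
    and bij: "bij_betw h (carrier ?M) (carrier ?N \<times> carrier P)"
    using h by (auto simp: iso_def module_sum_def)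
  define z where "z = zero ?N"
  have z: "z \<in> carrier ?N" by (auto simp: z_def free_module_def)
  define j where "j = (\<lambda>p. inv_into (carrier ?M) h (z, p))"
  have j: "j p \<in> carrier ?M" "h (j p) = (z, p)" if "p \<in> carrier P" for p
  proof -
    have "(z, p) \<in> h ` carrier ?M" using bij that z by (simp add: bij_betw_def)
    then show "j p \<in> carrier ?M" "h (j p) = (z, p)"
      unfolding j_def by (rule inv_into_into, rule f_inv_into_f)
  qed
  define g where "g = (\<lambda>x. snd (h x))"
  have gj: "g (j p) = p" if "p \<in> carrier P" for p using j[OF that] by (simp add: g_def)
  define P' :: "('r, nat \<Rightarrow> 'r) right_module" where
    "P' = \<lparr>carrier = j ` carrier P, mult = undefined, one = undefined, zero = j \<zero>\<^bsub>P\<^esub>,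
      add = (\<lambda>x y. j (g x \<oplus>\<^bsub>P\<^esub> g y)), rsmult = (\<lambda>x r. j (g x \<star>\<^bsub>P\<^esub> r))\<rparr>"
  have inv: "\<exists>y\<in>carrier P. j (x \<oplus>\<^bsub>P\<^esub> y) = j \<zero>\<^bsub>P\<^esub>" if "x \<in> carrier P" for x
    using that by (intro bexI[of _ "\<ominus>\<^bsub>P\<^esub> x"]) (simp_all add: P.M.r_neg)
  have "abelian_group P'"
    by (rule abelian_groupI)
      (use inv in \<open>auto simp: P'_def gj P.M.add.m_assoc P.M.add.m_comm P.M.add.m_lcomm\<close>)
  then have "right_module R P'"
    by (intro right_module.intro right_module_axioms.intro P.R.ring_axioms)
     (auto simp: P'_def gj P.rsmult_l_distr P.rsmult_r_distr P.rsmult_assoc)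
  moreover have "right_module_iso R ?M (module_sum ?N P')"
  proof -
    define k where "k = (\<lambda>x. (fst (h x), j (snd (h x))))"
    have hx: "fst (h x) \<in> carrier ?N" "snd (h x) \<in> carrier P" if "x \<in> carrier ?M" for x
      using bij_betwE[OF bij] that by (auto simp: mem_Times_iff)
    have "bij_betw (\<lambda>(a, p). (a, j p)) (carrier ?N \<times> carrier P) (carrier ?N \<times> j ` carrier P)"
      unfolding bij_betw_def by (auto simp: inj_on_def) (metis gj)
    from bij_betw_trans[OF bij this] have "bij_betw k (carrier ?M) (carrier (module_sum ?N P'))"
      by (simp add: k_def comp_def case_prod_beta' module_sum_def P'_def)
    moreover have "k \<in> hom (add_monoid ?M) (add_monoid (module_sum ?N P'))"
    proof (rule homI)
      fix x assume "x \<in> carrier (add_monoid ?M)"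
      then show "k x \<in> carrier (add_monoid (module_sum ?N P'))"
        using hx[of x] by (simp add: k_def module_sum_def P'_def)
    next
      fix x y assume xy: "x \<in> carrier (add_monoid ?M)" "y \<in> carrier (add_monoid ?M)"
      have "h (x \<oplus>\<^bsub>?M\<^esub> y) = h x \<oplus>\<^bsub>module_sum ?N P\<^esub> h y"
        using hom_mult[OF hom xy] by simp
      then show "k (x \<otimes>\<^bsub>add_monoid ?M\<^esub> y) = k x \<otimes>\<^bsub>add_monoid (module_sum ?N P')\<^esub> k y"
        using hx[of x] hx[of y] xy by (simp add: k_def module_sum_def P'_def gj case_prod_beta)
    qed
    moreover have "k (x \<star>\<^bsub>?M\<^esub> r) = k x \<star>\<^bsub>module_sum ?N P'\<^esub> r" if "x \<in> carrier ?M" "r \<in> carrier R" for x r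
      using hr[OF that] hx[OF that(1)] by (simp add: k_def module_sum_def P'_def gj case_prod_beta)
    ultimately show ?thesis unfolding right_module_iso_def iso_def by auto
  qed
  ultimately show ?thesis using assms(1) unfolding UGN_def by blast
qed

definition fin_dim_on :: "('k::field, 'a) module \<Rightarrow> 'a set \<Rightarrow> bool" where
  "fin_dim_on A W \<longleftrightarrow> vectorspace.fin_dim class_ring (A\<lparr>carrier := W\<rparr>)"

definition dim_on :: "('k::field, 'a) module \<Rightarrow> 'a set \<Rightarrow> nat" where
  "dim_on A W = vectorspace.dim class_ring (A\<lparr>carrier := W\<rparr>)"

definition algebraically_amenable :: "('k::field, 'a) module \<Rightarrow> bool" where
  "algebraically_amenable A \<longleftrightarrow>
     (\<forall>\<epsilon>::real. \<forall>S. \<epsilon> > 0 \<and> finite S \<and> S \<subseteq> carrier A \<longrightarrow>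
        (\<exists>W. VectorSpace.subspace class_ring W A \<and> W \<noteq> {\<zero>\<^bsub>A\<^esub>} \<and> fin_dim_on A W \<and>
             (\<forall>a\<in>S. real (dim_on A ((a <#\<^bsub>A\<^esub> W) <+>\<^bsub>A\<^esub> W)) \<le> (1 + \<epsilon>) * real (dim_on A W))))"

definition has_nonzero_fin_dim_quotient :: "('k::field, 'a) module \<Rightarrow> bool" where
  "has_nonzero_fin_dim_quotient A \<longleftrightarrow>
     (\<exists>J. ideal J A \<and> carrier (quotient_algebra A J) \<noteq> {\<zero>\<^bsub>quotient_algebra A J\<^esub>} \<and>
          vectorspace.fin_dim class_ring (quotient_algebra A J))"

end

theory Submission
  imports Defs "HOL-Library.Sublist"
begin

text \<open>
  Amenability and the existence of a nonzero finite dimensional quotient both yield the rank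
  condition: a square identity matrix of size \<open>n\<close> factors through size \<open>m\<close> only for
  \<open>n \<le> m\<close>.  The rank condition gives UGN, and it excludes \<open>doubling\<close>, that is, elements with
  \<open>a x = b y = 1\<close> and \<open>a y = b x = 0\<close>.  Doubling contradicts UGN and is equivalent to the square of
  the ring being a quotient module of the ring.

  A maximal sink or cycle provides a vertex \<open>v\<close> for which the set of paths \<open>p\<close> reaching \<open>v\<close> only
  at their end is finite, and at which there is at most one first return path \<open>c\<close>.  The paths
  \<open>p c\<^sup>k\<close> with \<open>k < n\<close> span nearly invariant subspaces, and identifying \<open>c\<close> with the identity gives
  a finite dimensional representation.

  Without maximal sinks and cycles, every vertex \<open>v\<close> is a finite sum of elements \<open>p p\<^sup>*\<close> for paths
  \<open>p\<close> that end below a vertex lying on two incomparable closed paths.  Infinitely many pairwise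
  incomparable paths \<open>\<alpha>\<close> then end there, and suitable sums of the products \<open>\<alpha> p\<^sup>*\<close> and \<open>p \<alpha>\<^sup>*\<close>
  witness doubling.
\<close>

section \<open>Cycles and first returns\<close>

text \<open>The rank condition is the hub because it speaks of matrix equations: these pass to
  quotients, and an almost invariant subspace refutes a forbidden one by counting dimensions. Linear
  independence in the Leavitt path algebra is detected by a representation instead of a basis. Its
  points are pairs \<open>(p, k)\<close> standing for \<open>p c^k\<close>, with \<open>k\<close>
  read modulo \<open>m\<close>. Closing up the powers of \<open>c\<close> cyclically makes the
  relations at \<open>v\<close> hold exactly on finitely many points. The case \<open>m = 1\<close>
  is the one behind the quotient; \<open>m = n\<close> separates the powers \<open>c^k\<close> with
  \<open>k < n\<close> and so bounds the dimension of the almost invariant subspaces from below. In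
  the other direction the obstacle is to find a branching vertex above every cycle and every sink.
  If a cycle has none above it, then among the vertices on cycles above it one with fewest ancestors
  yields a maximal cycle; a sink with none above it is maximal or has such a cycle above it.\<close>

lemma (in wf_digraph) awalk_append_ex:
  "awalk u (p @ q) w \<longleftrightarrow> (\<exists>v. awalk u p v \<and> awalk v q w)"
  using awalk_appendI by auto

lemma (in wf_digraph) awalk_tail_hd:
  "awalk u p v \<Longrightarrow> p \<noteq> [] \<Longrightarrow> tail G (hd p) = u"
  by (cases p) (auto simp: awalk_Cons_iff)

lemma (in wf_digraph) awalk_tails_heads:
  "awalk u p v \<Longrightarrow> map (tail G) p @ [v] = u # map (head G) p"
  by (induction p arbitrary: u) (auto simp: awalk_simps)

text \<open>For a closed walk \<open>awalk_tails_heads\<close> makes tails and heads equal as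
  multisets. Tails are preferred because \<open>vertices_on\<close> and
  \<open>first_arrivals\<close> are phrased with them.\<close>

lemma (in wf_digraph) cycle_iff_distinct_tails:
  "cycle p \<longleftrightarrow> p \<noteq> [] \<and> (\<exists>u. awalk u p u) \<and> distinct (map (tail G) p)"
proof -
  have "distinct (tl (awalk_verts u p)) \<longleftrightarrow> distinct (map (tail G) p)" if "awalk u p u" "p \<noteq> []" for u
  proof -
    have "tl (awalk_verts u p) = map (head G) p"
      using that awalk_verts_conv'[of u p u] by (auto simp: awalk_def)
    moreover have "mset (map (tail G) p) = mset (map (head G) p)"
      using arg_cong[OF awalk_tails_heads[OF that(1)], of mset] by simp
    ultimately show ?thesis using mset_eq_imp_distinct_iff by metis
  qed
  then show ?thesis unfolding cycle_def by blast
qed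

lemma (in wf_digraph) cycle_has_arc: "cycle p \<Longrightarrow> \<exists>e. e \<in> set p"
  unfolding cycle_iff_distinct_tails by (cases p) auto

text \<open>A repeated tail cuts out a closed subwalk between its two occurrences. It is shorter
  than \<open>p\<close>, since the second occurrence is left out, so the induction ends at a closed
  walk with distinct tails.\<close>

lemma (in wf_digraph) walk_contains_cycle:
  assumes "awalk u p v" "\<not> distinct (map (tail G) p)"
  shows "\<exists>q. cycle q \<and> set q \<subseteq> set p"
  using assms
proof (induction "length p" arbitrary: u v p rule: less_induct)
  case less
  obtain xs ys zs y where "map (tail G) p = xs @ [y] @ ys @ [y] @ zs"
    using not_distinct_decomp[OF less.prems(2)] by blast
  then obtain a e b f c where p: "p = a @ (e # b) @ (f # c)" and t: "tail G e = y" "tail G f = y"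
    by (auto simp: map_eq_append_conv map_eq_Cons_conv append_eq_map_conv Cons_eq_map_conv)
  have w: "awalk y (e # b) y"
    using less.prems(1) t unfolding p awalk_append_ex by (auto simp: awalk_Cons_iff)
  show ?case
  proof (cases "distinct (map (tail G) (e # b))")
    case True
    then have "cycle (e # b)" using w cycle_iff_distinct_tails by blast
    then show ?thesis using p by (intro exI[of _ "e # b"]) auto
  next
    case False
    from less.hyps[OF _ w False] obtain q where "cycle q" "set q \<subseteq> set (e # b)" using p by auto
    then show ?thesis using p by auto
  qed
qed

lemma (in wf_digraph) closed_walk_contains_cycle:
  assumes "awalk u p u" "p \<noteq> []"
  shows "\<exists>q. cycle q \<and> set q \<subseteq> set p"
  using assms walk_contains_cycle cycle_iff_distinct_tails by blast

lemma (in wf_digraph) tail_reachable_end: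
  assumes "awalk u p v" "e \<in> set p" shows "tail G e \<rightarrow>\<^sup>* v"
proof -
  obtain a b where "p = a @ e # b" using assms(2) by (meson split_list)
  then have "awalk (tail G e) (e # b) v" using assms(1) by (auto simp: awalk_append_ex awalk_Cons_iff simp del: awalk_append_iff)
  then show ?thesis using reachable_awalk by blast
qed

lemma rotation_class_self: "p \<in> rotation_class p"
  unfolding rotation_class_def by (auto intro: image_eqI[of _ _ 0])

lemma rotation_class_subset: "q \<in> rotation_class p \<Longrightarrow> rotation_class q \<subseteq> rotation_class p"
  unfolding rotation_class_def by (auto simp: rotate_rotate)

lemma rotation_class_append_commute: "rotation_class (a @ b) = rotation_class (b @ a)"
proof -
  have "b @ a \<in> rotation_class (a @ b)" for a b :: "'x list"
    unfolding rotation_class_def using rotate_append[of a b] by (metis rangeI)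
  then show ?thesis using rotation_class_subset by (intro equalityI) blast+
qed

lemma rotation_class_eq: "q \<in> rotation_class p \<Longrightarrow> rotation_class q = rotation_class p"
proof -
  assume "q \<in> rotation_class p"
  then obtain k where "q = drop k p @ take k p"
    by (auto simp: rotation_class_def rotate_drop_take)
  then show ?thesis
    using rotation_class_append_commute[of "drop k p" "take k p"] by simp
qed

lemma vertices_on_rotation_class: "vertices_on G (Cycle (rotation_class p)) = tail G ` set p"
  by (auto simp: rotation_class_def)

lemma (in wf_digraph) cycle_based_at:
  assumes "cycle p" "x \<in> tail G ` set p"
  obtains c where "cycle c" "awalk x c x" "rotation_class c = rotation_class p"
proof -
  obtain e where "e \<in> set p" "tail G e = x" using assms(2) by auto
  then obtain a b where p: "p = a @ e # b" by (meson split_list)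
  obtain u where "awalk u p u" and d: "distinct (map (tail G) p)"
    using assms(1) cycle_iff_distinct_tails by blast
  then obtain w where "awalk u a w" "awalk w (e # b) u"
    unfolding p awalk_append_ex by blast
  moreover from this have "w = x" using \<open>tail G e = x\<close> by (simp add: awalk_Cons_iff)
  ultimately have w: "awalk x ((e # b) @ a) x" using awalk_appendI by blast
  have "distinct (map (tail G) ((e # b) @ a))" using d unfolding p by auto
  then have "cycle ((e # b) @ a)" using w cycle_iff_distinct_tails by blast
  then show ?thesis
    using that[OF _ w] rotation_class_append_commute[of a "e # b"] p by simp
qed

text \<open>A rotation of \<open>c\<close> by \<open>j\<close> starts at the tail of the arc
  \<open>c ! j\<close>. Both walks start at \<open>x\<close> and the tails of \<open>c\<close> are
  distinct, so \<open>j = 0\<close>.\<close>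

lemma (in wf_digraph) cycle_at_unique:
  assumes "cycle c" "awalk x c x" "awalk x d x" "rotation_class c = rotation_class d"
  shows "c = d"
proof -
  have c: "c \<noteq> []" "distinct (map (tail G) c)" using assms(1) cycle_iff_distinct_tails by auto
  have "d \<in> rotation_class c" using assms(4) rotation_class_self by auto
  then obtain k where "d = rotate k c" unfolding rotation_class_def by blast
  then have d: "d = rotate (k mod length c) c" using rotate_conv_mod[of k c] by simp
  define j where "j = k mod length c"
  have j: "j < length c" using c by (simp add: j_def)
  have "tail G (hd d) = x" "tail G (hd c) = x"
    using awalk_tail_hd[OF assms(2)] awalk_tail_hd[OF assms(3)] c d by auto
  moreover have "hd d = c ! j" using c j unfolding d j_def[symmetric] by (simp add: hd_rotate_conv_nth)
  ultimately have "map (tail G) c ! j = map (tail G) c ! 0" using j c by (simp add: hd_conv_nth)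
  then have "j = 0" using c j using nth_eq_iff_index_eq[of "map (tail G) c" j 0] by auto
  then show ?thesis using d j_def by simp
qed

text \<open>Every vertex of a walk but the last is the tail of one of its arcs, so the condition on
  tails says that \<open>v\<close> is met only at the end. The empty walk at \<open>v\<close>
  counts.\<close>

definition first_arrivals :: "('v, 'e) pre_digraph \<Rightarrow> 'v \<Rightarrow> 'e list set" where
  "first_arrivals G v = {p. (\<exists>y. pre_digraph.awalk G y p v) \<and> v \<notin> tail G ` set p}"

definition first_return :: "('v, 'e) pre_digraph \<Rightarrow> 'v \<Rightarrow> 'e list \<Rightarrow> bool" where
  "first_return G v c \<longleftrightarrow> c \<noteq> [] \<and> pre_digraph.awalk G v c v \<and> tl c \<in> first_arrivals G v"

text \<open>Equivalently, \<open>u\<close> has two different first returns: otherwise all closed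
  walks at \<open>u\<close> are powers of a single walk, hence comparable.\<close>

definition core :: "('v, 'e) pre_digraph \<Rightarrow> 'v \<Rightarrow> bool" where
  "core G u \<longleftrightarrow> (\<exists>c d. pre_digraph.awalk G u c u \<and> pre_digraph.awalk G u d u \<and> parallel c d)"

context fin_digraph
begin

lemma maximal_in_iff:
  "maximal_in G u \<longleftrightarrow> u \<in> sinks_and_cycles G \<and>
     (\<forall>s. s \<in> sinks G \<and> leads_to G (Sink s) u \<longrightarrow> Sink s = u) \<and>
     (\<forall>q. cycle q \<and> leads_to G (Cycle (rotation_class q)) u \<longrightarrow> Cycle (rotation_class q) = u)"
  unfolding maximal_in_def sinks_and_cycles_def cycle_classes_def by blast

lemma finite_distinct_walks: "finite {p. set p \<subseteq> arcs G \<and> distinct p}"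
  by (rule finite_subset_distinct) (rule finite_arcs)

lemma finite_first_arrivals:
  assumes "\<And>p y. awalk y p v \<Longrightarrow> v \<notin> tail G ` set p \<Longrightarrow> distinct (map (tail G) p)"
  shows "finite (first_arrivals G v)"
proof (rule finite_subset[OF _ finite_distinct_walks])
  show "first_arrivals G v \<subseteq> {p. set p \<subseteq> arcs G \<and> distinct p}"
    unfolding first_arrivals_def using assms by (auto simp: distinct_map awalk_def)
qed

text \<open>By maximality every cycle leading to \<open>u\<close> is \<open>u\<close> itself. For a
  sink this excludes cycles on walks into it. For a cycle through \<open>v\<close>, a cycle found on
  an arrival would have to contain \<open>v\<close>, which arrivals avoid. So arrivals repeat no
  vertex, and a first return is itself a cycle, namely \<open>u\<close> based at
  \<open>v\<close>.\<close>

lemma maximal_imp_good_vertex: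
  assumes "maximal_in G u"
  obtains v where "v \<in> verts G" "finite (first_arrivals G v)"
    "\<And>c d. first_return G v c \<Longrightarrow> first_return G v d \<Longrightarrow> c = d"
    "out_arcs G v \<noteq> {} \<Longrightarrow> \<exists>c. first_return G v c"
proof -
  have u: "u \<in> sinks_and_cycles G" using assms maximal_in_iff by blast
  have max: "\<And>q. cycle q \<Longrightarrow> leads_to G (Cycle (rotation_class q)) u \<Longrightarrow> Cycle (rotation_class q) = u"
    using assms maximal_in_iff by blast
  \<comment> \<open>The form in which maximality is used: a cycle contained in a walk that ends on
    \<open>u\<close> leads to \<open>u\<close>.\<close>
  have via: "Cycle (rotation_class q) = u"
    if w: "cycle q" "set q \<subseteq> set p" "awalk y p v" "v \<in> vertices_on G u" for q p y v
  proof -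
    obtain e where "e \<in> set q" using cycle_has_arc[OF w(1)] by blast
    moreover from this have "tail G e \<rightarrow>\<^sup>* v" using w tail_reachable_end by blast
    ultimately have "leads_to G (Cycle (rotation_class q)) u"
      unfolding leads_to_def vertices_on_rotation_class using w(4) by blast
    then show ?thesis using max w(1) by blast
  qed
  from u consider v where "v \<in> sinks G" "u = Sink v" | c where "cycle c" "u = Cycle (rotation_class c)"
    unfolding sinks_and_cycles_def cycle_classes_def by blast
  then show ?thesis
  proof cases
    case 1
    have "distinct (map (tail G) p)" if w: "awalk y p v" for p y
    proof (rule ccontr)
      assume "\<not> ?thesis"
      then obtain q where "cycle q" "set q \<subseteq> set p" using walk_contains_cycle[OF w] by blast
      then show False using via[of q p y v] w 1 by simp
    qed
    then have "finite (first_arrivals G v)" by (intro finite_first_arrivals) blast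
    moreover have "\<not> first_return G v c" for c
      using 1 by (cases c) (auto simp: first_return_def awalk_Cons_iff sinks_def out_arcs_def)
    ultimately show ?thesis using 1 by (intro that) (auto simp: sinks_def)
  next
    case 2
    obtain v where c: "awalk v c v" "c \<noteq> []" "distinct (map (tail G) c)"
      using 2(1) cycle_iff_distinct_tails by blast
    then have v: "v \<in> tail G ` set c" by (cases c) (auto simp: awalk_Cons_iff)
    have dist: "distinct (map (tail G) p)" if w: "awalk y p v" "v \<notin> tail G ` set p" for p y
    proof (rule ccontr)
      assume "\<not> ?thesis"
      then obtain q where q: "cycle q" "set q \<subseteq> set p" using walk_contains_cycle[OF w(1)] by blast
      then have "Cycle (rotation_class q) = u"
        using via[of q p y v] w v 2 by (simp only: vertices_on_rotation_class)
      then have "v \<in> tail G ` set q" using v 2(2) vertices_on_rotation_class by metis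
      then show False using q w by auto
    qed
    have ret: "d = c" if "first_return G v d" for d
    proof -
      have "d \<noteq> []" "awalk v d v" "tl d \<in> first_arrivals G v"
        using that by (simp_all add: first_return_def)
      moreover from this obtain e p where "d = e # p" by (meson neq_Nil_conv)
      ultimately have d: "d = e # p" "awalk v d v" "v \<notin> tail G ` set p"
        by (simp_all add: first_arrivals_def)
      have "awalk (head G e) p v" "tail G e = v" using d(2) unfolding d(1) awalk_Cons_iff by blast+
      note d = d this
      then have "distinct (map (tail G) d)" using dist by auto
      then have "cycle d" using d cycle_iff_distinct_tails by blast
      moreover from this have "Cycle (rotation_class d) = u"
        using via[of d d v v] d(2) v 2 by (simp only: vertices_on_rotation_class)
      ultimately show ?thesis using cycle_at_unique d(2) c(1) 2 by simp
    qed
    have "first_return G v c"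
    proof -
      obtain e p where e: "c = e # p" using c(2) by (meson neq_Nil_conv)
      have "awalk (head G e) p v" "tail G e = v" using c(1) unfolding e awalk_Cons_iff by blast+
      moreover from this have "v \<notin> tail G ` set p" using c(3) by (auto simp: e)
      ultimately have "tl c \<in> first_arrivals G v" unfolding first_arrivals_def e list.sel by blast
      then show ?thesis unfolding first_return_def using c by blast
    qed
    moreover have "finite (first_arrivals G v)" using dist by (rule finite_first_arrivals)
    moreover have "v \<in> verts G" using c(1) by (rule awalk_hd_in_verts)
    ultimately show ?thesis using ret by (intro that[of v]) blast+
  qed
qed

section \<open>Maximal sinks and cycles from the absence of branching\<close>

lemma sink_reaches_only_itself:
  assumes "s \<in> sinks G" "s \<rightarrow>\<^sup>* x" shows "x = s"
proof -
  obtain p where "awalk s p x" using assms(2) reachable_awalk by blast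
  then show ?thesis using assms(1) by (cases p) (auto simp: awalk_simps sinks_def out_arcs_def)
qed

lemma closed_walk_successor:
  assumes "awalk z c z" "i < length c"
  shows "head G (c ! i) = tail G (c ! (Suc i mod length c))"
proof -
  have eq: "map (tail G) c @ [z] = z # map (head G) c" using awalk_tails_heads[OF assms(1)] .
  have "head G (c ! i) = (map (tail G) c @ [z]) ! Suc i" using assms(2) by (simp add: eq)
  moreover have "tail G (c ! 0) = z" using assms by (cases c) (auto simp: awalk_Cons_iff)
  ultimately show ?thesis using assms(2) by (cases "Suc i = length c") (auto simp: nth_append)
qed

lemma nth_concat_replicate:
  "i < n * length c \<Longrightarrow> concat (replicate n c) ! i = c ! (i mod length c)"
proof (induction n arbitrary: i)
  case (Suc n)
  then show ?case
    by (cases "i < length c") (auto simp: nth_append le_mod_geq)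
qed simp

lemma awalk_concat_replicate: "awalk z c z \<Longrightarrow> awalk z (concat (replicate n c)) z"
proof (induction n)
  case (Suc n)
  then show ?case using awalk_appendI by simp
qed (auto simp: awalk_simps)

lemma length_concat_replicate: "length (concat (replicate n c)) = n * length c"
  by (induction n) auto

text \<open>
  Comparing with the powers of \<open>c\<close> shows that the walk \<open>g q h\<close> runs around \<open>c\<close>, so \<open>q\<close>
  is a rotation of \<open>c\<close>.
\<close>

lemma cycle_in_same_component:
  assumes c: "cycle c" "awalk z c z" and q: "cycle q" "awalk s q s"
    and g: "awalk z g s" and h: "awalk s h z" and "\<not> core G z"
  shows "rotation_class q = rotation_class c"
proof -
  define n where "n = length c"
  define w where "w = g @ q @ h"
  \<comment> \<open>Repeating \<open>c\<close> as often as \<open>w\<close> has arcs makes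
    \<open>C\<close> at least as long as \<open>w\<close>, so that comparability can only mean that
    \<open>w\<close> is a prefix of \<open>C\<close>.\<close>
  define C where "C = concat (replicate (length w) c)"
  have n: "n > 0" and dc: "distinct (map (tail G) c)" using c cycle_iff_distinct_tails by (auto simp: n_def)
  have q0: "q \<noteq> []" and dq: "distinct (map (tail G) q)" using q cycle_iff_distinct_tails by auto
  have "awalk z w z" unfolding w_def using g h q(2) awalk_appendI by blast
  moreover have "awalk z C z" unfolding C_def using c(2) awalk_concat_replicate by blast
  ultimately have "prefix w C \<or> prefix C w"
    using \<open>\<not> core G z\<close> unfolding core_def by (blast intro: parallelI)
  moreover have len: "length C = length w * n" by (simp add: C_def length_concat_replicate n_def)
  then have "length w \<le> length C" using n by simp
  ultimately have "prefix w C" by (auto simp: prefix_def)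
  then have wc: "w ! i = c ! (i mod n)" if "i < length w" for i
  proof -
    have "C ! i = w ! i" using \<open>prefix w C\<close> that by (auto simp: prefix_def nth_append)
    moreover have "length w * 1 \<le> length w * length c" using n unfolding n_def by (intro mult_le_mono2) linarith
    then have "i < length w * length c" using that by linarith
    ultimately show ?thesis using nth_concat_replicate[of i "length w" c] by (simp add: C_def n_def)
  qed
  define k where "k = length g"
  define m where "m = length q"
  have m: "m > 0" using q0 by (simp add: m_def)
  have qc: "q ! j = c ! ((k + j) mod n)" if "j < m" for j
    using wc[of "k + j"] that by (simp add: w_def k_def m_def nth_append)
  \<comment> \<open>Read along the powers of \<open>c\<close>, the walk \<open>q\<close> occupies
    the positions \<open>k\<close> to \<open>k + m - 1\<close>. It returns to its starting vertex
    and the tails of \<open>c\<close> are distinct, so \<open>m\<close> is a multiple of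
    \<open>n\<close>; if it exceeded \<open>n\<close>, the first arc of \<open>q\<close> would recur
    in \<open>q\<close>.\<close>
  have "tail G (c ! ((k + m) mod n)) = tail G (c ! (k mod n))"
  proof -
    have "Suc ((k + (m - 1)) mod n) mod n = (k + m) mod n" using m by (simp add: mod_Suc_eq)
    then have "tail G (c ! ((k + m) mod n)) = head G (q ! (m - 1))"
      using closed_walk_successor[OF c(2), of "(k + (m - 1)) mod n"] qc[of "m - 1"] m n by (simp add: n_def)
    also have "\<dots> = tail G (q ! 0)"
      using closed_walk_successor[OF q(2), of "m - 1"] m by (simp add: m_def)
    finally show ?thesis using qc[of 0] m by simp
  qed
  then have "(k + m) mod n = k mod n"
    using nth_eq_iff_index_eq[OF dc, of "(k + m) mod n" "k mod n"] n by (simp add: n_def)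
  then have "n dvd m" using mod_eq_dvd_iff_nat[of k "k + m" n] by simp
  then have "n \<le> m" using m by (simp add: dvd_imp_le)
  moreover have False if "n < m"
  proof -
    have "q ! n = q ! 0" using qc[of n] qc[of 0] that by simp
    then show False using nth_eq_iff_index_eq[of q n 0] dq that n q0 unfolding m_def distinct_map by blast
  qed
  ultimately have "m = n" by fastforce
  then have "q = rotate k c"
    using qc by (intro nth_equalityI) (auto simp: m_def n_def nth_rotate)
  then show ?thesis using rotation_class_eq[of q c] by (auto simp: rotation_class_def)
qed

text \<open>Among the vertices on cycles that reach \<open>x\<close>, take one with fewest ancestors
  and a cycle \<open>c\<close> through it. A cycle leading to \<open>c\<close> has a vertex with no
  fewer ancestors, hence lies in the same strong component, where
  \<open>cycle_in_same_component\<close> leaves only rotations of \<open>c\<close>.\<close>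

lemma closed_walk_without_core:
  assumes "awalk x p x" "p \<noteq> []" and no_core: "\<And>u. u \<rightarrow>\<^sup>* x \<Longrightarrow> \<not> core G u"
  shows "\<exists>u. maximal_in G u"
proof -
  define K where "K = {z. z \<rightarrow>\<^sup>* x \<and> (\<exists>q. cycle q \<and> z \<in> tail G ` set q)}"
  define anc where "anc z = {y. y \<rightarrow>\<^sup>* z}" for z
  have fin: "finite (anc z)" for z
    by (rule finite_subset[of _ "verts G"]) (auto simp: anc_def reachable_in_verts)
  obtain q where q: "cycle q" "set q \<subseteq> set p" using closed_walk_contains_cycle assms by blast
  moreover obtain e where "e \<in> set q" using cycle_has_arc q by blast
  ultimately have "tail G e \<in> K"
    unfolding K_def using tail_reachable_end[OF assms(1)] by blast
  define z where "z = arg_min (\<lambda>z. card (anc z)) (\<lambda>z. z \<in> K)"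
  have z: "z \<in> K" unfolding z_def by (rule arg_min_natI) fact
  have min: "card (anc z) \<le> card (anc y)" if "y \<in> K" for y
    unfolding z_def using that by (rule arg_min_nat_le)
  from z have zx: "z \<rightarrow>\<^sup>* x" by (simp add: K_def)
  obtain q' where "cycle q'" "z \<in> tail G ` set q'" using z unfolding K_def by blast
  then obtain c where c: "cycle c" "awalk z c z" by (rule cycle_based_at)
  have c0: "c \<noteq> []" using c cycle_iff_distinct_tails by blast
  have to_z: "y \<rightarrow>\<^sup>* z" if "y \<in> tail G ` set c" for y
    using tail_reachable_end[OF c(2)] that by blast
  have "maximal_in G (Cycle (rotation_class c))"
    unfolding maximal_in_iff
  proof (intro conjI allI impI)
    show "Cycle (rotation_class c) \<in> sinks_and_cycles G"
      using c unfolding sinks_and_cycles_def cycle_classes_def by blast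
  next
    fix s assume s: "s \<in> sinks G \<and> leads_to G (Sink s) (Cycle (rotation_class c))"
    then obtain y where "y \<in> tail G ` set c" "s \<rightarrow>\<^sup>* y"
      unfolding leads_to_def vertices_on_rotation_class by auto
    then have "s \<in> tail G ` set c" using sink_reaches_only_itself s by blast
    then have "out_arcs G s \<noteq> {}" using c(2) by (auto simp: out_arcs_def awalk_def)
    then show "Sink s = Cycle (rotation_class c)" using s by (simp add: sinks_def)
  next
    fix q assume q: "cycle q \<and> leads_to G (Cycle (rotation_class q)) (Cycle (rotation_class c))"
    then obtain s y where s: "s \<in> tail G ` set q" "y \<in> tail G ` set c" "s \<rightarrow>\<^sup>* y"
      unfolding leads_to_def vertices_on_rotation_class by blast
    then have sz: "s \<rightarrow>\<^sup>* z" using to_z reachable_trans by blast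
    then have "s \<in> K" using s q zx reachable_trans unfolding K_def by blast
    moreover have "anc s \<subseteq> anc z" using sz reachable_trans unfolding anc_def by blast
    \<comment> \<open>Since \<open>z\<close> is its own ancestor, the equality shows that
      \<open>z\<close> reaches \<open>s\<close>.\<close>
    ultimately have "anc s = anc z" using min fin by (meson card_seteq)
    moreover have "z \<in> verts G" using zx reachable_in_verts by blast
    ultimately have zs: "z \<rightarrow>\<^sup>* s" unfolding anc_def by blast
    obtain q' where q': "cycle q'" "awalk s q' s" "rotation_class q' = rotation_class q"
      using cycle_based_at[OF _ s(1)] q by blast
    obtain g h where "awalk z g s" "awalk s h z" using zs sz reachable_awalk by blast
    then have "rotation_class q' = rotation_class c"
      using cycle_in_same_component[OF c q'(1,2)] no_core zx by blast
    then show "Cycle (rotation_class q) = Cycle (rotation_class c)" using q' by simp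
  qed
  then show ?thesis by blast
qed

text \<open>If \<open>Sink v\<close> is not maximal, then some cycle leads to it, and no branching
  vertex lies above that cycle either.\<close>

lemma sink_without_core:
  assumes "v \<in> sinks G" and no_core: "\<And>u. u \<rightarrow>\<^sup>* v \<Longrightarrow> \<not> core G u"
  shows "\<exists>u. maximal_in G u"
proof (rule ccontr)
  assume no_max: "\<not> ?thesis"
  then have "\<not> maximal_in G (Sink v)" by blast
  moreover have "s = v" if "s \<in> sinks G" "leads_to G (Sink s) (Sink v)" for s
    using that sink_reaches_only_itself by (auto simp: leads_to_def)
  ultimately obtain q where q: "cycle q" "leads_to G (Cycle (rotation_class q)) (Sink v)"
    using assms(1) unfolding maximal_in_iff sinks_and_cycles_def by blast
  then obtain s where s: "s \<in> tail G ` set q" "s \<rightarrow>\<^sup>* v"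
    unfolding leads_to_def vertices_on_rotation_class by auto
  obtain q' where q': "cycle q'" "awalk s q' s"
    using cycle_based_at[OF _ s(1)] q by blast
  moreover have "q' \<noteq> []" using q' cycle_iff_distinct_tails by blast
  moreover have "\<not> core G u" if "u \<rightarrow>\<^sup>* s" for u
    using no_core reachable_trans[OF that s(2)] by blast
  ultimately show False using closed_walk_without_core no_max by blast
qed

end

section \<open>The rank condition\<close>

text \<open>Gaussian elimination, with an unknown for each element of \<open>I\<close> and an
  equation for each element of \<open>J\<close>.\<close>

lemma underdetermined_system:
  fixes c :: "'i \<Rightarrow> 'j \<Rightarrow> 'k::field"
  assumes "finite J" "finite I" "card J < card I"
  shows "\<exists>f. (\<exists>i\<in>I. f i \<noteq> 0) \<and> (\<forall>j\<in>J. (\<Sum>i\<in>I. f i * c i j) = 0)"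
  using assms
proof (induction J arbitrary: I c rule: finite_induct)
  case empty
  then obtain i where "i \<in> I" by fastforce
  then show ?case by (intro exI[of _ "\<lambda>_. 1"]) auto
next
  case (insert j0 J)
  show ?case
  proof (cases "\<forall>i\<in>I. c i j0 = 0")
    case True
    have "card J < card I" using insert by simp
    then obtain f where "\<exists>i\<in>I. f i \<noteq> 0" "\<forall>j\<in>J. (\<Sum>i\<in>I. f i * c i j) = 0"
      using insert.IH[OF insert.prems(1)] by blast
    then show ?thesis using True by (intro exI[of _ f]) auto
  next
    case False
    then obtain i0 where i0: "i0 \<in> I" "c i0 j0 \<noteq> 0" by blast
    \<comment> \<open>The coefficients of equation \<open>j\<close> after the unknown
      \<open>i0\<close> has been eliminated by means of equation \<open>j0\<close>.\<close>
    define c' where "c' i j = c i j - c i j0 / c i0 j0 * c i0 j" for i j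
    have "card J < card (I - {i0})" using insert i0 by simp
    then obtain f where f: "\<exists>i\<in>I - {i0}. f i \<noteq> 0" "\<forall>j\<in>J. (\<Sum>i\<in>I - {i0}. f i * c' i j) = 0"
      using insert.IH[of "I - {i0}" c'] insert.prems(1) by blast
    define s where "s = (\<Sum>i\<in>I - {i0}. f i * c i j0)"
    \<comment> \<open>The value at \<open>i0\<close> is the one that solves equation
      \<open>j0\<close>.\<close>
    define g where "g = f(i0 := - s / c i0 j0)"
    have sum_g: "(\<Sum>i\<in>I. g i * c i j) = (\<Sum>i\<in>I - {i0}. f i * c i j) - s / c i0 j0 * c i0 j" for j
    proof -
      have "(\<Sum>i\<in>I - {i0}. g i * c i j) = (\<Sum>i\<in>I - {i0}. f i * c i j)"
        by (intro sum.cong) (auto simp: g_def)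
      then show ?thesis using insert.prems(1) i0 by (subst sum.remove[of I i0]) (auto simp: g_def)
    qed
    have "(\<Sum>i\<in>I. g i * c i j) = 0" if "j \<in> J" for j
    proof -
      have "0 = (\<Sum>i\<in>I - {i0}. f i * c' i j)" using f that by simp
      also have "\<dots> = (\<Sum>i\<in>I - {i0}. f i * c i j) - (\<Sum>i\<in>I - {i0}. f i * c i j0 * (c i0 j / c i0 j0))"
        by (simp add: c'_def sum_subtractf algebra_simps)
      also have "\<dots> = (\<Sum>i\<in>I. g i * c i j)"
        unfolding sum_g s_def by (simp add: sum_distrib_right sum_divide_distrib)
      finally show ?thesis by simp
    qed
    moreover have "(\<Sum>i\<in>I. g i * c i j0) = 0" unfolding sum_g using i0 by (simp add: s_def)
    moreover have "\<exists>i\<in>I. g i \<noteq> 0" using f(1) by (auto simp: g_def)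
    ultimately show ?thesis by (intro exI[of _ g]) auto
  qed
qed

text \<open>The matrix form of: there is no epimorphism from \<open>R^m\<close> onto
  \<open>R^n\<close> with \<open>m < n\<close>. Such an epimorphism splits, and the splitting is
  \<open>b\<close>. The case \<open>m = 0\<close> excludes the zero ring.\<close>

definition rank_condition :: "('a, 'b) ring_scheme \<Rightarrow> bool" where
  "rank_condition R \<longleftrightarrow> (\<forall>(m::nat) (n::nat) a b.
     (\<forall>i<n. \<forall>j<m. a i j \<in> carrier R \<and> b j i \<in> carrier R) \<and>
     (\<forall>i<n. \<forall>l<n. (\<Oplus>\<^bsub>R\<^esub>j\<in>{..<m}. a i j \<otimes>\<^bsub>R\<^esub> b j l) = (if i = l then \<one>\<^bsub>R\<^esub> else \<zero>\<^bsub>R\<^esub>)) \<longrightarrow>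
     n \<le> m)"

section \<open>Spans, dimensions and linear combinations inside an algebra\<close>

context field_algebra
begin

lemma subspaceI:
  assumes "W \<subseteq> carrier A" "\<zero> \<in> W" "\<And>x y. x \<in> W \<Longrightarrow> y \<in> W \<Longrightarrow> x \<oplus> y \<in> W"
    "\<And>a x. x \<in> W \<Longrightarrow> a \<odot> x \<in> W"
  shows "VectorSpace.subspace class_ring W A"
  by (intro subspace.intro submodule.intro) (use assms vectorspace_axioms module_axioms in auto)

lemma subspaceD:
  assumes "VectorSpace.subspace class_ring W A"
  shows "W \<subseteq> carrier A" "\<zero> \<in> W" "\<And>x y. x \<in> W \<Longrightarrow> y \<in> W \<Longrightarrow> x \<oplus> y \<in> W"
    "\<And>a x. x \<in> W \<Longrightarrow> a \<odot> x \<in> W"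
  using assms unfolding subspace_def submodule_def by auto

lemma span_subset:
  assumes "VectorSpace.subspace class_ring W A" "X \<subseteq> W" shows "span X \<subseteq> W"
  using assms by (intro span_is_subset) auto

lemma smult_in_carrier [simp]: "x \<in> carrier A \<Longrightarrow> a \<odot> x \<in> carrier A"
  by (rule smult_closed) auto

lemma dim_on_span:
  assumes "finite X" "X \<subseteq> carrier A"
  shows "fin_dim_on A (span X)" "dim_on A (span X) \<le> card X"
proof -
  have sub: "VectorSpace.subspace class_ring (span X) A" using assms(2) by (rule span_is_subspace)
  interpret W: vectorspace class_ring "vs (span X)" by (rule subspace_is_vs[OF sub])
  have "X \<subseteq> span X" using assms(2) by (rule in_own_span)
  moreover from this have "W.span X = span X"
    using sub by (intro span_li_not_depend(1)) auto
  ultimately have "X \<subseteq> carrier (vs (span X))" "W.gen_set X" by auto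
  then show "fin_dim_on A (span X)" "dim_on A (span X) \<le> card X"
    unfolding fin_dim_on_def dim_on_def using assms(1) W.gen_ge_dim[of X] unfolding W.fin_dim_def by blast+
qed

lemma subspace_basis:
  assumes sub: "VectorSpace.subspace class_ring W A" and "fin_dim_on A W"
  obtains B where "finite B" "B \<subseteq> carrier A" "lin_indpt B" "span B = W" "card B = dim_on A W"
proof -
  interpret W: vectorspace class_ring "vs W" by (rule subspace_is_vs[OF sub])
  obtain B where B: "finite B" "W.basis B"
    using W.finite_basis_exists assms(2) unfolding fin_dim_on_def by blast
  have BW: "B \<subseteq> W" using B(2) by (simp add: W.basis_def)
  have "lin_indpt B" "span B = W"
    using B(2) span_li_not_depend[OF BW] sub by (auto simp: W.basis_def)
  moreover have "card B = dim_on A W" using W.dim_basis[OF B] by (simp add: dim_on_def)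
  ultimately show ?thesis using that B(1) BW subspaceD(1)[OF sub] by blast
qed

lemma lin_indpt_card_le_dim_on:
  assumes sub: "VectorSpace.subspace class_ring W A" and "fin_dim_on A W" "B \<subseteq> W" "lin_indpt B"
  shows "finite B" "card B \<le> dim_on A W"
proof -
  interpret W: vectorspace class_ring "vs W" by (rule subspace_is_vs[OF sub])
  have "W.lin_indpt B" using span_li_not_depend(2)[OF assms(3)] sub assms(4) by auto
  then show "finite B" "card B \<le> dim_on A W"
    using W.li_le_dim[of B] assms(2,3) unfolding fin_dim_on_def dim_on_def by auto
qed

lemma dim_on_mono:
  assumes "VectorSpace.subspace class_ring W A" "fin_dim_on A W"
    and "VectorSpace.subspace class_ring W' A" "fin_dim_on A W'" "W \<subseteq> W'"
  shows "dim_on A W \<le> dim_on A W'"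
proof -
  obtain B where B: "finite B" "B \<subseteq> carrier A" "lin_indpt B" "span B = W" "card B = dim_on A W"
    using subspace_basis assms(1,2) by blast
  then have "B \<subseteq> W'" using in_own_span assms(5) by blast
  then show ?thesis using lin_indpt_card_le_dim_on(2)[OF assms(3,4) _ B(3)] B(5) by simp
qed

lemma extend_to_spanning_set:
  assumes "finite B" "lin_indpt B" "B \<subseteq> W"
    and W: "VectorSpace.subspace class_ring W A" "fin_dim_on A W"
  obtains C where "finite C" "C \<subseteq> carrier A" "span (B \<union> C) = W" "int (card C) \<le> int (dim_on A W) - int (card B)"
proof -
  obtain D where D: "finite D" "D \<subseteq> carrier A" "span D = W" "card D = dim_on A W"
    using subspace_basis[OF W] by metis
  show ?thesis
    using replacement[OF assms(1) D(1,2) assms(2)] assms(3) D(3,4) that by auto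
qed

lemma left_mult_span:
  assumes "a \<in> carrier A" "X \<subseteq> carrier A" "x \<in> span X"
  shows "a \<otimes> x \<in> span ((\<otimes>) a ` X)"
proof -
  have im: "(\<otimes>) a ` X \<subseteq> carrier A" using assms by auto
  have sub: "VectorSpace.subspace class_ring (span ((\<otimes>) a ` X)) A" using im by (rule span_is_subspace)
  have "VectorSpace.subspace class_ring {x \<in> carrier A. a \<otimes> x \<in> span ((\<otimes>) a ` X)} A"
    by (rule subspaceI) (use subspaceD[OF sub] assms(1) in \<open>auto simp: A.r_distr mult_smult\<close>)
  moreover have "X \<subseteq> {x \<in> carrier A. a \<otimes> x \<in> span ((\<otimes>) a ` X)}"
    using assms(2) in_own_span[OF im] by auto
  ultimately have "span X \<subseteq> {x \<in> carrier A. a \<otimes> x \<in> span ((\<otimes>) a ` X)}" by (rule span_subset)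
  then show ?thesis using assms(3) by auto
qed

text \<open>For finite \<open>X\<close> this turns the space whose dimension is bounded in the
  definition of amenability into the span of a finite set.\<close>

lemma translate_sum_eq_span:
  assumes a: "a \<in> carrier A" and X: "X \<subseteq> carrier A"
  shows "(a <#\<^bsub>A\<^esub> span X) <+>\<^bsub>A\<^esub> span X = span (X \<union> (\<otimes>) a ` X)"
proof (rule equalityI)
  define W where "W = (a <#\<^bsub>A\<^esub> span X) <+>\<^bsub>A\<^esub> span X"
  have W: "x \<in> W \<longleftrightarrow> (\<exists>p\<in>span X. \<exists>q\<in>span X. x = a \<otimes> p \<oplus> q)" for x
    by (auto simp: W_def set_add_def' l_coset_def)
  have im: "(\<otimes>) a ` X \<subseteq> carrier A" using assms by auto
  then have c: "X \<union> (\<otimes>) a ` X \<subseteq> carrier A" using X by blast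
  have sub: "VectorSpace.subspace class_ring (span (X \<union> (\<otimes>) a ` X)) A" using c by (rule span_is_subspace)
  have "span X \<subseteq> span (X \<union> (\<otimes>) a ` X)" "span ((\<otimes>) a ` X) \<subseteq> span (X \<union> (\<otimes>) a ` X)"
    by (intro span_is_monotone; blast)+
  then have "a \<otimes> p \<oplus> q \<in> span (X \<union> (\<otimes>) a ` X)" if "p \<in> span X" "q \<in> span X" for p q
    using left_mult_span[OF a X that(1)] that(2) by (intro subspaceD(3)[OF sub]) (erule subsetD, assumption)+
  then have "W \<subseteq> span (X \<union> (\<otimes>) a ` X)" using W by auto
  then show "(a <#\<^bsub>A\<^esub> span X) <+>\<^bsub>A\<^esub> span X \<subseteq> span (X \<union> (\<otimes>) a ` X)"
    unfolding W_def .
  have subX: "VectorSpace.subspace class_ring (span X) A" using X by (rule span_is_subspace)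
  have S: "span X \<subseteq> carrier A" "\<zero> \<in> span X" "X \<subseteq> span X"
    using subspaceD[OF subX] in_own_span[OF X] by auto
  have "VectorSpace.subspace class_ring W A"
  proof (rule subspaceI)
    show "W \<subseteq> carrier A" using subsetD[OF S(1)] a by (auto simp: W)
    show "\<zero> \<in> W" using S(2) a by (auto simp: W intro!: bexI[of _ \<zero>])
  next
    fix x y assume "x \<in> W" "y \<in> W"
    then obtain p q r s where pq: "p \<in> span X" "q \<in> span X" "x = a \<otimes> p \<oplus> q"
      and rs: "r \<in> span X" "s \<in> span X" "y = a \<otimes> r \<oplus> s"
      by (auto simp: W)
    have c: "p \<in> carrier A" "q \<in> carrier A" "r \<in> carrier A" "s \<in> carrier A" using pq rs S by auto
    have "x \<oplus> y = a \<otimes> (p \<oplus> r) \<oplus> (q \<oplus> s)"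
      using c a by (simp add: pq rs A.r_distr A.add.m_ac)
    then show "x \<oplus> y \<in> W"
      using subspaceD(3)[OF subX pq(1) rs(1)] subspaceD(3)[OF subX pq(2) rs(2)] W by blast
  next
    fix k x assume "x \<in> W"
    then obtain p q where pq: "p \<in> span X" "q \<in> span X" "x = a \<otimes> p \<oplus> q"
      by (auto simp: W)
    have c: "p \<in> carrier A" "q \<in> carrier A" using pq S by auto
    have "k \<odot> x = a \<otimes> (k \<odot> p) \<oplus> k \<odot> q"
      using c a by (simp add: pq smult_r_distr mult_smult)
    then show "k \<odot> x \<in> W"
      using subspaceD(4)[OF subX pq(1)] subspaceD(4)[OF subX pq(2)] W by blast
  qed
  moreover have "X \<union> (\<otimes>) a ` X \<subseteq> W"
  proof -
    have "x = a \<otimes> \<zero> \<oplus> x" "a \<otimes> x = a \<otimes> x \<oplus> \<zero>" if "x \<in> X" for x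
      using subsetD[OF X that] a by auto
    then show ?thesis using S W by blast
  qed
  ultimately show "span (X \<union> (\<otimes>) a ` X) \<subseteq> (a <#\<^bsub>A\<^esub> span X) <+>\<^bsub>A\<^esub> span X"
    unfolding W_def by (rule span_subset)
qed

lemma lincomb_add:
  assumes "X \<subseteq> carrier A" shows "lincomb f X \<oplus> lincomb g X = lincomb (\<lambda>x. f x + g x) X"
proof -
  have "lincomb (\<lambda>x. f x + g x) X = (\<Oplus>x\<in>X. f x \<odot> x \<oplus> g x \<odot> x)"
    unfolding lincomb_def
    by (intro A.add.finprod_cong') (use assms smult_l_distr in \<open>auto simp: subset_iff\<close>)
  also have "\<dots> = lincomb f X \<oplus> lincomb g X"
    unfolding lincomb_def by (intro A.add.finprod_multf) (use assms in auto)
  finally show ?thesis by simp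
qed

lemma lincomb_scale:
  assumes "X \<subseteq> carrier A" shows "a \<odot> lincomb f X = lincomb (\<lambda>x. a * f x) X"
  using lincomb_smult[OF assms, of f a] by simp

lemma lincomb_in_carrier: "X \<subseteq> carrier A \<Longrightarrow> lincomb f X \<in> carrier A"
  by (rule lincomb_closed) auto

lemma lincomb_zero: "X \<subseteq> carrier A \<Longrightarrow> lincomb (\<lambda>x. 0) X = \<zero>"
  using lincomb_scale[of X 0 "\<lambda>_. 0"] lmult_0[OF lincomb_in_carrier, of X "\<lambda>_. 0"] by simp

lemma lincomb_of_lincombs:
  assumes "finite I" "X \<subseteq> carrier A"
  shows "(\<Oplus>i\<in>I. f i \<odot> lincomb (c i) X) = lincomb (\<lambda>x. \<Sum>i\<in>I. f i * c i x) X"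
  using assms(1)
proof (induction I rule: finite_induct)
  case empty
  then show ?case using lincomb_zero[OF assms(2)] by simp
next
  case (insert i I)
  then show ?case
    using assms(2) by (simp add: lincomb_in_carrier lincomb_scale lincomb_add)
qed

text \<open>Associativity of a row \<open>a\<close>, a matrix \<open>b\<close> and a vector with
  coefficients \<open>f\<close>. The index \<open>t\<close> will be a pair of a column index and a
  basis vector.\<close>

lemma matrix_action_sum:
  assumes "finite I" "finite J"
    and "\<And>j. j \<in> J \<Longrightarrow> a j \<in> carrier A" "\<And>j t. j \<in> J \<Longrightarrow> t \<in> I \<Longrightarrow> b j t \<in> carrier A"
    and "\<And>t. t \<in> I \<Longrightarrow> w t \<in> carrier A"
  shows "(\<Oplus>j\<in>J. a j \<otimes> (\<Oplus>t\<in>I. f t \<odot> (b j t \<otimes> w t))) =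
    (\<Oplus>t\<in>I. f t \<odot> ((\<Oplus>j\<in>J. a j \<otimes> b j t) \<otimes> w t))"
  using assms(1,4,5)
proof (induction I rule: finite_induct)
  case empty
  have "(\<Oplus>j\<in>J. a j \<otimes> \<zero>) = (\<Oplus>j\<in>J. \<zero>)"
    by (intro A.add.finprod_cong') (use assms in auto)
  then show ?case by simp
next
  case (insert s I)
  have [simp]: "(\<Oplus>t\<in>I. f t \<odot> (b j t \<otimes> w t)) \<in> carrier A" if "j \<in> J" for j
    using insert that by (intro A.finsum_closed) auto
  have 1: "a j \<otimes> (\<Oplus>t\<in>insert s I. f t \<odot> (b j t \<otimes> w t)) =
    a j \<otimes> (f s \<odot> (b j s \<otimes> w s)) \<oplus> a j \<otimes> (\<Oplus>t\<in>I. f t \<odot> (b j t \<otimes> w t))" if "j \<in> J" for j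
  proof -
    have "(\<Oplus>t\<in>insert s I. f t \<odot> (b j t \<otimes> w t)) = f s \<odot> (b j s \<otimes> w s) \<oplus> (\<Oplus>t\<in>I. f t \<odot> (b j t \<otimes> w t))"
      using insert that by (intro A.finsum_insert) auto
    then show ?thesis using that assms(3) insert by (simp add: A.r_distr)
  qed
  have "(\<Oplus>j\<in>J. a j \<otimes> (\<Oplus>t\<in>insert s I. f t \<odot> (b j t \<otimes> w t))) =
    (\<Oplus>j\<in>J. a j \<otimes> (f s \<odot> (b j s \<otimes> w s)) \<oplus> a j \<otimes> (\<Oplus>t\<in>I. f t \<odot> (b j t \<otimes> w t)))"
    by (intro A.add.finprod_cong') (use 1 assms(3) insert in auto)
  also have "\<dots> = (\<Oplus>j\<in>J. a j \<otimes> (f s \<odot> (b j s \<otimes> w s))) \<oplus> (\<Oplus>j\<in>J. a j \<otimes> (\<Oplus>t\<in>I. f t \<odot> (b j t \<otimes> w t)))"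
    by (intro A.finsum_addf) (use assms(3) insert in auto)
  also have "(\<Oplus>j\<in>J. a j \<otimes> (f s \<odot> (b j s \<otimes> w s))) = (\<Oplus>j\<in>J. f s \<odot> ((a j \<otimes> b j s) \<otimes> w s))"
    by (intro A.add.finprod_cong') (use assms(3) insert in \<open>auto simp: mult_smult A.m_assoc\<close>)
  also have "\<dots> = f s \<odot> ((\<Oplus>j\<in>J. a j \<otimes> b j s) \<otimes> w s)"
    using insert assms(2,3) by (subst A.finsum_ldistr) (auto intro!: finsum_smult[symmetric])
  finally show ?case
    using insert assms(3) by (simp add: A.finsum_closed Pi_def)
qed

text \<open>If the product of \<open>a\<close> and \<open>b\<close> is the identity of size
  \<open>n\<close>, then \<open>b\<close> embeds \<open>W^n\<close> into the \<open>m\<close>-th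
  power of the space spanned by \<open>W\<close> and all \<open>b j l W\<close>. Almost invariance
  keeps this space so close to \<open>W\<close> in dimension that \<open>m < n\<close> is
  impossible.\<close>

theorem amenable_imp_rank_condition:
  assumes "algebraically_amenable A"
  shows "rank_condition A"
  unfolding rank_condition_def
proof (intro allI impI, elim conjE)
  fix m n and a b :: "nat \<Rightarrow> nat \<Rightarrow> 'a"
  assume ab: "\<forall>i<n. \<forall>j<m. a i j \<in> carrier A \<and> b j i \<in> carrier A"
    and id: "\<forall>i<n. \<forall>l<n. (\<Oplus>j\<in>{..<m}. a i j \<otimes> b j l) = (if i = l then \<one> else \<zero>)"
  show "n \<le> m"
  proof (rule ccontr)
    assume "\<not> n \<le> m"
    \<comment> \<open>With \<open>d\<close> the dimension of \<open>W\<close>, the space spanned by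
      \<open>W\<close> and its \<open>m * n\<close> translates has dimension at most
      \<open>(1 + m * n * e) d\<close>. Its \<open>m\<close>-th power has to stay below dimension
      \<open>(m + 1) d\<close>, so \<open>m * m * n * e < 1\<close> is needed; the summand 1 in the
      denominator makes this strict and avoids division by zero.\<close>
    define e :: real where "e = 1 / (real (m * m * n) + 1)"
    define S where "S = (\<lambda>(j, l). b j l) ` ({..<m} \<times> {..<n})"
    have "e > 0" unfolding e_def by (intro divide_pos_pos add_nonneg_pos) simp_all
    moreover have "finite S" "S \<subseteq> carrier A" using ab by (auto simp: S_def)
    ultimately obtain W where W: "VectorSpace.subspace class_ring W A" "W \<noteq> {\<zero>}" "fin_dim_on A W"
      and small: "\<forall>x\<in>S. real (dim_on A ((x <#\<^bsub>A\<^esub> W) <+>\<^bsub>A\<^esub> W)) \<le> (1 + e) * real (dim_on A W)"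
      using assms unfolding algebraically_amenable_def by metis
    define d where "d = dim_on A W"
    obtain B where B: "finite B" "B \<subseteq> carrier A" "lin_indpt B" "span B = W" "card B = d"
      using subspace_basis[OF W(1,3)] unfolding d_def by metis
    have "d > 0"
    proof (rule ccontr)
      assume "\<not> d > 0"
      then have "B = {}" using B by simp
      moreover have "lincomb f {} = \<zero>" for f by (simp add: lincomb_def)
      ultimately have "span B \<subseteq> {\<zero>}" by (auto simp: span_def)
      then show False using W subspaceD(2)[OF W(1)] B(4) by blast
    qed
    \<comment> \<open>\<open>C\<close> completes the basis \<open>B\<close> of \<open>W\<close> to a
      spanning set of \<open>b j l W + W\<close>; its size is the growth in dimension.\<close>
    define P where "P j l C \<longleftrightarrow> finite C \<and> C \<subseteq> carrier A \<and> real (card C) \<le> e * d \<and>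
      (\<forall>w\<in>B. b j l \<otimes> w \<in> span (B \<union> C))" for j l C
    have ex: "\<exists>C. P j l C" if jl: "j < m" "l < n" for j l
    proof -
      have bc: "b j l \<in> carrier A" using ab jl by blast
      let ?W = "(b j l <#\<^bsub>A\<^esub> W) <+>\<^bsub>A\<^esub> W"
      have eq: "?W = span (B \<union> (\<otimes>) (b j l) ` B)"
        using translate_sum_eq_span[OF bc B(2)] unfolding B(4) .
      have c: "B \<union> (\<otimes>) (b j l) ` B \<subseteq> carrier A" using B(2) bc by auto
      have sub: "VectorSpace.subspace class_ring ?W A" unfolding eq using c by (rule span_is_subspace)
      have fd: "fin_dim_on A ?W" unfolding eq by (rule dim_on_span) (use B c in auto)
      have own: "B \<union> (\<otimes>) (b j l) ` B \<subseteq> ?W" unfolding eq using c by (rule in_own_span)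
      then have "B \<subseteq> ?W" by simp
      then obtain C where C: "finite C" "C \<subseteq> carrier A" "span (B \<union> C) = ?W"
        "int (card C) \<le> int (dim_on A ?W) - int (card B)"
        using extend_to_spanning_set[OF B(1,3) _ sub fd] by metis
      have "b j l \<in> S" using jl by (auto simp: S_def)
      then have "real (dim_on A ?W) \<le> (1 + e) * d" using small by (simp add: d_def)
      moreover have "real (card C) \<le> real (dim_on A ?W) - d" using C(4) B(5) by linarith
      ultimately have "real (card C) \<le> e * d" by (simp add: algebra_simps)
      moreover have "\<forall>w\<in>B. b j l \<otimes> w \<in> span (B \<union> C)" using own unfolding C(3) Un_subset_iff image_subset_iff by (rule conjunct2)
      ultimately show ?thesis using C(1,2) unfolding P_def by blast
    qed
    define C where "C j l = (SOME C. P j l C)" for j l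
    have "P j l (C j l)" if "j < m" "l < n" for j l
      unfolding C_def using ex[OF that] by (rule someI_ex)
    then have C: "\<And>j l. j < m \<Longrightarrow> l < n \<Longrightarrow> finite (C j l)" "\<And>j l. j < m \<Longrightarrow> l < n \<Longrightarrow> C j l \<subseteq> carrier A"
      "\<And>j l. j < m \<Longrightarrow> l < n \<Longrightarrow> real (card (C j l)) \<le> e * d"
      "\<And>j l w. j < m \<Longrightarrow> l < n \<Longrightarrow> w \<in> B \<Longrightarrow> b j l \<otimes> w \<in> span (B \<union> C j l)"
      unfolding P_def by blast+
    define T where "T = B \<union> (\<Union>(j, l)\<in>{..<m} \<times> {..<n}. C j l)"
    have T: "finite T" "T \<subseteq> carrier A" using B C(1) subsetD[OF C(2)] by (auto simp: T_def)
    have "real (card T) \<le> d + real (\<Sum>(j, l)\<in>{..<m} \<times> {..<n}. card (C j l))"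
    proof -
      have "card T \<le> card B + card (\<Union>(j, l)\<in>{..<m} \<times> {..<n}. C j l)" unfolding T_def by (rule card_Un_le)
      also have "card (\<Union>(j, l)\<in>{..<m} \<times> {..<n}. C j l) \<le> (\<Sum>(j, l)\<in>{..<m} \<times> {..<n}. card (C j l))"
        using card_UN_le[of "{..<m} \<times> {..<n}" "\<lambda>(j, l). C j l"] by (simp add: case_prod_unfold)
      finally show ?thesis using B(5) by linarith
    qed
    also have "real (\<Sum>(j, l)\<in>{..<m} \<times> {..<n}. card (C j l)) \<le> (\<Sum>(j, l)\<in>{..<m} \<times> {..<n}. e * d)"
      unfolding of_nat_sum by (intro sum_mono) (use C(3) in auto)
    finally have card_T: "real (card T) \<le> d + real m * real n * (e * d)"
      by (simp add: case_prod_unfold card_cartesian_product)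
    have small_e: "real (m * m * n) * e < 1"
    proof -
      have *: "X * (1 / (X + 1)) < 1" if "X \<ge> 0" for X :: real using that by (simp add: divide_less_eq)
      show ?thesis unfolding e_def by (rule *) simp
    qed
    have "real m * real (card T) \<le> real m * (d + real m * real n * (e * d))"
      using card_T by (intro mult_left_mono) auto
    also have "\<dots> = d * (real m + real (m * m * n) * e)" by (simp add: algebra_simps)
    also have "\<dots> < d * (real m + 1)"
      using \<open>d > 0\<close> by (intro mult_strict_left_mono) (use small_e in auto)
    also have "\<dots> \<le> d * real n" using \<open>\<not> n \<le> m\<close> by (intro mult_left_mono) auto
    finally have "real (m * card T) < real (n * d)" by (simp add: mult.commute)
    then have less: "card ({..<m} \<times> T) < card ({..<n} \<times> B)"
      unfolding of_nat_less_iff by (simp add: card_cartesian_product B(5))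
    have "\<exists>c. lincomb c T = b j l \<otimes> w" if "j < m" "l < n" "w \<in> B" for j l w
    proof -
      have "span (B \<union> C j l) \<subseteq> span T" using that by (intro span_is_monotone) (auto simp: T_def)
      then have "b j l \<otimes> w \<in> span T" using C(4)[OF that] by (rule subsetD)
      then show ?thesis using finite_in_span[OF T] by blast
    qed
    then obtain c where c: "\<And>j l w. j < m \<Longrightarrow> l < n \<Longrightarrow> w \<in> B \<Longrightarrow> lincomb (c j l w) T = b j l \<otimes> w"
      by metis
    \<comment> \<open>By the count just made, \<open>b\<close> has a nonzero kernel vector on
      \<open>W^n\<close>; \<open>f\<close> holds the coordinates of its \<open>n\<close> components
      with respect to \<open>B\<close>.\<close>
    obtain f where f: "\<exists>t\<in>{..<n} \<times> B. f t \<noteq> 0"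
      and f0: "\<forall>(j, x)\<in>{..<m} \<times> T. (\<Sum>t\<in>{..<n} \<times> B. f t * c j (fst t) (snd t) x) = 0"
      using underdetermined_system[of "{..<m} \<times> T" "{..<n} \<times> B" "\<lambda>t (j, x). c j (fst t) (snd t) x"] less T(1) B(1)
      by (auto simp: case_prod_unfold)
    have vanish: "(\<Oplus>t\<in>{..<n} \<times> B. f t \<odot> (b j (fst t) \<otimes> snd t)) = \<zero>" if "j < m" for j
    proof -
      have "(\<Oplus>t\<in>{..<n} \<times> B. f t \<odot> (b j (fst t) \<otimes> snd t)) =
        (\<Oplus>t\<in>{..<n} \<times> B. f t \<odot> lincomb (c j (fst t) (snd t)) T)"
        by (intro A.add.finprod_cong') (use c that lincomb_in_carrier[OF T(2)] in auto)
      also have "\<dots> = lincomb (\<lambda>x. \<Sum>t\<in>{..<n} \<times> B. f t * c j (fst t) (snd t) x) T"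
        by (rule lincomb_of_lincombs) (use B T in auto)
      also have "\<dots> = lincomb (\<lambda>x. 0) T" by (rule lincomb_cong) (use f0 that T in auto)
      finally show ?thesis using lincomb_zero[OF T(2)] by simp
    qed
    obtain i w0 where i: "i < n" "w0 \<in> B" "f (i, w0) \<noteq> 0" using f by auto
    \<comment> \<open>Multiplying the kernel vector by row \<open>i\<close> of \<open>a\<close>
      returns its component \<open>i\<close>, a nontrivial combination of the independent set
      \<open>B\<close>.\<close>
    have "\<zero> = (\<Oplus>j\<in>{..<m}. a i j \<otimes> (\<Oplus>t\<in>{..<n} \<times> B. f t \<odot> (b j (fst t) \<otimes> snd t)))"
    proof -
      have "(\<Oplus>j\<in>{..<m}. a i j \<otimes> (\<Oplus>t\<in>{..<n} \<times> B. f t \<odot> (b j (fst t) \<otimes> snd t))) = (\<Oplus>j\<in>{..<m}. \<zero>)"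
        by (intro A.add.finprod_cong') (use vanish ab i in auto)
      then show ?thesis by simp
    qed
    also have "\<dots> = (\<Oplus>t\<in>{..<n} \<times> B. f t \<odot> ((\<Oplus>j\<in>{..<m}. a i j \<otimes> b j (fst t)) \<otimes> snd t))"
      by (rule matrix_action_sum) (use ab i B in auto)
    also have "\<dots> = (\<Oplus>t\<in>Pair i ` B. f t \<odot> snd t)"
    proof -
      have "k \<odot> \<zero> = \<zero>" for k by (rule smult_r_null) simp
      then show ?thesis
        by (intro A.add.finprod_mono_neutral_cong) (use B(1) subsetD[OF B(2)] id i in auto)
    qed
    also have "\<dots> = lincomb (\<lambda>w. f (i, w)) B"
      unfolding lincomb_def by (subst A.finsum_reindex) (use B in \<open>auto simp: inj_on_def\<close>)
    finally show False
      using lin_dep_crit[of B B "\<lambda>w. f (i, w)" w0] B(1,3) i by simp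
  qed
qed

end

section \<open>Doubling, quotient modules and UGN\<close>

text \<open>The column of \<open>a\<close> and \<open>b\<close> times the row of \<open>x\<close>
  and \<open>y\<close> is the identity of size 2. So \<open>R^2\<close> is a direct summand of
  \<open>R\<close>, not necessarily all of it: \<open>x a + y b\<close> may differ from the
  unit.\<close>

definition doubling :: "('a, 'b) ring_scheme \<Rightarrow> bool" where
  "doubling R \<longleftrightarrow> (\<exists>a\<in>carrier R. \<exists>b\<in>carrier R. \<exists>x\<in>carrier R. \<exists>y\<in>carrier R.
     a \<otimes>\<^bsub>R\<^esub> x = \<one>\<^bsub>R\<^esub> \<and> b \<otimes>\<^bsub>R\<^esub> y = \<one>\<^bsub>R\<^esub> \<and> a \<otimes>\<^bsub>R\<^esub> y = \<zero>\<^bsub>R\<^esub> \<and> b \<otimes>\<^bsub>R\<^esub> x = \<zero>\<^bsub>R\<^esub>)"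

text \<open>A unital homomorphism carries a factorization of the identity matrix to one of the same
  sizes.\<close>

lemma ring_hom_rank_condition:
  assumes "ring R" "ring S" "h \<in> Ring.ring_hom R S" "rank_condition S"
  shows "rank_condition R"
  unfolding rank_condition_def
proof (intro allI impI, elim conjE)
  interpret R: ring R by fact
  interpret S: ring S by fact
  fix m n and a b :: "nat \<Rightarrow> nat \<Rightarrow> 'a"
  assume ab: "\<forall>i<n. \<forall>j<m. a i j \<in> carrier R \<and> b j i \<in> carrier R"
    and id: "\<forall>i<n. \<forall>l<n. (\<Oplus>\<^bsub>R\<^esub>j\<in>{..<m}. a i j \<otimes>\<^bsub>R\<^esub> b j l) = (if i = l then \<one>\<^bsub>R\<^esub> else \<zero>\<^bsub>R\<^esub>)"
  have h: "h x \<in> carrier S" if "x \<in> carrier R" for x using ring_hom_closed[OF assms(3) that] .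
  have h0: "h \<zero>\<^bsub>R\<^esub> = \<zero>\<^bsub>S\<^esub>"
    using ring_hom_zero[OF assms(3,1,2)] .
  have hsum: "h (\<Oplus>\<^bsub>R\<^esub>j\<in>J. f j) = (\<Oplus>\<^bsub>S\<^esub>j\<in>J. h (f j))"
    if "finite J" "\<And>j. j \<in> J \<Longrightarrow> f j \<in> carrier R" for J :: "nat set" and f
    using that
  proof (induction J rule: finite_induct)
    case (insert j J)
    then show ?case
      using ring_hom_add[OF assms(3)] h by (simp add: R.finsum_closed Pi_def)
  qed (simp add: h0)
  have "(\<Oplus>\<^bsub>S\<^esub>j\<in>{..<m}. h (a i j) \<otimes>\<^bsub>S\<^esub> h (b j l)) = (if i = l then \<one>\<^bsub>S\<^esub> else \<zero>\<^bsub>S\<^esub>)"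
    if il: "i < n" "l < n" for i l
  proof -
    have "(\<Oplus>\<^bsub>S\<^esub>j\<in>{..<m}. h (a i j) \<otimes>\<^bsub>S\<^esub> h (b j l)) = (\<Oplus>\<^bsub>S\<^esub>j\<in>{..<m}. h (a i j \<otimes>\<^bsub>R\<^esub> b j l))"
      by (intro S.add.finprod_cong') (use il ab h ring_hom_mult[OF assms(3)] in auto)
    also have "\<dots> = h (\<Oplus>\<^bsub>R\<^esub>j\<in>{..<m}. a i j \<otimes>\<^bsub>R\<^esub> b j l)"
      using ab il by (intro hsum[symmetric]) auto
    also have "\<dots> = h (if i = l then \<one>\<^bsub>R\<^esub> else \<zero>\<^bsub>R\<^esub>)" using id il by simp
    finally show ?thesis using h0 ring_hom_one[OF assms(3)] by simp
  qed
  moreover have "\<forall>i<n. \<forall>j<m. h (a i j) \<in> carrier S \<and> h (b j i) \<in> carrier S" using ab h by blast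
  ultimately show "n \<le> m"
    using assms(4)[unfolded rank_condition_def, rule_format, of n m "\<lambda>i j. h (a i j)" "\<lambda>i j. h (b i j)"] by blast
qed

text \<open>The whole algebra serves as an invariant subspace, for every tolerance.\<close>

lemma (in field_algebra) fin_dim_imp_amenable:
  assumes "carrier A \<noteq> {\<zero>}" "vectorspace.fin_dim class_ring A"
  shows "algebraically_amenable A"
proof -
  have sub: "VectorSpace.subspace class_ring (carrier A) A" by (rule subspaceI) auto
  have "fin_dim_on A (carrier A)" using assms(2) by (simp add: fin_dim_on_def)
  moreover have "(a <#\<^bsub>A\<^esub> carrier A) <+>\<^bsub>A\<^esub> carrier A = carrier A" if "a \<in> carrier A" for a
  proof
    show "(a <#\<^bsub>A\<^esub> carrier A) <+>\<^bsub>A\<^esub> carrier A \<subseteq> carrier A"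
      using that by (auto simp: set_add_def' l_coset_def)
    have "x = a \<otimes> \<zero> \<oplus> x" if "x \<in> carrier A" for x using that \<open>a \<in> carrier A\<close> by simp
    then show "carrier A \<subseteq> (a <#\<^bsub>A\<^esub> carrier A) <+>\<^bsub>A\<^esub> carrier A"
      using A.zero_closed by (fastforce simp: set_add_def' l_coset_def)
  qed
  ultimately show ?thesis
    unfolding algebraically_amenable_def using sub assms(1)
    by (intro allI impI exI[of _ "carrier A"]) (auto simp: algebra_simps subset_iff)
qed

lemma (in field_algebra) fin_dim_quotient_imp_rank_condition:
  assumes "has_nonzero_fin_dim_quotient A"
  shows "rank_condition A"
proof -
  obtain J where J: "ideal J A" and nz: "carrier (quotient_algebra A J) \<noteq> {\<zero>\<^bsub>quotient_algebra A J\<^esub>}"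
    and fd: "vectorspace.fin_dim class_ring (quotient_algebra A J)"
    using assms unfolding has_nonzero_fin_dim_quotient_def by blast
  interpret J: ideal J A by (rule J)
  interpret Q: field_algebra "quotient_algebra A J" by (rule quotient_field_algebra[OF J])
  have "rank_condition (quotient_algebra A J)"
    using Q.amenable_imp_rank_condition Q.fin_dim_imp_amenable nz fd by blast
  moreover have "(+>) J \<in> Ring.ring_hom A (quotient_algebra A J)"
  proof (rule ring_hom_memI)
    have "carrier (quotient_algebra A J) = (\<lambda>x. J +> x) ` carrier A"
      by (auto simp: quotient_algebra_def FactRing_def A_RCOSETS_def RCOSETS_def a_r_coset_def)
    then show "J +> x \<in> carrier (quotient_algebra A J)" if "x \<in> carrier A" for x using that by blast
  qed (simp_all add: quotient_algebra_def FactRing_def J.rcoset_mult_add J.a_rcos_sum)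
  ultimately show ?thesis
    using ring_hom_rank_condition[OF A.ring_axioms Q.A.ring_axioms] by blast
qed

section \<open>Matrices, free modules and quotients of the regular module\<close>

context ring
begin

lemma rank_condition_imp_not_doubling:
  assumes "rank_condition R" shows "\<not> doubling R"
proof
  assume "doubling R"
  then obtain a b x y where c: "a \<in> carrier R" "b \<in> carrier R" "x \<in> carrier R" "y \<in> carrier R"
    and e: "a \<otimes> x = \<one>" "b \<otimes> y = \<one>" "a \<otimes> y = \<zero>" "b \<otimes> x = \<zero>"
    unfolding doubling_def by blast
  define f :: "nat \<Rightarrow> nat \<Rightarrow> 'a" where "f i j = (if i = 0 then a else b)" for i j
  define g :: "nat \<Rightarrow> nat \<Rightarrow> 'a" where "g j l = (if l = 0 then x else y)" for j l
  have "(\<Oplus>j\<in>{..<1::nat}. f i j \<otimes> g j l) = (if i = l then \<one> else \<zero>)" if "i < 2" "l < 2" for i l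
  proof -
    have "(\<Oplus>j\<in>{..<1::nat}. f i j \<otimes> g j l) = f i 0 \<otimes> g 0 l"
      using c by (simp add: lessThan_Suc f_def g_def)
    then show ?thesis using that e by (auto simp: f_def g_def less_2_cases_iff)
  qed
  moreover have "\<forall>i<2. \<forall>j<1. f i j \<in> carrier R \<and> g j i \<in> carrier R" using c by (simp add: f_def g_def)
  ultimately show False
    using assms[unfolded rank_condition_def, rule_format, of 2 1 f g] by fastforce
qed

text \<open>A right linear map out of \<open>R^m\<close> is left multiplication by the matrix whose
  columns are the images of the unit vectors \<open>e j\<close>; only the components in
  \<open>R^n\<close> are recorded.\<close>

lemma free_module_hom_expansion:
  fixes n :: nat
  assumes P: "right_module R P"
    and h: "h \<in> hom (add_monoid (free_module R m)) (add_monoid (module_sum (free_module R n) P))"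
    and lin: "\<And>x r. x \<in> carrier (free_module R m) \<Longrightarrow> r \<in> carrier R \<Longrightarrow>
      h (x \<star>\<^bsub>free_module R m\<^esub> r) = h x \<star>\<^bsub>module_sum (free_module R n) P\<^esub> r"
    and f: "f \<in> carrier (free_module R m)" and i: "i < n"
  defines "e \<equiv> \<lambda>k. \<lambda>j\<in>{..<m}. if j = k then \<one> else \<zero>"
  shows "fst (h f) i = (\<Oplus>j\<in>{..<m}. fst (h (e j)) i \<otimes> f j)"
proof -
  let ?M = "free_module R m"
  have hc: "fst (h x) \<in> {..<n} \<rightarrow>\<^sub>E carrier R" if "x \<in> carrier ?M" for x
    using hom_in_carrier[OF h, of x] that by (auto simp: module_sum_def free_module_def)
  then have hi: "fst (h x) i \<in> carrier R" if "x \<in> carrier ?M" for x using that i by auto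
  have add: "fst (h (x \<oplus>\<^bsub>?M\<^esub> y)) i = fst (h x) i \<oplus> fst (h y) i" if "x \<in> carrier ?M" "y \<in> carrier ?M" for x y
  proof -
    have "h (x \<oplus>\<^bsub>?M\<^esub> y) = h x \<oplus>\<^bsub>module_sum (free_module R n) P\<^esub> h y"
      using hom_mult[OF h, of x y] that by simp
    then show ?thesis using i by (simp add: module_sum_def case_prod_beta free_module_def)
  qed
  have smul: "fst (h (x \<star>\<^bsub>?M\<^esub> r)) i = fst (h x) i \<otimes> r" if "x \<in> carrier ?M" "r \<in> carrier R" for x r
    using lin[OF that] i by (simp add: module_sum_def case_prod_beta free_module_def)
  have fj: "f j \<in> carrier R" if "j < m" for j using f that by (auto simp: free_module_def)
  have e: "e k \<in> carrier ?M" for k by (auto simp: e_def free_module_def)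
  \<comment> \<open>Truncation of \<open>f\<close> to its first \<open>k\<close> coordinates, which
    allows induction on \<open>k\<close>.\<close>
  define F where "F k = (\<lambda>j\<in>{..<m}. if j < k then f j else \<zero>)" for k
  have F: "F k \<in> carrier ?M" for k using fj by (auto simp: F_def free_module_def)
  have "fst (h (F k)) i = (\<Oplus>j\<in>{..<k}. fst (h (e j)) i \<otimes> f j)" if "k \<le> m" for k
    using that
  proof (induction k)
    case 0
    have "F 0 \<oplus>\<^bsub>?M\<^esub> F 0 = F 0" by (auto simp: F_def free_module_def fun_eq_iff)
    then have "fst (h (F 0)) i \<oplus> fst (h (F 0)) i = fst (h (F 0)) i" using add[OF F F, of 0 0] by simp
    then have "fst (h (F 0)) i = \<zero>" using hi[OF F] by (metis add.r_cancel_one)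
    then show ?case by simp
  next
    case (Suc k)
    have "F (Suc k) = F k \<oplus>\<^bsub>?M\<^esub> (e k \<star>\<^bsub>?M\<^esub> f k)"
      using Suc.prems fj by (auto simp: F_def e_def free_module_def fun_eq_iff less_Suc_eq)
    moreover have "e k \<star>\<^bsub>?M\<^esub> f k \<in> carrier ?M"
      using Suc.prems fj by (auto simp: e_def free_module_def)
    ultimately have "fst (h (F (Suc k))) i = fst (h (F k)) i \<oplus> fst (h (e k)) i \<otimes> f k"
      using add[OF F] smul[OF e] fj Suc.prems by simp
    also have "\<dots> = (\<Oplus>j\<in>{..<k}. fst (h (e j)) i \<otimes> f j) \<oplus> fst (h (e k)) i \<otimes> f k"
      using Suc by simp
    also have "\<dots> = (\<Oplus>j\<in>insert k {..<k}. fst (h (e j)) i \<otimes> f j)"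
      using Suc.prems fj hi[OF e] by (subst finsum_insert) (auto simp: a_comm finsum_closed)
    finally show ?case by (simp add: lessThan_Suc)
  qed
  from this[of m] have "fst (h (F m)) i = (\<Oplus>j\<in>{..<m}. fst (h (e j)) i \<otimes> f j)" by simp
  moreover have "F m = f" using f by (auto simp: F_def free_module_def fun_eq_iff PiE_def extensional_def)
  ultimately show ?thesis by simp
qed

text \<open>The projection of \<open>R^m\<close> onto the summand \<open>R^n\<close> is given by a
  matrix, and preimages of the unit vectors are the columns of a right inverse.\<close>

theorem rank_condition_imp_UGN:
  assumes "rank_condition R"
  shows "UGN R"
  unfolding UGN_def
proof (intro allI impI, elim conjE)
  fix m n :: nat and P :: "('a, nat \<Rightarrow> 'a) right_module"
  assume P: "right_module R P"
    and iso: "right_module_iso R (free_module R m) (module_sum (free_module R n) P)"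
  interpret P: right_module R P by fact
  let ?M = "free_module R m" and ?N = "free_module R n"
  obtain h where h: "h \<in> iso (add_monoid ?M) (add_monoid (module_sum ?N P))"
    and lin: "\<And>x r. x \<in> carrier ?M \<Longrightarrow> r \<in> carrier R \<Longrightarrow>
      h (x \<star>\<^bsub>?M\<^esub> r) = h x \<star>\<^bsub>module_sum ?N P\<^esub> r"
    using iso unfolding right_module_iso_def by blast
  have hom: "h \<in> hom (add_monoid ?M) (add_monoid (module_sum ?N P))"
    and bij: "bij_betw h (carrier ?M) (carrier ?N \<times> carrier P)"
    using h by (auto simp: iso_def module_sum_def)
  define e where "e k = (\<lambda>j\<in>{..<m}. if j = k then \<one> else \<zero>)" for k
  define u where "u l = (\<lambda>j\<in>{..<n}. if j = l then \<one> else \<zero>)" for l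
  define w where "w l = inv_into (carrier ?M) h (u l, \<zero>\<^bsub>P\<^esub>)" for l
  have "(u l, \<zero>\<^bsub>P\<^esub>) \<in> h ` carrier ?M" for l
    using bij by (auto simp: bij_betw_def u_def free_module_def)
  then have w: "w l \<in> carrier ?M" "h (w l) = (u l, \<zero>\<^bsub>P\<^esub>)" for l
    unfolding w_def by (rule inv_into_into, rule f_inv_into_f)
  have e: "e k \<in> carrier ?M" for k by (auto simp: e_def free_module_def)
  have "fst (h (e j)) i \<in> carrier R" if "i < n" for i j
    using bij_betwE[OF bij] e[of j] that by (auto simp: free_module_def mem_Times_iff)
  moreover have "w i j \<in> carrier R" if "j < m" for i j using w(1)[of i] that by (auto simp: free_module_def)
  moreover have "(\<Oplus>j\<in>{..<m}. fst (h (e j)) i \<otimes> w l j) = (if i = l then \<one> else \<zero>)" if "i < n" "l < n" for i l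
    using free_module_hom_expansion[OF P hom lin w(1) that(1), of l, folded e_def] w(2) that
    by (simp add: u_def)
  ultimately show "n \<le> m"
    using assms[unfolded rank_condition_def, rule_format, of n m "\<lambda>i j. fst (h (e j)) i" "\<lambda>j l. w l j"] by blast
qed

text \<open>Left multiplication by \<open>x a + y b\<close> is a projection. It splits
  \<open>R\<close> into a part identified with \<open>R^2\<close> by \<open>a\<close> and
  \<open>b\<close>, and the common kernel \<open>K\<close> of \<open>a\<close> and
  \<open>b\<close>.\<close>

lemma doubling_imp_not_UGN:
  assumes "doubling R" shows "\<not> UGN R"
proof
  assume ugn: "UGN R"
  obtain a b x y where c [simp]: "a \<in> carrier R" "b \<in> carrier R" "x \<in> carrier R" "y \<in> carrier R"
    and e: "a \<otimes> x = \<one>" "b \<otimes> y = \<one>" "a \<otimes> y = \<zero>" "b \<otimes> x = \<zero>"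
    using assms unfolding doubling_def by blast
  define K where "K = {r \<in> carrier R. a \<otimes> r = \<zero> \<and> b \<otimes> r = \<zero>}"
  define P :: "('a, 'a) right_module" where
    "P = \<lparr>carrier = K, mult = undefined, one = undefined, zero = \<zero>, add = add R, rsmult = mult R\<rparr>"
  have K: "r \<in> carrier R" "a \<otimes> r = \<zero>" "b \<otimes> r = \<zero>" if "r \<in> K" for r using that by (auto simp: K_def)
  have cancel: "a \<otimes> (x \<otimes> r) = r" "b \<otimes> (y \<otimes> r) = r" "a \<otimes> (y \<otimes> r) = \<zero>" "b \<otimes> (x \<otimes> r) = \<zero>"
    if "r \<in> carrier R" for r
    using that e by (simp_all flip: m_assoc)
  have "right_module R P"
  proof (intro right_module.intro right_module_axioms.intro abelian_groupI)
    show "ring R" by (rule ring_axioms)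
    fix r assume "r \<in> carrier P"
    then show "\<exists>s\<in>carrier P. s \<oplus>\<^bsub>P\<^esub> r = \<zero>\<^bsub>P\<^esub>"
      by (intro bexI[of _ "\<ominus> r"]) (auto simp: P_def K_def l_neg r_minus)
  next
    fix r s assume "r \<in> carrier P" "s \<in> carrier R"
    then show "r \<star>\<^bsub>P\<^esub> s \<in> carrier P" by (auto simp: P_def K_def simp flip: m_assoc)
  qed (auto simp: P_def K_def r_distr l_distr m_assoc a_ac)
  define h where "h f = ((\<lambda>i\<in>{..<2::nat}. (if i = 0 then a else b) \<otimes> f 0),
    f 0 \<oplus> \<ominus> (x \<otimes> (a \<otimes> f 0) \<oplus> y \<otimes> (b \<otimes> f 0)))" for f :: "nat \<Rightarrow> 'a"
  define g where "g = (\<lambda>(f, k). \<lambda>i\<in>{..<1::nat}. x \<otimes> f 0 \<oplus> y \<otimes> f (1::nat) \<oplus> k)"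
  let ?M = "free_module R 1" and ?N = "module_sum (free_module R 2) P"
  have M: "f 0 \<in> carrier R" if "f \<in> carrier ?M" for f using that by (auto simp: free_module_def)
  have proj: "r \<oplus> \<ominus> (x \<otimes> (a \<otimes> r) \<oplus> y \<otimes> (b \<otimes> r)) \<in> K" if "r \<in> carrier R" for r
    using that by (simp add: K_def r_distr r_minus cancel r_neg)
  have N2: "f 0 \<in> carrier R" "f 1 \<in> carrier R" if "f \<in> {..<2::nat} \<rightarrow>\<^sub>E carrier R" for f
    using PiE_mem[OF that, of 0] PiE_mem[OF that, of 1] by simp_all
  have "bij_betw h (carrier ?M) (carrier ?N)"
  proof (rule bij_betwI[of _ _ _ g])
    show "h \<in> carrier ?M \<rightarrow> carrier ?N"
    proof
      fix f assume "f \<in> carrier ?M"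
      then have "f 0 \<in> carrier R" by (rule M)
      then show "h f \<in> carrier ?N"
        using proj by (auto simp: h_def module_sum_def P_def free_module_def simp del: restrict_apply)
    qed
    show "g \<in> carrier ?N \<rightarrow> carrier ?M"
      using K N2 by (auto simp: g_def module_sum_def P_def free_module_def simp del: One_nat_def)
  next
    fix f assume f: "f \<in> carrier ?M"
    have "x \<otimes> (a \<otimes> f 0) \<oplus> y \<otimes> (b \<otimes> f 0) \<oplus> (f 0 \<oplus> \<ominus> (x \<otimes> (a \<otimes> f 0) \<oplus> y \<otimes> (b \<otimes> f 0))) = f 0"
      using M[OF f] by (simp add: a_lcomm[of _ "f 0"] r_neg)
    then have "g (h f) 0 = f 0" by (simp add: g_def h_def)
    moreover have "f i = undefined" "g (h f) i = undefined" if "i \<noteq> 0" for i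
      using f that by (auto simp: g_def case_prod_beta free_module_def PiE_def extensional_def)
    ultimately show "g (h f) = f" by (intro ext) (case_tac "x = 0"; simp)
  next
    fix t assume "t \<in> carrier ?N"
    then obtain f k where t: "t = (f, k)" "f \<in> {..<2} \<rightarrow>\<^sub>E carrier R" "k \<in> K"
      unfolding module_sum_def P_def free_module_def by auto
    define r where "r = x \<otimes> f 0 \<oplus> y \<otimes> f 1 \<oplus> k"
    have fc: "f 0 \<in> carrier R" "f 1 \<in> carrier R" using N2[OF t(2)] .
    have ar: "a \<otimes> r = f 0" "b \<otimes> r = f 1"
      using fc K[OF t(3)] by (simp_all add: r_def r_distr cancel)
    have "r \<oplus> \<ominus> (x \<otimes> f 0 \<oplus> y \<otimes> f 1) = k"
    proof -
      have "s \<oplus> k \<oplus> \<ominus> s = k" if "s \<in> carrier R" for s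
        using that K[OF t(3)] by (simp add: a_comm[of s k] a_assoc r_neg)
      then show ?thesis using fc by (simp add: r_def)
    qed
    moreover have "h (g t) = ((\<lambda>i\<in>{..<2::nat}. (if i = 0 then a else b) \<otimes> r), r \<oplus> \<ominus> (x \<otimes> (a \<otimes> r) \<oplus> y \<otimes> (b \<otimes> r)))"
      by (simp add: h_def g_def t(1) r_def)
    moreover have "(\<lambda>i\<in>{..<2::nat}. (if i = 0 then a else b) \<otimes> r) = f"
      using t(2) ar by (auto simp: fun_eq_iff PiE_def extensional_def less_2_cases_iff)
    ultimately show "h (g t) = t" using ar t(1) by simp
  qed
  moreover have "h \<in> hom (add_monoid ?M) (add_monoid ?N)"
  proof (rule homI)
    fix f f' assume ff: "f \<in> carrier (add_monoid ?M)" "f' \<in> carrier (add_monoid ?M)"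
    then have c': "f 0 \<in> carrier R" "f' 0 \<in> carrier R" using M by auto
    have "f 0 \<oplus> f' 0 \<oplus> \<ominus> (x \<otimes> (a \<otimes> (f 0 \<oplus> f' 0)) \<oplus> y \<otimes> (b \<otimes> (f 0 \<oplus> f' 0))) =
      (f 0 \<oplus> \<ominus> (x \<otimes> (a \<otimes> f 0) \<oplus> y \<otimes> (b \<otimes> f 0))) \<oplus> (f' 0 \<oplus> \<ominus> (x \<otimes> (a \<otimes> f' 0) \<oplus> y \<otimes> (b \<otimes> f' 0)))"
      using c' by (simp add: r_distr minus_add a_ac)
    then show "h (f \<otimes>\<^bsub>add_monoid ?M\<^esub> f') = h f \<otimes>\<^bsub>add_monoid ?N\<^esub> h f'"
      using c' by (auto simp: h_def free_module_def module_sum_def P_def r_distr)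
  qed (use \<open>bij_betw h (carrier ?M) (carrier ?N)\<close> in \<open>auto dest: bij_betwE\<close>)
  moreover have "h (f \<star>\<^bsub>?M\<^esub> r) = h f \<star>\<^bsub>?N\<^esub> r" if "f \<in> carrier ?M" "r \<in> carrier R" for f r
    using M[OF that(1)] that(2)
    by (auto simp: h_def free_module_def module_sum_def P_def m_assoc l_distr l_minus fun_eq_iff)
  ultimately have "right_module_iso R ?M ?N"
    unfolding right_module_iso_def iso_def by auto
  then have "(2::nat) \<le> 1" using UGN_any_universe[OF ugn \<open>right_module R P\<close>] by blast
  then show False by simp
qed

lemma right_submodule_regular_iff:
  "right_submodule R N (regular_module R) \<longleftrightarrow>
     additive_subgroup N R \<and> (\<forall>x\<in>N. \<forall>r\<in>carrier R. x \<otimes> r \<in> N)"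
  by (simp add: right_submodule_def additive_subgroup_def regular_module_def subgroup_def m_inv_def)

lemma regular_module_square:
  defines "S \<equiv> module_sum (regular_module R) (regular_module R)"
  shows "carrier S = carrier R \<times> carrier R"
    "(r, s) \<oplus>\<^bsub>S\<^esub> (r', s') = (r \<oplus> r', s \<oplus> s')" "(r, s) \<star>\<^bsub>S\<^esub> c = (r \<otimes> c, s \<otimes> c)"
  by (simp_all add: S_def module_sum_def regular_module_def)

lemma quotient_regular_module:
  assumes N: "right_submodule R N (regular_module R)"
  defines "Q \<equiv> quotient_module (regular_module R) N"
  shows "carrier Q = (\<lambda>x. N +> x) ` carrier R"
    and "\<And>x y. x \<in> carrier R \<Longrightarrow> y \<in> carrier R \<Longrightarrow> (N +> x) \<oplus>\<^bsub>Q\<^esub> (N +> y) = N +> (x \<oplus> y)"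
    and "\<And>x r. x \<in> carrier R \<Longrightarrow> r \<in> carrier R \<Longrightarrow> (N +> x) \<star>\<^bsub>Q\<^esub> r = N +> (x \<otimes> r)"
    and "\<And>x y. x \<in> carrier R \<Longrightarrow> y \<in> carrier R \<Longrightarrow> N +> x = N +> y \<longleftrightarrow> x \<ominus> y \<in> N"
proof -
  have sub: "additive_subgroup N R" and mult: "\<And>x r. x \<in> N \<Longrightarrow> r \<in> carrier R \<Longrightarrow> x \<otimes> r \<in> N"
    using N right_submodule_regular_iff by auto
  interpret N: abelian_subgroup N R
    using sub is_abelian_group by (rule abelian_subgroupI3)
  have ops: "a_rcosets\<^bsub>regular_module R\<^esub> N = a_rcosets N" "a_r_coset (regular_module R) = a_r_coset R"
    "set_add (regular_module R) = set_add R"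
    by (simp_all add: A_RCOSETS_def RCOSETS_def a_r_coset_def r_coset_def set_add_def set_mult_def regular_module_def fun_eq_iff)
  show "carrier Q = (\<lambda>x. N +> x) ` carrier R"
    by (auto simp: Q_def quotient_module_def ops) (auto simp: A_RCOSETS_def RCOSETS_def a_r_coset_def)
  show "(N +> x) \<oplus>\<^bsub>Q\<^esub> (N +> y) = N +> (x \<oplus> y)" if "x \<in> carrier R" "y \<in> carrier R" for x y
    using that by (simp add: Q_def quotient_module_def ops N.a_rcos_sum)
  show eq: "N +> x = N +> y \<longleftrightarrow> x \<ominus> y \<in> N" if "x \<in> carrier R" "y \<in> carrier R" for x y
  proof -
    have "N +> x = N +> y \<longleftrightarrow> x \<in> N +> y"
      using that N.a_rcos_self a_repr_independence[OF _ that(2) N.a_subgroup] by metis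
    also have "\<dots> \<longleftrightarrow> x \<ominus> y \<in> N" using that N.a_rcos_module_imp N.a_rcos_module_rev by (metis a_minus_def is_abelian_group)
    finally show ?thesis .
  qed
  show "(N +> x) \<star>\<^bsub>Q\<^esub> r = N +> (x \<otimes> r)" if xr: "x \<in> carrier R" "r \<in> carrier R" for x r
  proof -
    have "N +> (z \<otimes> r) = N +> (x \<otimes> r)" if "z \<in> N +> x" for z
    proof -
      from that obtain n where n: "n \<in> N" "z = n \<oplus> x" by (auto simp: a_r_coset_def')
      have nc: "n \<in> carrier R" using n by auto
      have "z \<otimes> r \<ominus> x \<otimes> r = n \<otimes> r"
        using n nc xr by (simp add: l_distr a_minus_def a_assoc r_neg)
      then show ?thesis using eq[of "z \<otimes> r" "x \<otimes> r"] mult[OF n(1) xr(2)] n nc xr by simp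
    qed
    moreover have "x \<in> N +> x" using xr N.a_rcos_self by blast
    moreover have "(N +> x) \<star>\<^bsub>Q\<^esub> r = (\<Union>z\<in>N +> x. N +> (z \<otimes> r))"
      unfolding Q_def quotient_module_def by (simp add: ops) (simp add: regular_module_def)
    ultimately show ?thesis by blast
  qed
qed

text \<open>Doubling makes the map from \<open>R\<close> to \<open>R^2\<close> with components
  \<open>a\<close> and \<open>b\<close> surjective, and \<open>N\<close> is its kernel. Conversely,
  \<open>a\<close> and \<open>b\<close> are the coordinates of the pair that corresponds to the
  class of 1, and \<open>x\<close>, \<open>y\<close> represent the images of the two unit vectors;
  the equations follow from injectivity.\<close>

theorem doubling_iff_square_is_quotient:
  "doubling R \<longleftrightarrow> (\<exists>N. right_submodule R N (regular_module R) \<and>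
     right_module_iso R (module_sum (regular_module R) (regular_module R))
       (quotient_module (regular_module R) N))"
proof
  assume "doubling R"
  then obtain a b x y where c [simp]: "a \<in> carrier R" "b \<in> carrier R" "x \<in> carrier R" "y \<in> carrier R"
    and e: "a \<otimes> x = \<one>" "b \<otimes> y = \<one>" "a \<otimes> y = \<zero>" "b \<otimes> x = \<zero>"
    unfolding doubling_def by blast
  have cancel: "a \<otimes> (x \<otimes> r) = r" "b \<otimes> (y \<otimes> r) = r" "a \<otimes> (y \<otimes> r) = \<zero>" "b \<otimes> (x \<otimes> r) = \<zero>"
    if "r \<in> carrier R" for r
    using that e by (simp_all flip: m_assoc)
  define N where "N = {r \<in> carrier R. a \<otimes> r = \<zero> \<and> b \<otimes> r = \<zero>}"
  have "subgroup N (add_monoid R)"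
  proof (rule add.subgroupI)
    show "\<ominus> r \<in> N" if "r \<in> N" for r
      using that by (auto simp: N_def r_minus)
  next
    have "\<zero> \<in> N" by (simp add: N_def)
    then show "N \<noteq> {}" by blast
  qed (auto simp: N_def r_distr)
  then have "additive_subgroup N R" by (rule additive_subgroup.intro)
  then have sub: "right_submodule R N (regular_module R)"
    unfolding right_submodule_regular_iff by (auto simp: N_def simp flip: m_assoc)
  let ?Q = "quotient_module (regular_module R) N" and ?S = "module_sum (regular_module R) (regular_module R)"
  note Q = quotient_regular_module[OF sub]
  note S = regular_module_square
  define h where "h = (\<lambda>(r, s). N +> (x \<otimes> r \<oplus> y \<otimes> s))"
  have inj: "inj_on h (carrier R \<times> carrier R)"
  proof (rule inj_onI, clarify)
    fix r s r' s' assume c': "r \<in> carrier R" "s \<in> carrier R" "r' \<in> carrier R" "s' \<in> carrier R"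
      and "h (r, s) = h (r', s')"
    then have "(x \<otimes> r \<oplus> y \<otimes> s) \<ominus> (x \<otimes> r' \<oplus> y \<otimes> s') \<in> N"
      by (simp add: h_def Q(4))
    moreover have "a \<otimes> ((x \<otimes> r \<oplus> y \<otimes> s) \<ominus> (x \<otimes> r' \<oplus> y \<otimes> s')) = r \<ominus> r'"
      "b \<otimes> ((x \<otimes> r \<oplus> y \<otimes> s) \<ominus> (x \<otimes> r' \<oplus> y \<otimes> s')) = s \<ominus> s'"
      using c' by (simp_all add: a_minus_def r_distr r_minus cancel)
    ultimately show "r = r' \<and> s = s'"
      using c' by (simp add: N_def)
  qed
  have "N +> r \<in> h ` (carrier R \<times> carrier R)" if r: "r \<in> carrier R" for r
  proof -
    have "(x \<otimes> (a \<otimes> r) \<oplus> y \<otimes> (b \<otimes> r)) \<ominus> r \<in> N"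
      using r by (simp add: N_def a_minus_def r_distr r_minus cancel r_neg)
    then have "h (a \<otimes> r, b \<otimes> r) = N +> r" using r by (simp add: h_def Q(4))
    then show ?thesis using r by (metis SigmaI c(1,2) image_eqI m_closed)
  qed
  then have "bij_betw h (carrier ?S) (carrier ?Q)"
    using inj by (auto simp: bij_betw_def S Q(1) h_def)
  moreover have "h \<in> hom (add_monoid ?S) (add_monoid ?Q)"
  proof (rule homI)
    fix z z' assume "z \<in> carrier (add_monoid ?S)" "z' \<in> carrier (add_monoid ?S)"
    then obtain p q p' q' where z: "z = (p, q)" "z' = (p', q')"
      and c': "p \<in> carrier R" "q \<in> carrier R" "p' \<in> carrier R" "q' \<in> carrier R" by (auto simp: S)
    have "x \<otimes> (p \<oplus> p') \<oplus> y \<otimes> (q \<oplus> q') = (x \<otimes> p \<oplus> y \<otimes> q) \<oplus> (x \<otimes> p' \<oplus> y \<otimes> q')"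
      using c' by (simp add: r_distr a_ac)
    then show "h (z \<otimes>\<^bsub>add_monoid ?S\<^esub> z') = h z \<otimes>\<^bsub>add_monoid ?Q\<^esub> h z'"
      using c' by (simp add: z S h_def Q(2))
  qed (auto simp: S Q(1) h_def)
  moreover have "\<forall>z\<in>carrier ?S. \<forall>r\<in>carrier R. h (z \<star>\<^bsub>?S\<^esub> r) = h z \<star>\<^bsub>?Q\<^esub> r"
  proof (intro ballI)
    fix z r assume "z \<in> carrier ?S" and r: "r \<in> carrier R"
    then obtain p q where z: "z = (p, q)" and c': "p \<in> carrier R" "q \<in> carrier R" by (auto simp: S)
    show "h (z \<star>\<^bsub>?S\<^esub> r) = h z \<star>\<^bsub>?Q\<^esub> r"
      using c' r by (simp add: z S h_def Q(3) l_distr m_assoc)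
  qed
  ultimately show "\<exists>N. right_submodule R N (regular_module R) \<and>
     right_module_iso R ?S (quotient_module (regular_module R) N)"
    using sub unfolding right_module_iso_def iso_def by auto
next
  let ?S = "module_sum (regular_module R) (regular_module R)"
  assume "\<exists>N. right_submodule R N (regular_module R) \<and>
     right_module_iso R ?S (quotient_module (regular_module R) N)"
  then obtain N h where sub: "right_submodule R N (regular_module R)"
    and h: "h \<in> iso (add_monoid ?S) (add_monoid (quotient_module (regular_module R) N))"
    and lin: "\<And>z r. z \<in> carrier ?S \<Longrightarrow> r \<in> carrier R \<Longrightarrow>
      h (z \<star>\<^bsub>?S\<^esub> r) = h z \<star>\<^bsub>quotient_module (regular_module R) N\<^esub> r"
    unfolding right_module_iso_def by (elim exE conjE bexE) (rule that, assumption, assumption, blast)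
  note Q = quotient_regular_module[OF sub]
  note S = regular_module_square
  have bij: "bij_betw h (carrier R \<times> carrier R) ((\<lambda>x. N +> x) ` carrier R)"
    using h by (simp add: iso_def S Q(1))
  have "N +> \<one> \<in> h ` (carrier R \<times> carrier R)" using bij by (auto simp: bij_betw_def)
  then obtain a b where ab: "a \<in> carrier R" "b \<in> carrier R" "h (a, b) = N +> \<one>" by auto
  obtain x where x: "x \<in> carrier R" "h (\<one>, \<zero>) = N +> x" using bij_betwE[OF bij] by blast
  obtain y where y: "y \<in> carrier R" "h (\<zero>, \<one>) = N +> y" using bij_betwE[OF bij] by blast
  have inv: "h (a \<otimes> r, b \<otimes> r) = N +> r" if "r \<in> carrier R" for r
    using lin[of "(a, b)" r] ab that by (simp add: S Q)
  have "(a \<otimes> x, b \<otimes> x) = (\<one>, \<zero>)"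
    by (rule inj_onD[OF bij_betw_imp_inj_on[OF bij]]) (use inv x ab in auto)
  moreover have "(a \<otimes> y, b \<otimes> y) = (\<zero>, \<one>)"
    by (rule inj_onD[OF bij_betw_imp_inj_on[OF bij]]) (use inv y ab in auto)
  ultimately show "doubling R" unfolding doubling_def using ab x y by blast
qed

end

section \<open>Calculations modulo the Leavitt relations\<close>

abbreviation vert :: "'v \<Rightarrow> ('v, 'e) generator free_word \<Rightarrow>\<^sub>0 'k::field" where
  "vert v \<equiv> letter (Vert v)"

abbreviation arc_letter :: "'e \<Rightarrow> ('v, 'e) generator free_word \<Rightarrow>\<^sub>0 'k::field" where
  "arc_letter e \<equiv> letter (Arc e)"

abbreviation ghost_letter :: "'e \<Rightarrow> ('v, 'e) generator free_word \<Rightarrow>\<^sub>0 'k::field" where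
  "ghost_letter e \<equiv> letter (Ghost e)"

definition arcs_word :: "'e list \<Rightarrow> ('v, 'e) generator free_word \<Rightarrow>\<^sub>0 'k::field" where
  "arcs_word p = prod_list (map arc_letter p)"

definition ghosts_word :: "'e list \<Rightarrow> ('v, 'e) generator free_word \<Rightarrow>\<^sub>0 'k::field" where
  "ghosts_word p = prod_list (map ghost_letter (rev p))"

lemma arcs_word_simps [simp]: "arcs_word [] = 1" "arcs_word (e # p) = arc_letter e * arcs_word p"
  "arcs_word (p @ q) = arcs_word p * arcs_word q"
  by (simp_all add: arcs_word_def)

lemma ghosts_word_simps [simp]: "ghosts_word [] = 1" "ghosts_word (e # p) = ghosts_word p * ghost_letter e"
  by (simp_all add: ghosts_word_def)

text \<open>The leading vertex lets the empty path stand for \<open>v\<close>. Its bare word would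
  be the unit of the free algebra, which does not lie in the nonunital part.\<close>

definition path_elem :: "'v \<Rightarrow> 'e list \<Rightarrow> ('v, 'e) generator free_word \<Rightarrow>\<^sub>0 'k::field" where
  "path_elem v p = vert v * arcs_word p"

definition ghost_elem :: "'v \<Rightarrow> 'e list \<Rightarrow> ('v, 'e) generator free_word \<Rightarrow>\<^sub>0 'k::field" where
  "ghost_elem v p = ghosts_word p * vert v"

context fin_digraph
begin

abbreviation free_carrier :: "(('a, 'b) generator free_word \<Rightarrow>\<^sub>0 'k::field) set" where
  "free_carrier \<equiv> carrier (free_algebra (generators G))"

text \<open>Membership in the free algebra is built in, so that chains of congruences carry it
  along. The relation lives on the unital free algebra, so 1 and bare words may occur in
  calculations.\<close>

definition leavitt_eq ::
  "(('a, 'b) generator free_word \<Rightarrow>\<^sub>0 'k::field) \<Rightarrow> (('a, 'b) generator free_word \<Rightarrow>\<^sub>0 'k) \<Rightarrow> bool"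
  (infix \<open>\<approx>\<close> 50) where
  "f \<approx> g \<longleftrightarrow> f \<in> free_carrier \<and> g \<in> free_carrier \<and> f - g \<in> leavitt_ideal G"

lemma leavitt_eq_refl: "f \<in> free_carrier \<Longrightarrow> f \<approx> f"
  by (simp add: leavitt_eq_def I_closed(2))

lemma leavitt_eq_sym: "f \<approx> g \<Longrightarrow> g \<approx> f"
  using I_minus[of "f - g"] by (simp add: leavitt_eq_def)

lemma leavitt_eq_trans [trans]: "f \<approx> g \<Longrightarrow> g \<approx> h \<Longrightarrow> f \<approx> h"
  using I_closed(1)[of "f - g" "g - h"] by (simp add: leavitt_eq_def)

lemma leavitt_eq_add: "f \<approx> f' \<Longrightarrow> g \<approx> g' \<Longrightarrow> f + g \<approx> f' + g'"
  using I_closed(1)[of "f - f'" "g - g'"] by (simp add: leavitt_eq_def free_algebra_add algebra_simps)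

lemma leavitt_eq_mult: "f \<approx> f' \<Longrightarrow> g \<approx> g' \<Longrightarrow> f * g \<approx> f' * g'"
proof -
  assume fg: "f \<approx> f'" "g \<approx> g'"
  have "f * g - f' * g' = (f - f') * g + f' * (g - g')" by (simp add: algebra_simps)
  moreover have "\<dots> \<in> leavitt_ideal G"
    using fg by (intro I_closed(1) I_closed(3) I_closed(4)) (auto simp: leavitt_eq_def)
  ultimately show ?thesis using fg by (simp add: leavitt_eq_def free_algebra_mult)
qed

lemma leavitt_eq_mult_left: "g \<approx> g' \<Longrightarrow> f \<in> free_carrier \<Longrightarrow> f * g \<approx> f * g'"
  by (intro leavitt_eq_mult leavitt_eq_refl)

lemma leavitt_eq_mult_right: "f \<approx> f' \<Longrightarrow> g \<in> free_carrier \<Longrightarrow> f * g \<approx> f' * g"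
  by (intro leavitt_eq_mult leavitt_eq_refl)

lemma leavitt_eq_sum: "(\<And>i. i \<in> S \<Longrightarrow> f i \<approx> g i) \<Longrightarrow> sum f S \<approx> sum g S"
  by (induction S rule: infinite_finite_induct)
    (auto intro: leavitt_eq_add leavitt_eq_refl free_algebra_zero)

lemma generators_in_free_carrier [simp]:
  "v \<in> verts G \<Longrightarrow> vert v \<in> free_carrier"
  "e \<in> arcs G \<Longrightarrow> arc_letter e \<in> free_carrier"
  "e \<in> arcs G \<Longrightarrow> ghost_letter e \<in> free_carrier"
  by (auto intro!: free_algebra_letter generatorsI)

lemma free_carrier_closed [simp]:
  "f \<in> free_carrier \<Longrightarrow> g \<in> free_carrier \<Longrightarrow> f * g \<in> free_carrier" "1 \<in> free_carrier"
  by (auto intro: free_algebra_mult free_algebra_one)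

lemma words_in_free_carrier [simp]:
  "set p \<subseteq> arcs G \<Longrightarrow> arcs_word p \<in> free_carrier" "set p \<subseteq> arcs G \<Longrightarrow> ghosts_word p \<in> free_carrier"
  by (induction p) auto

lemma path_elems_in_free_carrier [simp]:
  "v \<in> verts G \<Longrightarrow> set p \<subseteq> arcs G \<Longrightarrow> path_elem v p \<in> free_carrier"
  "v \<in> verts G \<Longrightarrow> set p \<subseteq> arcs G \<Longrightarrow> ghost_elem v p \<in> free_carrier"
  by (auto simp: path_elem_def ghost_elem_def)

lemma awalk_arcs: "awalk u p v \<Longrightarrow> set p \<subseteq> arcs G" "awalk u p v \<Longrightarrow> u \<in> verts G"
  by (auto simp: awalk_def)

lemma relationI: "f - g \<in> leavitt_relations G \<Longrightarrow> f \<in> free_carrier \<Longrightarrow> g \<in> free_carrier \<Longrightarrow> f \<approx> g"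
  by (simp add: leavitt_eq_def rel_I)

lemma vert_vert:
  "v \<in> verts G \<Longrightarrow> w \<in> verts G \<Longrightarrow>
    (vert v * vert w :: _ \<Rightarrow>\<^sub>0 'k::field) \<approx> (if v = w then vert v else 0)"
  using leavitt_relations.V[of v G w, where ?'k = 'k]
  by (intro relationI) (auto intro: free_algebra_zero)

lemma vert_idem: "v \<in> verts G \<Longrightarrow> vert v * vert v \<approx> vert v"
  using vert_vert[of v v] by simp

lemma vert_arc: "e \<in> arcs G \<Longrightarrow> vert (tail G e) * arc_letter e \<approx> arc_letter e"
  using leavitt_relations.E_source[of "Arc e" G] by (intro relationI) auto

lemma arc_vert: "e \<in> arcs G \<Longrightarrow> arc_letter e * vert (head G e) \<approx> arc_letter e"
  using leavitt_relations.E_target[of "Arc e" G] by (intro relationI) auto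

lemma vert_ghost: "e \<in> arcs G \<Longrightarrow> vert (head G e) * ghost_letter e \<approx> ghost_letter e"
  using leavitt_relations.E_source[of "Ghost e" G] by (intro relationI) auto

lemma ghost_vert: "e \<in> arcs G \<Longrightarrow> ghost_letter e * vert (tail G e) \<approx> ghost_letter e"
  using leavitt_relations.E_target[of "Ghost e" G] by (intro relationI) auto

lemma ghost_arc:
  "e \<in> arcs G \<Longrightarrow> f \<in> arcs G \<Longrightarrow>
    (ghost_letter e * arc_letter f :: _ \<Rightarrow>\<^sub>0 'k::field) \<approx> (if e = f then vert (head G e) else 0)"
  using leavitt_relations.CK1[of e G f, where ?'k = 'k]
  by (intro relationI) (auto intro: free_algebra_zero)

lemma vert_sum:
  "v \<in> verts G \<Longrightarrow> out_arcs G v \<noteq> {} \<Longrightarrow> vert v \<approx> (\<Sum>e\<in>out_arcs G v. arc_letter e * ghost_letter e)"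
  by (rule relationI) (auto intro!: leavitt_relations.CK2 free_algebra_sum)

lemma ghost_vert_arc:
  assumes "e \<in> arcs G" "f \<in> arcs G" "tail G e = tail G f"
  shows "ghost_letter e * vert (tail G e) * arc_letter f \<approx> (if e = f then vert (head G e) else 0)"
proof -
  have "ghost_letter e * vert (tail G e) * arc_letter f \<approx> ghost_letter e * arc_letter f"
    using assms by (intro leavitt_eq_mult_right ghost_vert) auto
  also have "\<dots> \<approx> (if e = f then vert (head G e) else 0)" using assms by (intro ghost_arc)
  finally show ?thesis .
qed

text \<open>CK1 cancels the innermost pair of letters. The vertex in the middle is what the previous
  cancellation leaves behind, so the induction keeps its form.\<close>

lemma ghosts_arcs:
  "awalk u p v \<Longrightarrow> (ghosts_word p * vert u * arcs_word p :: _ \<Rightarrow>\<^sub>0 'k::field) \<approx> vert v"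
proof (induction p arbitrary: u)
  case Nil
  then show ?case by (auto simp: awalk_simps intro: leavitt_eq_refl)
next
  case (Cons e p)
  then have e: "e \<in> arcs G" "u = tail G e" "awalk (head G e) p v" by (auto simp: awalk_Cons_iff)
  have "(ghosts_word (e # p) * vert u * arcs_word (e # p) :: _ \<Rightarrow>\<^sub>0 'k) =
    ghosts_word p * (ghost_letter e * vert u * arc_letter e) * arcs_word p"
    by (simp add: mult.assoc)
  also have "\<dots> \<approx> ghosts_word p * vert (head G e) * arcs_word p"
    using e ghost_vert_arc[of e e] awalk_arcs[OF e(3)]
    by (intro leavitt_eq_mult_right leavitt_eq_mult_left) simp_all
  also have "\<dots> \<approx> vert v" using Cons.IH e(3) .
  finally show ?case .
qed

text \<open>Equal leading arcs cancel as in \<open>ghosts_arcs\<close>. Incomparability guarantees a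
  position where the arcs differ, and there CK1 gives zero.\<close>

lemma ghosts_arcs_parallel:
  "awalk u p v \<Longrightarrow> awalk u q w \<Longrightarrow> parallel p q \<Longrightarrow>
    (ghosts_word p * vert u * arcs_word q :: _ \<Rightarrow>\<^sub>0 'k::field) \<approx> 0"
proof (induction p arbitrary: u q)
  case Nil
  then show ?case by simp
next
  case (Cons e p)
  from Cons.prems(3) obtain f q' where q: "q = f # q'" by (cases q) auto
  have e: "e \<in> arcs G" "u = tail G e" "awalk (head G e) p v"
    and f: "f \<in> arcs G" "u = tail G f" "awalk (head G f) q' w"
    using Cons.prems(1,2) unfolding q by (auto simp: awalk_Cons_iff)
  have "(ghosts_word (e # p) * vert u * arcs_word q :: _ \<Rightarrow>\<^sub>0 'k) =
    ghosts_word p * (ghost_letter e * vert u * arc_letter f) * arcs_word q'"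
    by (simp add: mult.assoc q)
  also have "\<dots> \<approx> ghosts_word p * (if e = f then vert (head G e) else 0) * arcs_word q'"
    using e f ghost_vert_arc[of e f] awalk_arcs[OF e(3)] awalk_arcs[OF f(3)]
    by (intro leavitt_eq_mult_right leavitt_eq_mult_left) simp_all
  also have "\<dots> \<approx> 0"
  proof (cases "e = f")
    case True
    then have "parallel p q'" using Cons.prems(3) q by (simp add: parallel_def)
    then show ?thesis using Cons.IH[OF e(3)] f(3) True by simp
  qed (auto intro: leavitt_eq_refl free_algebra_zero)
  finally show ?case .
qed

lemma ghost_elem_path_elem:
  assumes "awalk u p v"
  shows "ghost_elem u p * path_elem u p \<approx> vert v"
proof -
  have "ghost_elem u p * path_elem u p = ghosts_word p * (vert u * vert u) * arcs_word p"
    by (simp add: ghost_elem_def path_elem_def mult.assoc)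
  also have "\<dots> \<approx> ghosts_word p * vert u * arcs_word p"
    using awalk_arcs[OF assms] by (intro leavitt_eq_mult_right leavitt_eq_mult_left vert_idem) auto
  also have "\<dots> \<approx> vert v" by (rule ghosts_arcs) fact
  finally show ?thesis .
qed

lemma ghost_elem_path_elem_zero:
  assumes "awalk u p v" "awalk u' q w" "u \<noteq> u' \<or> parallel p q"
  shows "ghost_elem u p * path_elem u' q \<approx> 0"
proof -
  have "ghost_elem u p * path_elem u' q = ghosts_word p * (vert u * vert u') * arcs_word q"
    by (simp add: ghost_elem_def path_elem_def mult.assoc)
  also have "\<dots> \<approx> ghosts_word p * (if u = u' then vert u else 0) * arcs_word q"
    using awalk_arcs[OF assms(1)] awalk_arcs[OF assms(2)]
    by (intro leavitt_eq_mult_right leavitt_eq_mult_left vert_vert) auto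
  also have "\<dots> \<approx> 0"
    using ghosts_arcs_parallel[OF assms(1)] assms by (auto intro: leavitt_eq_refl free_algebra_zero)
  finally show ?thesis .
qed

lemma path_elem_vert: "awalk u p v \<Longrightarrow> (path_elem u p * vert v :: _ \<Rightarrow>\<^sub>0 'k::field) \<approx> path_elem u p"
proof (induction p arbitrary: u)
  case Nil
  then show ?case by (auto simp: path_elem_def awalk_simps intro: vert_idem)
next
  case (Cons e p)
  then have e: "e \<in> arcs G" "u = tail G e" "awalk (head G e) p v" by (auto simp: awalk_Cons_iff)
  have v: "v \<in> verts G" and u: "u \<in> verts G" using Cons.prems by auto
  note c = awalk_arcs[OF e(3)]
  have shift: "(path_elem u (e # p) :: _ \<Rightarrow>\<^sub>0 'k) \<approx> vert u * arc_letter e * path_elem (head G e) p"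
  proof -
    have "(vert u * (arc_letter e * vert (head G e)) * arcs_word p :: _ \<Rightarrow>\<^sub>0 'k) \<approx> vert u * arc_letter e * arcs_word p"
      using e u c by (intro leavitt_eq_mult_right leavitt_eq_mult_left arc_vert) auto
    from leavitt_eq_sym[OF this] show ?thesis by (simp add: path_elem_def mult.assoc)
  qed
  have "(path_elem u (e # p) * vert v :: _ \<Rightarrow>\<^sub>0 'k) \<approx> vert u * arc_letter e * path_elem (head G e) p * vert v"
    using shift v by (intro leavitt_eq_mult_right) auto
  also have "\<dots> = vert u * arc_letter e * (path_elem (head G e) p * vert v)" by (simp add: mult.assoc)
  also have "\<dots> \<approx> vert u * arc_letter e * path_elem (head G e) p"
    using Cons.IH[OF e(3)] e u by (intro leavitt_eq_mult_left) auto
  also have "\<dots> \<approx> path_elem u (e # p)" using shift by (rule leavitt_eq_sym)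
  finally show ?case .
qed

lemma path_elem_Cons:
  assumes "e \<in> arcs G" "set p \<subseteq> arcs G"
  shows "path_elem (tail G e) (e # p) \<approx> arc_letter e * path_elem (head G e) p"
proof -
  have "path_elem (tail G e) (e # p) = (vert (tail G e) * arc_letter e) * arcs_word p"
    by (simp add: path_elem_def mult.assoc)
  also have "\<dots> \<approx> arc_letter e * arcs_word p" using assms by (intro leavitt_eq_mult_right vert_arc) auto
  also have "\<dots> \<approx> (arc_letter e * vert (head G e)) * arcs_word p"
    using assms by (intro leavitt_eq_mult_right leavitt_eq_sym[OF arc_vert]) auto
  finally show ?thesis by (simp add: path_elem_def mult.assoc)
qed

lemma ghost_elem_Cons:
  assumes "e \<in> arcs G" "set p \<subseteq> arcs G"
  shows "ghost_elem (tail G e) (e # p) \<approx> ghost_elem (head G e) p * ghost_letter e"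
proof -
  have "ghost_elem (tail G e) (e # p) = ghosts_word p * (ghost_letter e * vert (tail G e))"
    by (simp add: ghost_elem_def mult.assoc)
  also have "\<dots> \<approx> ghosts_word p * ghost_letter e" using assms by (intro leavitt_eq_mult_left ghost_vert) auto
  also have "\<dots> \<approx> ghosts_word p * (vert (head G e) * ghost_letter e)"
    using assms by (intro leavitt_eq_mult_left leavitt_eq_sym[OF vert_ghost]) auto
  finally show ?thesis by (simp add: ghost_elem_def mult.assoc)
qed

definition leavitt_class ::
  "(('a, 'b) generator free_word \<Rightarrow>\<^sub>0 'k::field) \<Rightarrow> (('a, 'b) generator free_word \<Rightarrow>\<^sub>0 'k) set" where
  "leavitt_class f = leavitt_ideal G +>\<^bsub>free_algebra (generators G)\<^esub> f"

text \<open>The interface to the quotient: calculations are made on representatives, and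
  \<open>\<approx>\<close> decides equality of classes.\<close>

lemma leavitt_ops:
  fixes L :: "('k::field, (('a, 'b) generator free_word \<Rightarrow>\<^sub>0 'k) set) module"
    and N :: "(('a, 'b) generator free_word \<Rightarrow>\<^sub>0 'k) set"
  defines "L \<equiv> leavitt_path_algebra G" and "N \<equiv> nonunital_part (generators G)"
  shows "carrier L = leavitt_class ` N" "\<one>\<^bsub>L\<^esub> = leavitt_class (\<Sum>v\<in>verts G. vert v)" "\<zero>\<^bsub>L\<^esub> = leavitt_class 0"
    "\<And>f g. f \<in> N \<Longrightarrow> g \<in> N \<Longrightarrow> leavitt_class f \<otimes>\<^bsub>L\<^esub> leavitt_class g = leavitt_class (f * g)"
    "\<And>f g. f \<in> N \<Longrightarrow> g \<in> N \<Longrightarrow> leavitt_class f \<oplus>\<^bsub>L\<^esub> leavitt_class g = leavitt_class (f + g)"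
    "\<And>a f. f \<in> N \<Longrightarrow> a \<odot>\<^bsub>L\<^esub> leavitt_class f = leavitt_class (Poly_Mapping.single 0 a * f)"
    "\<And>f g. f \<in> N \<Longrightarrow> g \<in> N \<Longrightarrow> leavitt_class f = leavitt_class g \<longleftrightarrow> f \<approx> g"
proof -
  let ?F = "free_algebra (generators G) :: ('k, ('a, 'b) generator free_word \<Rightarrow>\<^sub>0 'k) module"
  let ?I = "leavitt_ideal G :: (('a, 'b) generator free_word \<Rightarrow>\<^sub>0 'k) set"
  interpret F: field_algebra ?F by (rule field_algebra_free_algebra)
  interpret I: ideal ?I ?F by (rule ideal_leavitt)
  have L: "L = (quotient_algebra ?F ?I)\<lparr>carrier := leavitt_class ` N, one := leavitt_class (\<Sum>v\<in>verts G. vert v)\<rparr>"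
    by (simp add: leavitt_path_algebra_def Let_def L_def N_def leavitt_class_def[abs_def])
  have N: "f \<in> carrier ?F" if "f \<in> N" for f using that by (simp add: N_def nonunital_part_def)
  show "carrier L = leavitt_class ` N" "\<one>\<^bsub>L\<^esub> = leavitt_class (\<Sum>v\<in>verts G. vert v)" by (simp_all add: L)
  have "0 \<in> ?I" by (rule I_closed(2))
  then show "\<zero>\<^bsub>L\<^esub> = leavitt_class 0"
    using I.a_rcos_const[of 0] by (simp add: L leavitt_class_def quotient_algebra_def FactRing_def)
  show "leavitt_class f \<otimes>\<^bsub>L\<^esub> leavitt_class g = leavitt_class (f * g)" if "f \<in> N" "g \<in> N" for f g
    using that I.rcoset_mult_add[of f g] N by (simp add: L leavitt_class_def quotient_algebra_def FactRing_def F_ops)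
  show "leavitt_class f \<oplus>\<^bsub>L\<^esub> leavitt_class g = leavitt_class (f + g)" if "f \<in> N" "g \<in> N" for f g
    using that I.a_rcos_sum[of f g] N by (simp add: L leavitt_class_def quotient_algebra_def FactRing_def F_ops)
  show "a \<odot>\<^bsub>L\<^esub> leavitt_class f = leavitt_class (Poly_Mapping.single 0 a * f)" if "f \<in> N" for a f
    using F.coset_smult[OF ideal_leavitt N[OF that], of a] by (simp add: L leavitt_class_def quotient_algebra_def F_ops)
  show "leavitt_class f = leavitt_class g \<longleftrightarrow> f \<approx> g" if "f \<in> N" "g \<in> N" for f g
  proof
    assume "leavitt_class f = leavitt_class g"
    moreover have "f \<in> leavitt_class f"
      using N[OF that(1)] I_closed(2) by (auto simp: leavitt_class_def a_r_coset_def' F_ops intro!: bexI[of _ 0])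
    ultimately obtain i where "i \<in> ?I" "f = i + g" by (auto simp: leavitt_class_def a_r_coset_def' F_ops)
    then show "f \<approx> g" using N that by (simp add: leavitt_eq_def)
  next
    assume "f \<approx> g"
    then show "leavitt_class f = leavitt_class g" unfolding leavitt_class_def
      by (intro F.coset_eqI[OF ideal_leavitt, where j = "f - g"]) (auto simp: leavitt_eq_def F_ops)
  qed
qed

end

section \<open>Digraphs without maximal sinks and cycles\<close>

context fin_digraph
begin

definition hereditary_core :: "'a set" where
  "hereditary_core = {w. \<exists>u. core G u \<and> u \<rightarrow>\<^sup>* w}"

lemma closed_walk_in_hereditary_core:
  assumes "\<nexists>u. maximal_in G u" "x \<rightarrow>\<^sup>+ x"
  shows "x \<in> hereditary_core"
proof (rule ccontr)
  assume "x \<notin> hereditary_core"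
  moreover obtain p where "awalk x p x" "p \<noteq> []" using assms(2) reachable1_awalk by blast
  ultimately show False
    using closed_walk_without_core assms(1) unfolding hereditary_core_def by blast
qed

text \<open>A cycle of this relation would be a closed walk through a vertex outside the hereditary
  core. Induction along the relation passes from the heads of the arcs leaving \<open>v\<close> to
  \<open>v\<close>.\<close>

lemma wf_outside_hereditary_core:
  assumes "\<nexists>u. maximal_in G u"
  shows "wf {(head G e, tail G e) | e. e \<in> arcs G \<and> tail G e \<notin> hereditary_core}" (is "wf ?R")
proof (rule finite_acyclic_wf)
  have "?R = (\<lambda>e. (head G e, tail G e)) ` {e \<in> arcs G. tail G e \<notin> hereditary_core}" by auto
  then show "finite ?R" by simp
  have "x \<rightarrow>\<^sup>+ y \<and> x \<notin> hereditary_core" if "(y, x) \<in> ?R\<^sup>+" for x y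
    using that
  proof (induction rule: trancl_induct)
    case (base x)
    then show ?case by (auto simp: in_arcs_imp_in_arcs_ends)
  next
    case (step x' x)
    then obtain e where "e \<in> arcs G" "x' = head G e" "x = tail G e" "x \<notin> hereditary_core" by auto
    then show ?case using step.IH in_arcs_imp_in_arcs_ends[of e] by (auto intro: trancl_into_trancl2)
  qed
  then show "acyclic ?R" using closed_walk_in_hereditary_core[OF assms] unfolding acyclic_def by blast
qed

text \<open>CK2 rewrites \<open>v\<close> over its outgoing arcs and is repeated at their heads
  until the hereditary core is reached. This ends by \<open>wf_outside_hereditary_core\<close>, and
  by \<open>sink_without_core\<close> no sink is met outside the core.\<close>

lemma vertex_expansion:
  assumes no_max: "\<nexists>u. maximal_in G u" and "v \<in> verts G"
  shows "\<exists>S. finite S \<and> (\<forall>p\<in>S. \<exists>w. awalk v p w \<and> w \<in> hereditary_core) \<and>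
    (\<Sum>p\<in>S. path_elem v p * ghost_elem v p :: _ \<Rightarrow>\<^sub>0 'k::field) \<approx> vert v"
  using \<open>v \<in> verts G\<close>
proof (induction v rule: wf_induct_rule[OF wf_outside_hereditary_core[OF no_max]])
  case (1 v)
  show ?case
  proof (cases "v \<in> hereditary_core")
    case True
    moreover have "(vert v * vert v :: _ \<Rightarrow>\<^sub>0 'k) \<approx> vert v" using 1(2) by (rule vert_idem)
    ultimately show ?thesis using 1(2)
      by (intro exI[of _ "{[]}"]) (auto simp: path_elem_def ghost_elem_def awalk_simps)
  next
    case False
    have ne: "out_arcs G v \<noteq> {}"
      using sink_without_core[of v] no_max False 1(2) unfolding hereditary_core_def sinks_def by blast
    define P where "P e S \<longleftrightarrow> finite S \<and> (\<forall>p\<in>S. \<exists>w. awalk (head G e) p w \<and> w \<in> hereditary_core) \<and>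
      (\<Sum>p\<in>S. path_elem (head G e) p * ghost_elem (head G e) p :: _ \<Rightarrow>\<^sub>0 'k) \<approx> vert (head G e)" for e S
    have "\<forall>e\<in>out_arcs G v. \<exists>S. P e S"
    proof
      fix e assume "e \<in> out_arcs G v"
      then have "e \<in> arcs G" "tail G e = v" by auto
      then show "\<exists>S. P e S" unfolding P_def using False by (intro 1(1)) auto
    qed
    then obtain S where S: "\<And>e. e \<in> out_arcs G v \<Longrightarrow> P e (S e)" using bchoice[of "out_arcs G v" P] by blast
    define T where "T = (\<Union>e\<in>out_arcs G v. Cons e ` S e)"
    have "(\<Sum>p\<in>T. path_elem v p * ghost_elem v p :: _ \<Rightarrow>\<^sub>0 'k) =
      (\<Sum>e\<in>out_arcs G v. \<Sum>p\<in>Cons e ` S e. path_elem v p * ghost_elem v p)"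
      unfolding T_def using S by (intro sum.UNION_disjoint) (auto simp: P_def)
    also have "\<dots> = (\<Sum>e\<in>out_arcs G v. \<Sum>p\<in>S e. path_elem v (e # p) * ghost_elem v (e # p))"
      by (intro sum.cong refl sum.reindex_cong[of "Cons _"]) auto
    also have "\<dots> \<approx> (\<Sum>e\<in>out_arcs G v. \<Sum>p\<in>S e. (arc_letter e * path_elem (head G e) p) * (ghost_elem (head G e) p * ghost_letter e))"
    proof (intro leavitt_eq_sum)
      fix e p assume ep: "e \<in> out_arcs G v" "p \<in> S e"
      then have e: "e \<in> arcs G" "v = tail G e" by auto
      obtain w where "awalk (head G e) p w" using S[OF ep(1)] ep(2) unfolding P_def by blast
      then have "set p \<subseteq> arcs G" by (rule awalk_arcs)
      then show "path_elem v (e # p) * ghost_elem v (e # p) \<approx>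
        (arc_letter e * path_elem (head G e) p) * (ghost_elem (head G e) p * ghost_letter e)"
        unfolding e(2) using e(1) by (intro leavitt_eq_mult path_elem_Cons ghost_elem_Cons)
    qed
    also have "\<dots> = (\<Sum>e\<in>out_arcs G v. arc_letter e * (\<Sum>p\<in>S e. path_elem (head G e) p * ghost_elem (head G e) p) * ghost_letter e)"
      by (simp add: sum_distrib_left sum_distrib_right mult.assoc)
    also have "\<dots> \<approx> (\<Sum>e\<in>out_arcs G v. arc_letter e * vert (head G e) * ghost_letter e)"
      using S by (intro leavitt_eq_sum leavitt_eq_mult_left leavitt_eq_mult_right) (auto simp: P_def)
    also have "\<dots> \<approx> (\<Sum>e\<in>out_arcs G v. arc_letter e * ghost_letter e)"
      by (intro leavitt_eq_sum leavitt_eq_mult_right arc_vert) auto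
    also have "\<dots> \<approx> vert v" by (rule leavitt_eq_sym[OF vert_sum]) (use 1(2) ne in auto)
    finally have "(\<Sum>p\<in>T. path_elem v p * ghost_elem v p :: _ \<Rightarrow>\<^sub>0 'k) \<approx> vert v" .
    moreover have "finite T" unfolding T_def using S by (auto simp: P_def)
    moreover have "\<forall>p\<in>T. \<exists>w. awalk v p w \<and> w \<in> hereditary_core"
    proof
      fix p assume "p \<in> T"
      then obtain e q where q: "e \<in> out_arcs G v" "q \<in> S e" "p = e # q" by (auto simp: T_def)
      then obtain w where "awalk (head G e) q w" "w \<in> hereditary_core" using S unfolding P_def by blast
      then have "awalk v p w" using q by (auto simp: awalk_Cons_iff)
      then show "\<exists>w. awalk v p w \<and> w \<in> hereditary_core" using \<open>w \<in> hereditary_core\<close> by blast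
    qed
    ultimately show ?thesis by blast
  qed
qed

text \<open>Cancelling the smaller power of \<open>c\<close> leaves a word starting with
  \<open>d\<close> against one starting with \<open>c\<close>, and incomparable words stay
  incomparable when extended.\<close>

lemma parallel_powers:
  assumes "parallel c d" "k \<noteq> l"
  shows "parallel (concat (replicate k c) @ d @ g) (concat (replicate l c) @ d @ h)"
proof -
  have *: "parallel (concat (replicate k c) @ d @ g) (concat (replicate l c) @ d @ h)" if "k < l" for k l g h
  proof -
    have "replicate l c = replicate k c @ c # replicate (l - Suc k) c"
      using that by (metis Suc_diff_Suc le_add_diff_inverse less_imp_le_nat replicate_Suc replicate_add)
    moreover have "parallel (d @ g) (c @ concat (replicate (l - Suc k) c) @ d @ h)"
      using assms(1) by (intro parallel_append) (auto simp: parallel_commute)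
    ultimately show ?thesis by (simp add: parallel_def)
  qed
  show ?thesis
  proof (cases "k < l")
    case False
    then have "l < k" using assms(2) by simp
    from *[OF this] show ?thesis by (rule parallel_commute[THEN iffD1])
  qed (rule *)
qed

text \<open>
  Every vertex of \<open>hereditary_core\<close> is the end of infinitely many pairwise incomparable paths
  \<open>c\<^sup>k d g\<close>.
\<close>

lemma incomparable_paths_into_core:
  obtains s :: "'a \<Rightarrow> 'a" and A :: "'a \<Rightarrow> nat \<Rightarrow> 'b list" where
    "\<forall>w\<in>hereditary_core. \<forall>k. awalk (s w) (A w k) w"
    "\<forall>w\<in>hereditary_core. \<forall>w'\<in>hereditary_core. \<forall>k l. k \<noteq> l \<longrightarrow>
       s w \<noteq> s w' \<or> parallel (A w k) (A w' l)"
proof -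
  define s where "s w = (SOME u. core G u \<and> u \<rightarrow>\<^sup>* w)" for w
  define Q where "Q u z \<longleftrightarrow> awalk u (fst z) u \<and> awalk u (snd z) u \<and> parallel (fst z) (snd z)" for u z
  define cd where "cd u = (SOME z. Q u z)" for u
  define g where "g w = (SOME p. awalk (s w) p w)" for w
  \<comment> \<open>The closed walks \<open>c\<close> and \<open>d\<close> depend on the source
    \<open>s w\<close> alone. So for equal sources different exponents yield incomparable paths,
    even when the ends differ.\<close>
  define A where "A w k = concat (replicate k (fst (cd (s w)))) @ snd (cd (s w)) @ g w" for w k
  have s: "core G (s w)" "s w \<rightarrow>\<^sup>* w" if "w \<in> hereditary_core" for w
    using someI_ex[of "\<lambda>u. core G u \<and> u \<rightarrow>\<^sup>* w"] that unfolding s_def hereditary_core_def by blast+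
  have cd: "awalk u (fst (cd u)) u" "awalk u (snd (cd u)) u" "parallel (fst (cd u)) (snd (cd u))"
    if u: "core G u" for u
  proof -
    obtain c d where "Q u (c, d)" using u unfolding core_def Q_def by auto
    then have "Q u (cd u)" unfolding cd_def by (rule someI)
    then show "awalk u (fst (cd u)) u" "awalk u (snd (cd u)) u" "parallel (fst (cd u)) (snd (cd u))"
      by (simp_all add: Q_def)
  qed
  have g: "awalk (s w) (g w) w" if "w \<in> hereditary_core" for w
  proof -
    have "\<exists>p. awalk (s w) p w" using s(2)[OF that] unfolding reachable_awalk .
    then show ?thesis unfolding g_def by (rule someI_ex)
  qed
  have "awalk (s w) (A w k) w" if "w \<in> hereditary_core" for w k
    unfolding A_def
    using awalk_appendI[OF awalk_concat_replicate[OF cd(1)] awalk_appendI[OF cd(2) g]] s(1) that by blast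
  moreover have "s w \<noteq> s w' \<or> parallel (A w k) (A w' l)"
    if "w \<in> hereditary_core" "w' \<in> hereditary_core" "k \<noteq> l" for w w' k l
    using parallel_powers[OF cd(3)[OF s(1)[OF that(1)]] that(3)] unfolding A_def by metis
  ultimately show ?thesis by (intro that[of s A]) blast+
qed

lemma nonunital_elems [simp]:
  assumes "v \<in> verts G" "set p \<subseteq> arcs G"
  shows "path_elem v p \<in> nonunital_part (generators G)" "ghost_elem v p \<in> nonunital_part (generators G)"
  using assms path_elems_in_free_carrier[of v p]
  by (simp_all add: nonunital_part_def lookup_mult_zero_word) (simp_all add: path_elem_def ghost_elem_def lookup_mult_zero_word)

lemma nonunital_sum: "(\<And>i. i \<in> S \<Longrightarrow> f i \<in> nonunital_part (generators G)) \<Longrightarrow> sum f S \<in> nonunital_part (generators G)"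
  by (induction S rule: infinite_finite_induct) (auto intro: N_closed)

text \<open>The unit is a sum over finitely many paths \<open>t\<close>, each times its ghost. Every
  \<open>t\<close> gets two further paths \<open>B 0 t\<close> and \<open>B 1 t\<close> with the
  same end. In \<open>a i * x j\<close> the ghosts of the \<open>B i t\<close> meet the
  \<open>B j t'\<close>, incomparability leaves only the terms with \<open>i = j\<close> and
  \<open>t = t'\<close>, and these add up to the unit.\<close>

theorem no_maximal_imp_doubling:
  assumes no_max: "\<nexists>u. maximal_in G u"
  shows "doubling (leavitt_path_algebra G :: ('k::field, _) module)"
proof -
  let ?N = "nonunital_part (generators G) :: (('a, 'b) generator free_word \<Rightarrow>\<^sub>0 'k) set"
  define P where "P v S \<longleftrightarrow> finite S \<and> (\<forall>p\<in>S. \<exists>w. awalk v p w \<and> w \<in> hereditary_core) \<and>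
    (\<Sum>p\<in>S. path_elem v p * ghost_elem v p :: _ \<Rightarrow>\<^sub>0 'k) \<approx> vert v" for v S
  have "\<forall>v\<in>verts G. \<exists>S. P v S" unfolding P_def using vertex_expansion[OF no_max] by blast
  then obtain S where S: "\<And>v. v \<in> verts G \<Longrightarrow> P v (S v)" using bchoice[of "verts G" P] by blast
  define T where "T = Sigma (verts G) S"
  have fin: "finite T" unfolding T_def using S by (auto simp: P_def)
  define en where "en = (\<lambda>(v, p). SOME w. awalk v p w \<and> w \<in> hereditary_core)"
  have en: "awalk (fst t) (snd t) (en t)" "en t \<in> hereditary_core" if "t \<in> T" for t
  proof -
    obtain v p where t: "t = (v, p)" by (cases t)
    have "\<exists>w. awalk v p w \<and> w \<in> hereditary_core" using S that unfolding t T_def P_def by blast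
    from someI_ex[OF this] show "awalk (fst t) (snd t) (en t)" "en t \<in> hereditary_core"
      by (simp_all add: en_def t)
  qed
  obtain s and A :: "'a \<Rightarrow> nat \<Rightarrow> 'b list" where
    A: "\<forall>w\<in>hereditary_core. \<forall>k. awalk (s w) (A w k) w"
      "\<forall>w\<in>hereditary_core. \<forall>w'\<in>hereditary_core. \<forall>k l. k \<noteq> l \<longrightarrow>
        s w \<noteq> s w' \<or> parallel (A w k) (A w' l)"
    by (rule incomparable_paths_into_core)
  obtain idx :: "'a \<times> 'b list \<Rightarrow> nat" where idx: "inj_on idx T"
    using finite_imp_inj_to_nat_seg[OF fin] by blast
  \<comment> \<open>For \<open>i < 2\<close> the exponents \<open>2 * idx t + i\<close> differ for
    different pairs \<open>(i, t)\<close>.\<close>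
  define B where "B i t = A (en t) (2 * idx t + i)" for i t
  define pe where "pe t = (path_elem (fst t) (snd t) :: _ \<Rightarrow>\<^sub>0 'k)" for t :: "'a \<times> 'b list"
  define ge where "ge t = (ghost_elem (fst t) (snd t) :: _ \<Rightarrow>\<^sub>0 'k)" for t :: "'a \<times> 'b list"
  define pB where "pB i t = (path_elem (s (en t)) (B i t) :: _ \<Rightarrow>\<^sub>0 'k)" for i :: nat and t :: "'a \<times> 'b list"
  define gB where "gB i t = (ghost_elem (s (en t)) (B i t) :: _ \<Rightarrow>\<^sub>0 'k)" for i :: nat and t :: "'a \<times> 'b list"
  have B: "awalk (s (en t)) (B i t) (en t)" if "t \<in> T" for i t
    unfolding B_def using A(1) en(2)[OF that] by blast
  have N: "pe t \<in> ?N" "ge t \<in> ?N" "pB i t \<in> ?N" "gB i t \<in> ?N" if "t \<in> T" for i t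
    unfolding pe_def ge_def pB_def gB_def
    using awalk_arcs[OF B[OF that]] awalk_arcs[OF en(1)[OF that]] by simp_all
  have C: "pe t \<in> free_carrier" "ge t \<in> free_carrier" if "t \<in> T" for t
    using N[OF that] by (simp_all add: nonunital_part_def)
  define x where "x i = (\<Sum>t\<in>T. pB i t * ge t)" for i
  define a where "a i = (\<Sum>t\<in>T. pe t * gB i t)" for i
  have xa: "x i \<in> ?N" "a i \<in> ?N" for i
    unfolding x_def a_def by (intro nonunital_sum N_closed N; assumption)+
  have ghost_path: "gB i t * pB j t' \<approx> (if i = j \<and> t = t' then vert (en t) else 0)"
    if t: "t \<in> T" "t' \<in> T" and ij: "i < 2" "j < 2" for i j t t'
  proof (cases "i = j \<and> t = t'")
    case True
    then show ?thesis
      using ghost_elem_path_elem[OF B[OF t(1)], of i] by (simp add: gB_def pB_def)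
  next
    case False
    have "2 * idx t + i \<noteq> 2 * idx t' + j"
    proof
      assume eq: "2 * idx t + i = 2 * idx t' + j"
      then have "i = j" using ij by presburger
      then show False using eq False inj_onD[OF idx _ t] by simp
    qed
    then have "s (en t) \<noteq> s (en t') \<or> parallel (B i t) (B j t')"
      unfolding B_def using A(2) en(2) t by blast
    then show ?thesis
      using ghost_elem_path_elem_zero[OF B[OF t(1)] B[OF t(2)], of i j] False by (auto simp: gB_def pB_def)
  qed
  have ax: "a i * x j \<approx> (if i = j then \<Sum>v\<in>verts G. vert v else 0)" if ij: "i < 2" "j < 2" for i j
  proof -
    have "a i * x j = (\<Sum>t\<in>T. \<Sum>t'\<in>T. pe t * (gB i t * pB j t') * ge t')"
      by (simp add: a_def x_def sum_product mult.assoc)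
    also have "\<dots> \<approx> (\<Sum>t\<in>T. \<Sum>t'\<in>T. pe t * (if i = j \<and> t = t' then vert (en t) else 0) * ge t')"
      using C by (intro leavitt_eq_sum leavitt_eq_mult_left leavitt_eq_mult_right ghost_path ij)
    also have "\<dots> = (\<Sum>t\<in>T. \<Sum>t'\<in>T. if t = t' then (if i = j then pe t * vert (en t) * ge t else 0) else 0)"
      by (intro sum.cong refl) auto
    also have "\<dots> = (\<Sum>t\<in>T. if i = j then pe t * vert (en t) * ge t else 0)"
      using fin by (simp add: sum.delta)
    also have "\<dots> \<approx> (if i = j then \<Sum>v\<in>verts G. vert v else 0)"
    proof (cases "i = j")
      case True
      have "(\<Sum>t\<in>T. pe t * vert (en t) * ge t) \<approx> (\<Sum>t\<in>T. pe t * ge t)"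
        unfolding pe_def using C(2) en(1) by (intro leavitt_eq_sum leavitt_eq_mult_right path_elem_vert)
      also have "\<dots> = (\<Sum>v\<in>verts G. \<Sum>p\<in>S v. path_elem v p * ghost_elem v p)"
        unfolding T_def pe_def ge_def using S
        by (subst sum.Sigma) (auto simp: P_def case_prod_beta)
      also have "\<dots> \<approx> (\<Sum>v\<in>verts G. vert v)"
        using S by (intro leavitt_eq_sum) (auto simp: P_def)
      finally show ?thesis using True by simp
    qed (auto intro: leavitt_eq_refl free_algebra_zero)
    finally show ?thesis .
  qed
  let ?L = "leavitt_path_algebra G :: ('k, _) module"
  note L = leavitt_ops[where ?'k = 'k]
  have eq: "leavitt_class (a i) \<otimes>\<^bsub>?L\<^esub> leavitt_class (x j) = (if i = j then \<one>\<^bsub>?L\<^esub> else \<zero>\<^bsub>?L\<^esub>)" if "i < 2" "j < 2" for i j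
  proof -
    have "leavitt_class (a i) \<otimes>\<^bsub>?L\<^esub> leavitt_class (x j) = leavitt_class (a i * x j)" by (rule L(4)) (rule xa)+
    also have "\<dots> = leavitt_class (if i = j then \<Sum>v\<in>verts G. vert v else 0)"
      using ax[OF that] xa U_in(1) by (subst L(7)) (auto intro: N_closed)
    finally show ?thesis by (simp add: L(2,3))
  qed
  have "leavitt_class (a i) \<in> carrier ?L" "leavitt_class (x i) \<in> carrier ?L" for i using xa by (auto simp: L(1))
  moreover have "leavitt_class (a 0) \<otimes>\<^bsub>?L\<^esub> leavitt_class (x 0) = \<one>\<^bsub>?L\<^esub>"
    "leavitt_class (a 1) \<otimes>\<^bsub>?L\<^esub> leavitt_class (x 1) = \<one>\<^bsub>?L\<^esub>"
    "leavitt_class (a 0) \<otimes>\<^bsub>?L\<^esub> leavitt_class (x 1) = \<zero>\<^bsub>?L\<^esub>"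
    "leavitt_class (a 1) \<otimes>\<^bsub>?L\<^esub> leavitt_class (x 0) = \<zero>\<^bsub>?L\<^esub>"
    by (simp_all add: eq)
  ultimately show ?thesis unfolding doubling_def by blast
qed

end

section \<open>Almost invariant subspaces\<close>

context field_algebra
begin

text \<open>Counting extra vectors makes the bound additive under sums and products of elements. It
  is meant for a fixed \<open>d\<close> while \<open>X\<close> grows.\<close>

definition almost_invariant :: "'a set \<Rightarrow> nat \<Rightarrow> 'a \<Rightarrow> bool" where
  "almost_invariant X d a \<longleftrightarrow> (\<exists>Y. finite Y \<and> Y \<subseteq> carrier A \<and> card Y \<le> d \<and> (\<forall>x\<in>X. a \<otimes> x \<in> span (X \<union> Y)))"

lemma span_mono_closed:
  assumes "S \<subseteq> span T" "T \<subseteq> carrier A" shows "span S \<subseteq> span T"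
  using span_subset[OF span_is_subspace[OF assms(2)] assms(1)] .

lemma almost_invariant_add:
  assumes "almost_invariant X d a" "almost_invariant X d' b"
    and c: "X \<subseteq> carrier A" "a \<in> carrier A" "b \<in> carrier A"
  shows "almost_invariant X (d + d') (a \<oplus> b)"
proof -
  obtain Y Z where Y: "finite Y" "Y \<subseteq> carrier A" "card Y \<le> d" "\<forall>x\<in>X. a \<otimes> x \<in> span (X \<union> Y)"
    and Z: "finite Z" "Z \<subseteq> carrier A" "card Z \<le> d'" "\<forall>x\<in>X. b \<otimes> x \<in> span (X \<union> Z)"
    using assms(1,2) unfolding almost_invariant_def by blast
  have YZ: "X \<union> (Y \<union> Z) \<subseteq> carrier A" using c Y Z by blast
  note sub = subspaceD(3)[OF span_is_subspace[OF YZ]]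
  have "(a \<oplus> b) \<otimes> x \<in> span (X \<union> (Y \<union> Z))" if "x \<in> X" for x
  proof -
    have "a \<otimes> x \<in> span (X \<union> (Y \<union> Z))"
      using Y(4) that span_is_monotone[of "X \<union> Y" "X \<union> (Y \<union> Z)"] by blast
    moreover have "b \<otimes> x \<in> span (X \<union> (Y \<union> Z))"
      using Z(4) that span_is_monotone[of "X \<union> Z" "X \<union> (Y \<union> Z)"] by blast
    ultimately show ?thesis using sub c that by (simp add: A.l_distr subset_iff)
  qed
  moreover have "card (Y \<union> Z) \<le> d + d'" using card_Un_le[of Y Z] Y(3) Z(3) by linarith
  ultimately show ?thesis
    unfolding almost_invariant_def using Y Z by (intro exI[of _ "Y \<union> Z"]) blast
qed

lemma almost_invariant_smult:
  assumes "almost_invariant X d a" "X \<subseteq> carrier A" "a \<in> carrier A"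
  shows "almost_invariant X d (k \<odot> a)"
proof -
  obtain Y where Y: "finite Y" "Y \<subseteq> carrier A" "card Y \<le> d" "\<forall>x\<in>X. a \<otimes> x \<in> span (X \<union> Y)"
    using assms(1) unfolding almost_invariant_def by blast
  have "X \<union> Y \<subseteq> carrier A" using assms Y by blast
  note sub = subspaceD(4)[OF span_is_subspace[OF this]]
  have "(k \<odot> a) \<otimes> x \<in> span (X \<union> Y)" if "x \<in> X" for x
    using Y(4) that sub assms by (simp add: smult_mult subset_iff)
  then show ?thesis unfolding almost_invariant_def using Y by blast
qed

text \<open>As \<open>b X\<close> lies in the span of \<open>X\<close> and \<open>Z\<close>,
  \<open>a b X\<close> lies in the span of \<open>a X\<close> and \<open>a Z\<close>; the vectors
  \<open>a Z\<close> join the extra vectors \<open>Y\<close> of \<open>a\<close>.\<close>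

lemma almost_invariant_mult:
  assumes "almost_invariant X d a" "almost_invariant X d' b"
    and c: "X \<subseteq> carrier A" "a \<in> carrier A" "b \<in> carrier A"
  shows "almost_invariant X (d + d') (a \<otimes> b)"
proof -
  obtain Y Z where Y: "finite Y" "Y \<subseteq> carrier A" "card Y \<le> d" "\<forall>x\<in>X. a \<otimes> x \<in> span (X \<union> Y)"
    and Z: "finite Z" "Z \<subseteq> carrier A" "card Z \<le> d'" "\<forall>x\<in>X. b \<otimes> x \<in> span (X \<union> Z)"
    using assms(1,2) unfolding almost_invariant_def by blast
  let ?Y = "Y \<union> (\<otimes>) a ` Z"
  have im: "(\<otimes>) a ` Z \<subseteq> carrier A" using c Z(2) by auto
  have XY: "X \<union> ?Y \<subseteq> carrier A" using c Y im by blast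
  have XZ: "X \<union> Z \<subseteq> carrier A" using c Z by blast
  have "span (X \<union> Y) \<subseteq> span (X \<union> ?Y)" by (intro span_is_monotone) blast
  then have "(\<otimes>) a ` (X \<union> Z) \<subseteq> span (X \<union> ?Y)"
    using Y(4) in_own_span[OF XY] by blast
  then have "span ((\<otimes>) a ` (X \<union> Z)) \<subseteq> span (X \<union> ?Y)" by (rule span_mono_closed) (rule XY)
  then have "a \<otimes> (b \<otimes> x) \<in> span (X \<union> ?Y)" if "x \<in> X" for x
    using left_mult_span[OF c(2) XZ] Z(4) that by blast
  then have "(a \<otimes> b) \<otimes> x \<in> span (X \<union> ?Y)" if "x \<in> X" for x
    using c that by (simp add: A.m_assoc subset_iff)
  moreover have "card ?Y \<le> d + d'"
    using card_Un_le[of Y "(\<otimes>) a ` Z"] card_image_le[OF Z(1), of "(\<otimes>) a"] Y(3) Z(3) by linarith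
  ultimately show ?thesis
    unfolding almost_invariant_def using Y Z im by (intro exI[of _ ?Y]) blast
qed

text \<open>The extra vectors are added to a basis of the span of \<open>X\<close>, so the growth is
  measured against the dimension and not against the size of \<open>X\<close>.\<close>

lemma almost_invariant_dim:
  assumes "almost_invariant X d a" "finite X" "X \<subseteq> carrier A" "a \<in> carrier A"
  shows "dim_on A ((a <#\<^bsub>A\<^esub> span X) <+>\<^bsub>A\<^esub> span X) \<le> dim_on A (span X) + d"
proof -
  obtain Y where Y: "finite Y" "Y \<subseteq> carrier A" "card Y \<le> d" "\<forall>x\<in>X. a \<otimes> x \<in> span (X \<union> Y)"
    using assms(1) unfolding almost_invariant_def by blast
  note fX = dim_on_span[OF assms(2,3)]
  obtain B where B: "finite B" "B \<subseteq> carrier A" "span B = span X" "card B = dim_on A (span X)"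
    using subspace_basis[OF span_is_subspace[OF assms(3)] fX(1)] by metis
  have BY: "B \<union> Y \<subseteq> carrier A" "finite (B \<union> Y)" using B Y by auto
  have Z: "X \<union> (\<otimes>) a ` X \<subseteq> carrier A" "finite (X \<union> (\<otimes>) a ` X)" using assms by auto
  have XY: "X \<union> Y \<subseteq> span (B \<union> Y)"
    using in_own_span[OF assms(3)] B(3) span_is_monotone[of B "B \<union> Y"] in_own_span[OF BY(1)] by blast
  then have "span (X \<union> Y) \<subseteq> span (B \<union> Y)" by (rule span_mono_closed) (rule BY)
  then have "X \<union> (\<otimes>) a ` X \<subseteq> span (B \<union> Y)" using XY Y(4) by blast
  then have "span (X \<union> (\<otimes>) a ` X) \<subseteq> span (B \<union> Y)" by (rule span_mono_closed) (rule BY)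
  then have "dim_on A (span (X \<union> (\<otimes>) a ` X)) \<le> dim_on A (span (B \<union> Y))"
    using dim_on_span[OF Z(2,1)] dim_on_span[OF BY(2,1)] Z BY
    by (intro dim_on_mono span_is_subspace)
  also have "\<dots> \<le> card (B \<union> Y)" using dim_on_span[OF BY(2,1)] by blast
  also have "\<dots> \<le> dim_on A (span X) + d" using card_Un_le[of B Y] B(4) Y(3) by linarith
  finally show ?thesis by (simp only: translate_sum_eq_span[OF assms(4,3)])
qed

end

section \<open>Branching systems\<close>

text \<open>
  An algebraic branching system: the arc \<open>e\<close> identifies \<open>D (head G e)\<close> with a part of
  \<open>D (tail G e)\<close>, and these parts for the arcs leaving a vertex partition \<open>D v\<close>.
\<close>

locale branching_system = fin_digraph G for G :: "('a, 'b) pre_digraph" +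
  fixes D :: "'a \<Rightarrow> 'x set" and F :: "'b \<Rightarrow> 'x \<Rightarrow> 'x"
  assumes D_disjoint: "\<lbrakk>x \<in> D u; x \<in> D w\<rbrakk> \<Longrightarrow> u = w"
    and F_inj: "e \<in> arcs G \<Longrightarrow> inj_on (F e) (D (head G e))"
    and F_into: "\<lbrakk>e \<in> arcs G; x \<in> D (head G e)\<rbrakk> \<Longrightarrow> F e x \<in> D (tail G e)"
    and F_disjoint: "\<lbrakk>e \<in> arcs G; f \<in> arcs G; x \<in> D (head G e); y \<in> D (head G f); F e x = F f y\<rbrakk> \<Longrightarrow> e = f"
    and F_cover: "\<lbrakk>u \<in> verts G; out_arcs G u \<noteq> {}; y \<in> D u\<rbrakk> \<Longrightarrow>
      \<exists>e\<in>out_arcs G u. \<exists>x\<in>D (head G e). y = F e x"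
begin

text \<open>Transport of functions along \<open>F\<close>, extended by zero. Ghosts undo arcs, which
  is CK1; an arc after its ghost restricts a function to the image of \<open>F e\<close>, so the
  partition of \<open>D v\<close> gives CK2.\<close>

fun gen_op :: "('a, 'b) generator \<Rightarrow> ('x \<Rightarrow> 'k::field) \<Rightarrow> 'x \<Rightarrow> 'k" where
  "gen_op (Vert u) \<phi> = (\<lambda>x. if x \<in> D u then \<phi> x else 0)"
| "gen_op (Arc e) \<phi> = (\<lambda>y. if y \<in> F e ` D (head G e) then \<phi> (inv_into (D (head G e)) (F e) y) else 0)"
| "gen_op (Ghost e) \<phi> = (\<lambda>x. if x \<in> D (head G e) then \<phi> (F e x) else 0)"

text \<open>With \<open>foldr\<close> the last letter acts first, so that products of words become
  compositions.\<close>

definition word_op :: "('a, 'b) generator free_word \<Rightarrow> ('x \<Rightarrow> 'k::field) \<Rightarrow> 'x \<Rightarrow> 'k" where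
  "word_op w = foldr gen_op (letters w)"

definition action :: "(('a, 'b) generator free_word \<Rightarrow>\<^sub>0 'k::field) \<Rightarrow> ('x \<Rightarrow> 'k) \<Rightarrow> 'x \<Rightarrow> 'k" where
  "action f \<phi> = (\<lambda>x. \<Sum>w\<in>Poly_Mapping.keys f. Poly_Mapping.lookup f w * word_op w \<phi> x)"

lemma gen_op_linear:
  "gen_op g (\<lambda>x. \<phi> x + \<psi> x) = (\<lambda>x. gen_op g \<phi> x + gen_op g \<psi> x)"
  "gen_op g (\<lambda>x. a * \<phi> x) = (\<lambda>x. a * gen_op g \<phi> x)"
  "gen_op g (\<lambda>x. 0) = (\<lambda>x. 0)"
  by (cases g; auto simp: fun_eq_iff)+

lemma word_op_linear:
  "word_op w (\<lambda>x. \<phi> x + \<psi> x) = (\<lambda>x. word_op w \<phi> x + word_op w \<psi> x)"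
  "word_op w (\<lambda>x. a * \<phi> x) = (\<lambda>x. a * word_op w \<phi> x)"
proof -
  have "foldr gen_op xs (\<lambda>x. \<phi> x + \<psi> x) = (\<lambda>x. foldr gen_op xs \<phi> x + foldr gen_op xs \<psi> x)"
    "foldr gen_op xs (\<lambda>x. a * \<phi> x) = (\<lambda>x. a * foldr gen_op xs \<phi> x)" for xs
    by (induction xs) (simp_all add: gen_op_linear)
  then show "word_op w (\<lambda>x. \<phi> x + \<psi> x) = (\<lambda>x. word_op w \<phi> x + word_op w \<psi> x)"
    "word_op w (\<lambda>x. a * \<phi> x) = (\<lambda>x. a * word_op w \<phi> x)"
    by (simp_all add: word_op_def)
qed

lemma word_op_zero: "word_op w (\<lambda>x. 0) = (\<lambda>x. 0)"
  using word_op_linear(2)[of w 0 "\<lambda>x. 0"] by simp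

lemma action_superset:
  assumes "finite S" "Poly_Mapping.keys f \<subseteq> S"
  shows "action f \<phi> = (\<lambda>x. \<Sum>w\<in>S. Poly_Mapping.lookup f w * word_op w \<phi> x)"
  unfolding action_def using assms
  by (intro ext sum.mono_neutral_left) (auto simp: in_keys_iff)

lemma action_add: "action (f + g) \<phi> = (\<lambda>x. action f \<phi> x + action g \<phi> x)"
proof -
  let ?S = "Poly_Mapping.keys f \<union> Poly_Mapping.keys g"
  have "action (f + g) \<phi> = (\<lambda>x. \<Sum>w\<in>?S. Poly_Mapping.lookup (f + g) w * word_op w \<phi> x)"
    using Poly_Mapping.keys_add[of f g] by (intro action_superset) auto
  moreover have "action f \<phi> = (\<lambda>x. \<Sum>w\<in>?S. Poly_Mapping.lookup f w * word_op w \<phi> x)"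
    "action g \<phi> = (\<lambda>x. \<Sum>w\<in>?S. Poly_Mapping.lookup g w * word_op w \<phi> x)"
    by (intro action_superset; auto)+
  ultimately show ?thesis by (simp add: lookup_add algebra_simps sum.distrib)
qed

lemma action_single: "action (Poly_Mapping.single w a) \<phi> = (\<lambda>x. a * word_op w \<phi> x)"
  by (cases "a = 0") (simp_all add: action_def)

lemma action_zero: "action 0 \<phi> = (\<lambda>x. 0)"
  by (simp add: action_def)

lemma action_linear:
  "action f (\<lambda>x. \<phi> x + \<psi> x) = (\<lambda>x. action f \<phi> x + action f \<psi> x)"
  "action f (\<lambda>x. a * \<phi> x) = (\<lambda>x. a * action f \<phi> x)"
  by (simp_all add: action_def word_op_linear algebra_simps sum.distrib sum_distrib_left)

lemma action_zero_arg: "action f (\<lambda>x. 0) = (\<lambda>x. 0)"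
  by (simp add: action_def word_op_zero)

lemma action_mult: "action (f * g) \<phi> = action f (action g \<phi>)"
proof (induction f rule: free_word_mapping_induct)
  case (single u a)
  show ?case
  proof (induction g rule: free_word_mapping_induct)
    case (single w b)
    show ?case
      by (simp add: mult_single action_single word_op_linear fun_eq_iff mult.assoc)
        (simp add: word_op_def)
  qed (simp_all add: action_zero action_zero_arg action_add action_linear distrib_left)
qed (simp_all add: action_zero action_add distrib_right)

lemma action_letter: "action (letter g) \<phi> = gen_op g \<phi>"
  by (simp add: letter_def action_single word_op_def)

lemma action_diff: "action (f - g) \<phi> = (\<lambda>x. action f \<phi> x - action g \<phi> x)"
proof -
  have "action f \<phi> = action (f - g + g) \<phi>" by simp
  then show ?thesis unfolding action_add by (simp add: fun_eq_iff)
qed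

lemma action_sum: "action (sum f S) \<phi> = (\<lambda>x. \<Sum>i\<in>S. action (f i) \<phi> x)"
  by (induction S rule: infinite_finite_induct) (simp_all add: action_zero action_add)

lemma action_scalar: "action (Poly_Mapping.single 0 a * f) \<phi> = (\<lambda>x. a * action f \<phi> x)"
  by (simp add: action_mult action_single word_op_def)

lemma inv_F:
  assumes "e \<in> arcs G" "x \<in> D (head G e)"
  shows "inv_into (D (head G e)) (F e) (F e x) = x"
  using inv_into_f_f[OF F_inj[OF assms(1)] assms(2)] .

lemma gen_op_CK2:
  assumes "v \<in> verts G" "out_arcs G v \<noteq> {}"
  shows "(\<Sum>e\<in>out_arcs G v. gen_op (Arc e) (gen_op (Ghost e) \<phi>) y) = gen_op (Vert v) \<phi> y"
proof -
  have ghost: "gen_op (Arc e) (gen_op (Ghost e) \<phi>) y = (if y \<in> F e ` D (head G e) then \<phi> y else 0)"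
    if "e \<in> arcs G" for e
    using inv_F[OF that] by auto
  show ?thesis
  proof (cases "y \<in> D v")
    case True
    then obtain e x where e: "e \<in> out_arcs G v" "x \<in> D (head G e)" "y = F e x"
      using F_cover[OF assms True] by blast
    have "(\<Sum>e\<in>out_arcs G v. gen_op (Arc e) (gen_op (Ghost e) \<phi>) y) =
      (\<Sum>e'\<in>out_arcs G v. if e' = e then \<phi> y else 0)"
    proof (rule sum.cong[OF refl])
      fix e' assume "e' \<in> out_arcs G v"
      then have "y \<in> F e' ` D (head G e') \<longleftrightarrow> e' = e"
        using F_disjoint[of e' e _ x] e by auto
      then show "gen_op (Arc e') (gen_op (Ghost e') \<phi>) y = (if e' = e then \<phi> y else 0)"
        using ghost[of e'] \<open>e' \<in> out_arcs G v\<close> by (simp del: gen_op.simps)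
    qed
    also have "\<dots> = \<phi> y" by (subst sum.delta) (use e(1) in auto)
    finally show ?thesis using True by (simp del: gen_op.simps(2,3))
  next
    case False
    have "gen_op (Arc e) (gen_op (Ghost e) \<phi>) y = 0" if "e \<in> out_arcs G v" for e
    proof -
      have "y \<notin> F e ` D (head G e)" using F_into[of e] that False by auto
      then show ?thesis using ghost[of e] that by (simp del: gen_op.simps)
    qed
    then show ?thesis using False by (simp del: gen_op.simps(2,3))
  qed
qed

lemma action_relation:
  assumes "r \<in> leavitt_relations G"
  shows "action r \<phi> = (\<lambda>x. 0)"
  using assms
proof (induction rule: leavitt_relations.induct)
  case (V v w)
  then show ?case using D_disjoint
    by (auto simp: action_diff action_mult action_letter action_zero fun_eq_iff)
next
  case (E_source x)
  then show ?case using F_into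
    by (auto simp: action_diff action_mult action_letter fun_eq_iff)
next
  case (E_target x)
  then show ?case using F_into inv_F
    by (auto simp: action_diff action_mult action_letter fun_eq_iff)
next
  case (CK1 e f)
  then show ?case using F_disjoint[of e f] inv_F[of e]
    by (auto simp: action_diff action_mult action_letter action_zero fun_eq_iff)
next
  case (CK2 v)
  then show ?case using gen_op_CK2[of v \<phi>]
    by (simp add: action_diff action_mult action_letter action_sum fun_eq_iff del: gen_op.simps)
qed

text \<open>The elements acting as zero form an ideal that contains the relations.\<close>

lemma action_ideal:
  assumes "f \<in> leavitt_ideal G"
  shows "action f \<phi> = (\<lambda>x. 0 :: 'k::field)"
proof -
  let ?F = "free_algebra (generators G) :: ('k, ('a, 'b) generator free_word \<Rightarrow>\<^sub>0 'k) module"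
  let ?K = "{f \<in> carrier ?F. \<forall>\<phi>. action f \<phi> = (\<lambda>x. 0)}"
  interpret R: field_algebra ?F by (rule field_algebra_free_algebra)
  have minus: "\<ominus>\<^bsub>?F\<^esub> f = - f" if "f \<in> carrier ?F" for f
    using that free_algebra_uminus[OF that] by (intro R.minus_equality) (simp_all add: F_ops)
  have neg: "action (- f) \<phi> = (\<lambda>x. - action f \<phi> x)" for f :: "_ \<Rightarrow>\<^sub>0 'k" and \<phi>
    using action_diff[of 0 f \<phi>] by (simp add: action_zero)
  have "ideal ?K ?F"
  proof (rule idealI[OF R.A.ring_axioms R.A.add.subgroupI])
    show "\<ominus>\<^bsub>?F\<^esub> f \<in> ?K" if "f \<in> ?K" for f
      using that minus[of f] by (simp add: free_algebra_uminus neg)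
    have "0 \<in> ?K" using free_algebra_zero by (simp add: action_zero)
    then show "?K \<noteq> {}" by blast
  qed (auto simp: F_ops action_mult action_zero_arg free_algebra_mult action_add free_algebra_add)
  moreover have "leavitt_relations G \<subseteq> ?K"
    using leavitt_relations_nonunital action_relation by (auto simp: nonunital_part_def)
  ultimately have "leavitt_ideal G \<subseteq> ?K"
    unfolding leavitt_ideal_def by (rule R.A.genideal_minimal)
  then show ?thesis using assms by blast
qed

lemma action_cong: "f \<approx> g \<Longrightarrow> action f \<phi> = action g \<phi>"
  using action_ideal[of "f - g" \<phi>] action_diff[of f g \<phi>] by (simp add: leavitt_eq_def fun_eq_iff)

lemma action_sum_arg:
  "action f (\<lambda>x. \<Sum>i\<in>I. c i * \<phi> i x) = (\<lambda>x. \<Sum>i\<in>I. c i * action f (\<phi> i) x)"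
  by (induction I rule: infinite_finite_induct) (simp_all add: action_zero_arg action_linear)

end

section \<open>Products of generators with paths\<close>

context fin_digraph
begin

abbreviation nonunital :: "(('a, 'b) generator free_word \<Rightarrow>\<^sub>0 'k::field) set" where
  "nonunital \<equiv> nonunital_part (generators G)"

abbreviation LPA :: "('k::field, (('a, 'b) generator free_word \<Rightarrow>\<^sub>0 'k) set) module" where
  "LPA \<equiv> leavitt_path_algebra G"

lemma nonunital_free: "f \<in> nonunital \<Longrightarrow> f \<in> free_carrier"
  by (simp add: nonunital_part_def)

lemma leavitt_class_nonunital: "f \<in> nonunital \<Longrightarrow> leavitt_class f \<in> carrier LPA"
  by (simp add: leavitt_ops(1))

lemma leavitt_class_sum:
  fixes f :: "'i \<Rightarrow> ('a, 'b) generator free_word \<Rightarrow>\<^sub>0 'k::field"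
  assumes "finite I" "\<And>i. i \<in> I \<Longrightarrow> f i \<in> nonunital"
  shows "(\<Oplus>\<^bsub>LPA\<^esub>i\<in>I. a i \<odot>\<^bsub>LPA\<^esub> leavitt_class (f i)) = leavitt_class (\<Sum>i\<in>I. Poly_Mapping.single 0 (a i) * f i)"
  using assms
proof (induction I rule: finite_induct)
  case empty
  interpret L: field_algebra "LPA :: ('k, _) module" by (rule leavitt_field_algebra)
  show ?case by (simp add: leavitt_ops(3))
next
  case (insert i I)
  interpret L: field_algebra "LPA :: ('k, _) module" by (rule leavitt_field_algebra)
  have N: "Poly_Mapping.single 0 (a j) * f j \<in> nonunital" if "j \<in> insert i I" for j
    using insert.prems[OF that] by (rule N_closed)
  then have "(\<Sum>j\<in>I. Poly_Mapping.single 0 (a j) * f j) \<in> nonunital" by (intro nonunital_sum) blast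
  moreover have "leavitt_class (f j) \<in> carrier LPA" if "j \<in> insert i I" for j
    using insert.prems[OF that] by (rule leavitt_class_nonunital)
  ultimately show ?case
    using insert N[of i] leavitt_class_nonunital[OF N[of i]]
    by (subst L.A.finsum_insert) (auto simp: leavitt_ops(5,6))
qed

lemma vert_path_elem:
  assumes "u \<in> verts G" "w \<in> verts G" "set p \<subseteq> arcs G"
  shows "vert u * path_elem w p \<approx> (if u = w then path_elem w p else 0)"
proof -
  have "vert u * path_elem w p = (vert u * vert w) * arcs_word p" by (simp add: path_elem_def mult.assoc)
  also have "\<dots> \<approx> (if u = w then vert u else 0) * arcs_word p"
    using assms by (intro leavitt_eq_mult_right vert_vert) auto
  also have "\<dots> = (if u = w then path_elem w p else 0)" by (simp add: path_elem_def)
  finally show ?thesis .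
qed

lemma arc_path_elem_zero:
  assumes "e \<in> arcs G" "w \<in> verts G" "set p \<subseteq> arcs G" "head G e \<noteq> w"
  shows "arc_letter e * path_elem w p \<approx> 0"
proof -
  have "arc_letter e * path_elem w p \<approx> (arc_letter e * vert (head G e)) * path_elem w p"
    using assms by (intro leavitt_eq_mult_right leavitt_eq_sym[OF arc_vert]) auto
  also have "\<dots> = arc_letter e * (vert (head G e) * path_elem w p)" by (simp add: mult.assoc)
  also have "\<dots> \<approx> arc_letter e * (if head G e = w then path_elem w p else 0)"
    using assms by (intro leavitt_eq_mult_left vert_path_elem) auto
  also have "\<dots> = 0" using assms by simp
  finally show ?thesis .
qed

lemma ghost_path_elem_zero:
  assumes "e \<in> arcs G" "w \<in> verts G" "set p \<subseteq> arcs G" "tail G e \<noteq> w"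
  shows "ghost_letter e * path_elem w p \<approx> 0"
proof -
  have "ghost_letter e * path_elem w p \<approx> (ghost_letter e * vert (tail G e)) * path_elem w p"
    using assms by (intro leavitt_eq_mult_right leavitt_eq_sym[OF ghost_vert]) auto
  also have "\<dots> = ghost_letter e * (vert (tail G e) * path_elem w p)" by (simp add: mult.assoc)
  also have "\<dots> \<approx> ghost_letter e * (if tail G e = w then path_elem w p else 0)"
    using assms by (intro leavitt_eq_mult_left vert_path_elem) auto
  also have "\<dots> = 0" using assms by simp
  finally show ?thesis .
qed

lemma ghost_path_elem_Cons:
  assumes "e \<in> arcs G" "f \<in> arcs G" "set p \<subseteq> arcs G"
  shows "ghost_letter e * path_elem (tail G f) (f # p) \<approx> (if e = f then path_elem (head G f) p else 0)"
proof -
  have "ghost_letter e * path_elem (tail G f) (f # p) \<approx> ghost_letter e * (arc_letter f * path_elem (head G f) p)"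
    using assms by (intro leavitt_eq_mult_left path_elem_Cons) auto
  also have "\<dots> = (ghost_letter e * arc_letter f) * path_elem (head G f) p" by (simp add: mult.assoc)
  also have "\<dots> \<approx> (if e = f then vert (head G e) else 0) * path_elem (head G f) p"
    using assms by (intro leavitt_eq_mult_right ghost_arc) auto
  also have "\<dots> \<approx> (if e = f then path_elem (head G f) p else 0)"
    using assms vert_path_elem[of "head G f" "head G f" p] by (auto intro: leavitt_eq_refl free_algebra_zero)
  finally show ?thesis .
qed

end

text \<open>A uniform substitute for a maximal sink or cycle: a sink has no first return, any other
  good vertex has exactly one.\<close>

locale good_vertex = fin_digraph G for G :: "('a, 'b) pre_digraph" +
  fixes v :: 'a
  assumes v_vert: "v \<in> verts G"
    and finite_arrivals: "finite (first_arrivals G v)"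
    and unique_return: "first_return G v c \<Longrightarrow> first_return G v d \<Longrightarrow> c = d"
    and return_exists: "out_arcs G v \<noteq> {} \<Longrightarrow> \<exists>c. first_return G v c"
begin

definition start :: "'b list \<Rightarrow> 'a" where
  "start p = (if p = [] then v else tail G (hd p))"

abbreviation arrivals :: "'b list set" where "arrivals \<equiv> first_arrivals G v"

lemma start_simps [simp]: "start [] = v" "start (e # p) = tail G e"
  by (simp_all add: start_def)

lemma Nil_arrival [simp]: "[] \<in> arrivals"
  using v_vert by (auto simp: first_arrivals_def awalk_Nil_iff)

lemma arrival_walk: "p \<in> arrivals \<Longrightarrow> awalk (start p) p v"
  by (cases p) (auto simp: first_arrivals_def awalk_simps)

lemma start_vert [simp]: "p \<in> arrivals \<Longrightarrow> start p \<in> verts G"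
  and arrival_arcs [simp]: "p \<in> arrivals \<Longrightarrow> set p \<subseteq> arcs G"
  using arrival_walk awalk_arcs by blast+

lemma start_eq_v: "p \<in> arrivals \<Longrightarrow> start p = v \<longleftrightarrow> p = []"
  by (cases p) (auto simp: first_arrivals_def)

lemma arrival_Cons_iff:
  "e # p \<in> arrivals \<longleftrightarrow> e \<in> arcs G \<and> p \<in> arrivals \<and> start p = head G e \<and> tail G e \<noteq> v"
proof
  assume "e # p \<in> arrivals"
  then have w: "e \<in> arcs G" "awalk (head G e) p v" "tail G e \<noteq> v" "v \<notin> tail G ` set p"
    by (auto simp: first_arrivals_def awalk_Cons_iff)
  then have "p \<in> arrivals" unfolding first_arrivals_def by blast
  moreover have "start p = head G e" using w(2) by (cases p) (auto simp: awalk_simps)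
  ultimately show "e \<in> arcs G \<and> p \<in> arrivals \<and> start p = head G e \<and> tail G e \<noteq> v" using w by blast
next
  assume r: "e \<in> arcs G \<and> p \<in> arrivals \<and> start p = head G e \<and> tail G e \<noteq> v"
  then have "awalk (tail G e) (e # p) v" using arrival_walk[of p] by (simp add: awalk_Cons_iff)
  moreover have "v \<notin> tail G ` set (e # p)" using r by (auto simp: first_arrivals_def)
  ultimately show "e # p \<in> arrivals" unfolding first_arrivals_def by blast
qed

lemma return_Cons_iff:
  "first_return G v (e # p) \<longleftrightarrow> e \<in> arcs G \<and> p \<in> arrivals \<and> start p = head G e \<and> tail G e = v"
proof
  assume r: "first_return G v (e # p)"
  then have w: "e \<in> arcs G" "v = tail G e" "awalk (head G e) p v" "p \<in> arrivals"
    unfolding first_return_def awalk_Cons_iff list.sel by blast+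
  moreover have "start p = head G e" using w(3) by (cases p) (auto simp: awalk_simps)
  ultimately show "e \<in> arcs G \<and> p \<in> arrivals \<and> start p = head G e \<and> tail G e = v" by simp
next
  assume r: "e \<in> arcs G \<and> p \<in> arrivals \<and> start p = head G e \<and> tail G e = v"
  then show "first_return G v (e # p)" using arrival_walk[of p] by (simp add: first_return_def awalk_Cons_iff)
qed

text \<open>The point \<open>(p, k)\<close> stands for the path \<open>p c^k\<close> into
  \<open>v\<close>, where \<open>c\<close> is the first return, if there is one.\<close>

definition D :: "nat \<Rightarrow> 'a \<Rightarrow> ('b list \<times> nat) set" where
  "D m u = {(p, k). p \<in> arrivals \<and> k < m \<and> start p = u}"

text \<open>If \<open>e\<close> leaves \<open>v\<close>, then on \<open>D m (head G e)\<close> the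
  list \<open>e # p\<close> is the first return and is recorded as one more turn. The turn after
  \<open>m - 1\<close> leads back to 0, so that no point falls out of the system and none is missed
  by the images.\<close>

definition F :: "nat \<Rightarrow> 'b \<Rightarrow> 'b list \<times> nat \<Rightarrow> 'b list \<times> nat" where
  "F m e = (\<lambda>(p, k). if tail G e = v then ([], Suc k mod m) else (e # p, k))"

text \<open>At \<open>v\<close>, uniqueness of the first return gives injectivity and disjointness,
  and its existence gives the covering. Elsewhere a point has a nonempty arrival, which determines
  its first arc.\<close>

lemma branching:
  assumes "m > 0"
  shows "branching_system G (D m) (F m)"
proof (intro branching_system.intro branching_system_axioms.intro)
  show "fin_digraph G" by (rule fin_digraph_axioms)
next
  fix x u w assume "x \<in> D m u" "x \<in> D m w"
  then show "u = w" by (auto simp: D_def)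
next
  fix e assume e: "e \<in> arcs G"
  show "inj_on (F m e) (D m (head G e))"
  proof (rule inj_onI)
    fix x y assume xy: "x \<in> D m (head G e)" "y \<in> D m (head G e)" "F m e x = F m e y"
    obtain p k q l where pq: "x = (p, k)" "y = (q, l)" by (cases x; cases y)
    have x: "p \<in> arrivals" "k < m" "start p = head G e" and y: "q \<in> arrivals" "l < m" "start q = head G e"
      using xy(1,2) by (auto simp: D_def pq)
    show "x = y"
    proof (cases "tail G e = v")
      case True
      then have "Suc k mod m = Suc l mod m" using xy(3) by (simp add: F_def pq)
      then have "k = l" using x(2) y(2) by (auto simp: mod_Suc split: if_splits)
      moreover have "p = q" using unique_return[of "e # p" "e # q"] e x y True by (simp add: return_Cons_iff)
      ultimately show ?thesis using pq by simp
    qed (use xy(3) pq in \<open>simp add: F_def\<close>)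
  qed
next
  fix e x assume "e \<in> arcs G" "x \<in> D m (head G e)"
  then show "F m e x \<in> D m (tail G e)"
    using assms by (cases x; cases "tail G e = v") (auto simp: F_def D_def arrival_Cons_iff)
next
  fix e f x y
  assume "e \<in> arcs G" "f \<in> arcs G" "x \<in> D m (head G e)" "y \<in> D m (head G f)" "F m e x = F m f y"
  then show "e = f"
    using unique_return[of "e # fst x" "f # fst y"]
    by (auto simp: F_def D_def return_Cons_iff split: if_splits)
next
  fix u y assume u: "u \<in> verts G" "out_arcs G u \<noteq> {}" and y: "y \<in> D m u"
  obtain p k where pk: "y = (p, k)" "p \<in> arrivals" "k < m" "start p = u" using y by (auto simp: D_def)
  show "\<exists>e\<in>out_arcs G u. \<exists>x\<in>D m (head G e). y = F m e x"
  proof (cases p)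
    case Nil
    then obtain c where c: "first_return G v c" using return_exists u pk by auto
    then obtain e q where eq: "c = e # q" by (cases c) (auto simp: first_return_def)
    \<comment> \<open>The predecessor of \<open>k\<close> modulo \<open>m\<close>.\<close>
    define j where "j = (if k = 0 then m - 1 else k - 1)"
    have "j < m" "Suc j mod m = k" using pk(3) by (auto simp: j_def)
    moreover have q: "e \<in> arcs G" "q \<in> arrivals" "start q = head G e" "tail G e = v"
      using c unfolding eq return_Cons_iff by blast+
    ultimately have "(q, j) \<in> D m (head G e)" "y = F m e (q, j)"
      by (simp_all add: D_def F_def pk(1) Nil)
    moreover have "e \<in> out_arcs G u" using q pk(4) Nil by simp
    ultimately show ?thesis by blast
  next
    case (Cons e q)
    then show ?thesis using pk
      by (intro bexI[of _ e] bexI[of _ "(q, k)"]) (auto simp: D_def F_def arrival_Cons_iff)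
  qed
qed

abbreviation to_v :: "'b list \<Rightarrow> ('a, 'b) generator free_word \<Rightarrow>\<^sub>0 'k::field" where
  "to_v p \<equiv> path_elem (start p) p"

abbreviation from_v :: "'b list \<Rightarrow> ('a, 'b) generator free_word \<Rightarrow>\<^sub>0 'k::field" where
  "from_v p \<equiv> ghost_elem (start p) p"

abbreviation act :: "nat \<Rightarrow> (('a, 'b) generator free_word \<Rightarrow>\<^sub>0 'k::field) \<Rightarrow>
    ('b list \<times> nat \<Rightarrow> 'k) \<Rightarrow> 'b list \<times> nat \<Rightarrow> 'k" where
  "act m \<equiv> branching_system.action G (D m) (F m)"

abbreviation delta :: "'b list \<times> nat \<Rightarrow> 'b list \<times> nat \<Rightarrow> 'k::field" where
  "delta x \<equiv> \<lambda>y. if y = x then 1 else 0"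

lemma D_v: "z \<in> D m v \<longleftrightarrow> fst z = [] \<and> snd z < m"
  using start_eq_v by (cases z) (auto simp: D_def)

text \<open>Values at \<open>([], k)\<close> are moved to \<open>(p, k)\<close>. Together with
  \<open>act_from_v\<close> this makes \<open>to_v p * from_v q\<close> a matrix unit for
  \<open>m = 1\<close>.\<close>

lemma act_to_v:
  assumes "m > 0" "p \<in> arrivals"
  shows "act m (to_v p :: _ \<Rightarrow>\<^sub>0 'k::field) \<phi> z = (if fst z = p \<and> snd z < m then \<phi> ([], snd z) else 0)"
  using assms(2)
proof (induction p arbitrary: z)
  case Nil
  interpret R: branching_system G "D m" "F m" by (rule branching[OF assms(1)])
  show ?case by (cases z) (auto simp: path_elem_def R.action_letter D_v)
next
  case (Cons e p)
  interpret R: branching_system G "D m" "F m" by (rule branching[OF assms(1)])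
  have e: "e \<in> arcs G" "p \<in> arrivals" "start p = head G e" "tail G e \<noteq> v"
    using Cons.prems arrival_Cons_iff by auto
  have "act m (to_v (e # p) :: _ \<Rightarrow>\<^sub>0 'k) \<phi> = R.action (arc_letter e * to_v p) \<phi>"
    using e path_elem_Cons[of e p] by (intro R.action_cong) simp
  also have "\<dots> = R.gen_op (Arc e) (R.action (to_v p) \<phi>)" by (simp only: R.action_mult R.action_letter)
  finally have eq: "act m (to_v (e # p) :: _ \<Rightarrow>\<^sub>0 'k) \<phi> z = R.gen_op (Arc e) (R.action (to_v p) \<phi>) z" by simp
  show ?case
  proof (cases "z \<in> F m e ` D m (head G e)")
    case True
    then obtain q k where z: "z = F m e (q, k)" "(q, k) \<in> D m (head G e)" by auto
    have "R.gen_op (Arc e) (R.action (to_v p) \<phi>) z = R.action (to_v p) \<phi> (q, k)"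
      using z R.inv_F[OF e(1) z(2)] by auto
    also have "\<dots> = (if q = p \<and> k < m then \<phi> ([], k) else 0)"
      using Cons.IH[OF e(2), of "(q, k)"] by simp
    finally show ?thesis unfolding eq using z(1) e(4) by (simp add: F_def)
  next
    case False
    have "\<not> (fst z = e # p \<and> snd z < m)"
    proof
      assume "fst z = e # p \<and> snd z < m"
      then have "z = F m e (p, snd z)" "(p, snd z) \<in> D m (head G e)"
        using e by (auto simp: F_def D_def prod_eq_iff)
      then show False using False by blast
    qed
    then show ?thesis unfolding eq using False by (simp only: R.gen_op.simps if_False)
  qed
qed

lemma act_from_v:
  assumes "m > 0" "p \<in> arrivals"
  shows "act m (from_v p :: _ \<Rightarrow>\<^sub>0 'k::field) \<phi> z = (if z \<in> D m v then \<phi> (p, snd z) else 0)"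
  using assms(2)
proof (induction p arbitrary: \<phi>)
  case Nil
  interpret R: branching_system G "D m" "F m" by (rule branching[OF assms(1)])
  show ?case by (cases z) (auto simp: ghost_elem_def R.action_letter D_v)
next
  case (Cons e p)
  interpret R: branching_system G "D m" "F m" by (rule branching[OF assms(1)])
  have e: "e \<in> arcs G" "p \<in> arrivals" "start p = head G e" "tail G e \<noteq> v"
    using Cons.prems arrival_Cons_iff by auto
  have "act m (from_v (e # p) :: _ \<Rightarrow>\<^sub>0 'k) \<phi> = R.action (from_v p * ghost_letter e) \<phi>"
    using e ghost_elem_Cons[of e p] by (intro R.action_cong) simp
  also have "\<dots> = R.action (from_v p) (R.gen_op (Ghost e) \<phi>)" by (simp only: R.action_mult R.action_letter)
  finally show ?case using Cons.IH[OF e(2), of "R.gen_op (Ghost e) \<phi>"] e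
    by (auto simp: D_v) (auto simp: D_def F_def)
qed

text \<open>The unit acts as restriction to the points of the system, not as the identity on all
  functions.\<close>

lemma act_unit:
  assumes "m > 0"
  shows "act m (\<Sum>u\<in>verts G. vert u :: _ \<Rightarrow>\<^sub>0 'k::field) \<phi> z = (if fst z \<in> arrivals \<and> snd z < m then \<phi> z else 0)"
proof -
  interpret R: branching_system G "D m" "F m" by (rule branching[OF assms(1)])
  have "act m (\<Sum>u\<in>verts G. vert u :: _ \<Rightarrow>\<^sub>0 'k) \<phi> z = (\<Sum>u\<in>verts G. if z \<in> D m u then \<phi> z else 0)"
    by (simp add: R.action_sum R.action_letter)
  also have "\<dots> = (\<Sum>u\<in>verts G. if u = start (fst z) then (if fst z \<in> arrivals \<and> snd z < m then \<phi> z else 0) else 0)"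
    by (intro sum.cong) (auto simp: D_def case_prod_beta)
  also have "\<dots> = (if fst z \<in> arrivals \<and> snd z < m then \<phi> z else 0)"
    by (subst sum.delta) (auto simp: finite_verts)
  finally show ?thesis .
qed

end

section \<open>A finite dimensional quotient\<close>

context field_algebra
begin

lemma subspace_finsum:
  assumes "VectorSpace.subspace class_ring W A" "finite I" "\<And>i. i \<in> I \<Longrightarrow> x i \<in> W"
  shows "(\<Oplus>i\<in>I. x i) \<in> W"
  using assms(2,3)
proof (induction I rule: finite_induct)
  case (insert i I)
  then show ?case
    using subspaceD[OF assms(1)] by (subst A.finsum_insert) (auto simp: subset_iff)
qed (simp add: subspaceD(2)[OF assms(1)])

lemma quotient_algebra_ops:
  assumes J: "ideal J A"
  defines "Q \<equiv> quotient_algebra A J"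
  shows "carrier Q = (\<lambda>x. J +> x) ` carrier A"
    "\<And>x y. x \<in> carrier A \<Longrightarrow> y \<in> carrier A \<Longrightarrow> (J +> x) \<oplus>\<^bsub>Q\<^esub> (J +> y) = J +> (x \<oplus> y)"
    "\<And>a x. x \<in> carrier A \<Longrightarrow> a \<odot>\<^bsub>Q\<^esub> (J +> x) = J +> (a \<odot> x)"
    "\<zero>\<^bsub>Q\<^esub> = J"
proof -
  interpret J: ideal J A by (rule J)
  show "carrier Q = (\<lambda>x. J +> x) ` carrier A"
    by (auto simp: Q_def quotient_algebra_def FactRing_def A_RCOSETS_def RCOSETS_def a_r_coset_def)
  show "(J +> x) \<oplus>\<^bsub>Q\<^esub> (J +> y) = J +> (x \<oplus> y)" if "x \<in> carrier A" "y \<in> carrier A" for x y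
    using that J.a_rcos_sum by (simp add: Q_def quotient_algebra_def FactRing_def)
  show "a \<odot>\<^bsub>Q\<^esub> (J +> x) = J +> (a \<odot> x)" if "x \<in> carrier A" for a x
    using coset_smult[OF J that] by (simp add: Q_def quotient_algebra_def)
  show "\<zero>\<^bsub>Q\<^esub> = J" by (simp add: Q_def quotient_algebra_def FactRing_def)
qed

lemma fin_dim_quotientI:
  assumes J: "ideal J A" and "\<one> \<notin> J" and X: "finite X" "X \<subseteq> carrier A"
    and span: "\<And>x. x \<in> carrier A \<Longrightarrow> \<exists>y\<in>span X. x \<ominus> y \<in> J"
  shows "has_nonzero_fin_dim_quotient A"
proof -
  interpret J: ideal J A by (rule J)
  interpret Q: field_algebra "quotient_algebra A J" by (rule quotient_field_algebra[OF J])
  note ops = quotient_algebra_ops[OF J]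
  let ?X = "(\<lambda>x. J +> x) ` X"
  have X': "finite ?X" "?X \<subseteq> carrier (quotient_algebra A J)" using X by (auto simp: ops(1))
  note sub = Q.span_is_subspace[OF X'(2)]
  have "VectorSpace.subspace class_ring {x \<in> carrier A. J +> x \<in> Q.span ?X} A"
  proof (rule subspaceI)
    have "J +> \<zero> = J" using J.a_rcos_const[of \<zero>] by simp
    then show "\<zero> \<in> {x \<in> carrier A. J +> x \<in> Q.span ?X}"
      using Q.subspaceD(2)[OF sub] by (simp add: ops(4))
  next
    fix x y assume "x \<in> {x \<in> carrier A. J +> x \<in> Q.span ?X}" "y \<in> {x \<in> carrier A. J +> x \<in> Q.span ?X}"
    then show "x \<oplus> y \<in> {x \<in> carrier A. J +> x \<in> Q.span ?X}"
      using Q.subspaceD(3)[OF sub, of "J +> x" "J +> y"] ops(2)[of x y] by simp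
  next
    fix a x assume "x \<in> {x \<in> carrier A. J +> x \<in> Q.span ?X}"
    then show "a \<odot> x \<in> {x \<in> carrier A. J +> x \<in> Q.span ?X}"
      using Q.subspaceD(4)[OF sub, of "J +> x" a] ops(3)[of x a] by simp
  qed blast
  moreover have "X \<subseteq> {x \<in> carrier A. J +> x \<in> Q.span ?X}"
    using Q.in_own_span[OF X'(2)] X(2) by blast
  ultimately have *: "span X \<subseteq> {x \<in> carrier A. J +> x \<in> Q.span ?X}" by (rule span_subset)
  have "Q.span ?X = carrier (quotient_algebra A J)"
  proof
    show "Q.span ?X \<subseteq> carrier (quotient_algebra A J)" using Q.subspaceD(1)[OF sub] .
    show "carrier (quotient_algebra A J) \<subseteq> Q.span ?X"
    proof
      fix z assume "z \<in> carrier (quotient_algebra A J)"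
      then obtain x where x: "x \<in> carrier A" "z = J +> x" by (auto simp: ops(1))
      obtain y where y: "y \<in> span X" "x \<ominus> y \<in> J" using span[OF x(1)] by blast
      have yc: "y \<in> carrier A" "J +> y \<in> Q.span ?X" using * y(1) by auto
      have "x = (x \<ominus> y) \<oplus> y" using x(1) yc(1) by (simp add: a_minus_def A.add.m_assoc A.l_neg)
      then have "J +> x = J +> y" using coset_eqI[OF J x(1) yc(1) y(2)] by blast
      then show "z \<in> Q.span ?X" using yc x(2) by simp
    qed
  qed
  then have "vectorspace.fin_dim class_ring (quotient_algebra A J)"
    using Q.dim_on_span(1)[OF X'] by (simp add: fin_dim_on_def)
  moreover have "J +> \<one> \<noteq> J"
    using assms(2) J.a_rcos_self[of \<one>] by auto
  then have "carrier (quotient_algebra A J) \<noteq> {\<zero>\<^bsub>quotient_algebra A J\<^esub>}"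
    unfolding ops(1,4) by blast
  ultimately show ?thesis unfolding has_nonzero_fin_dim_quotient_def using J by blast
qed

end

context good_vertex
begin

lemma nonunital_matrix_unit:
  "p \<in> arrivals \<Longrightarrow> q \<in> arrivals \<Longrightarrow> to_v p * from_v q \<in> nonunital"
  by (intro N_closed) simp_all

text \<open>The unit absorbs \<open>f\<close> on both sides, so only the values of
  \<open>\<phi>\<close> at the finitely many points matter and the result vanishes elsewhere. Thus
  \<open>f\<close> acts as a finite matrix.\<close>

lemma act_expand:
  assumes f: "f \<in> (nonunital :: (_ \<Rightarrow>\<^sub>0 'k::field) set)"
  shows "act (Suc 0) f \<phi> z = (if fst z \<in> arrivals \<and> snd z < Suc 0
    then \<Sum>q\<in>arrivals. \<phi> (q, 0) * act (Suc 0) f (delta (q, 0)) z else 0)"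
proof -
  interpret R: branching_system G "D (Suc 0)" "F (Suc 0)" by (rule branching) simp
  let ?U = "(\<Sum>u\<in>verts G. vert u) :: _ \<Rightarrow>\<^sub>0 'k"
  have U: "?U \<in> free_carrier" by (rule U_in(2))
  have fU: "?U * f \<approx> f" "f * ?U \<approx> f"
    using U_unit[OF f] nonunital_free[OF f] U by (simp_all add: leavitt_eq_def)
  have left: "act (Suc 0) f \<phi> z = (if fst z \<in> arrivals \<and> snd z < Suc 0 then act (Suc 0) f \<phi> z else 0)" for \<phi>
    using R.action_cong[OF fU(1), of \<phi>] act_unit[of "Suc 0" "act (Suc 0) f \<phi>" z] by (simp add: R.action_mult)
  have "R.action ?U \<phi> = (\<lambda>z. \<Sum>q\<in>arrivals. \<phi> (q, 0) * delta (q, 0) z)"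
  proof
    fix z
    have "(\<Sum>q\<in>arrivals. \<phi> (q, 0) * delta (q, 0) z) = (\<Sum>q\<in>arrivals. if q = fst z then (if snd z < Suc 0 then \<phi> z else 0) else 0)"
      by (cases z) (auto intro!: sum.cong)
    then show "R.action ?U \<phi> z = (\<Sum>q\<in>arrivals. \<phi> (q, 0) * delta (q, 0) z)"
      using act_unit[of "Suc 0" \<phi> z] finite_arrivals by simp
  qed
  then have "act (Suc 0) f \<phi> = (\<lambda>z. \<Sum>q\<in>arrivals. \<phi> (q, 0) * act (Suc 0) f (delta (q, 0)) z)"
    using R.action_cong[OF fU(2), of \<phi>] R.action_sum_arg[of f "\<lambda>q. \<phi> (q, 0)" "\<lambda>q. delta (q, 0)" arrivals]
    by (simp add: R.action_mult)
  then have "act (Suc 0) f \<phi> z = (\<Sum>q\<in>arrivals. \<phi> (q, 0) * act (Suc 0) f (delta (q, 0)) z)" by (rule fun_cong)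
  then show ?thesis using left[of \<phi>] by presburger
qed

lemma act_matrix_unit:
  assumes "p \<in> arrivals" "q \<in> arrivals"
  shows "act (Suc 0) (to_v p * from_v q :: _ \<Rightarrow>\<^sub>0 'k::field) \<phi> z = (if fst z = p \<and> snd z < Suc 0 then \<phi> (q, 0) else 0)"
proof -
  interpret R: branching_system G "D (Suc 0)" "F (Suc 0)" by (rule branching) simp
  show ?thesis
    using act_to_v[of "Suc 0" p "act (Suc 0) (from_v q) \<phi>" z] act_from_v[of "Suc 0" q \<phi> "([], 0)"] assms
    by (simp add: R.action_mult D_v)
qed

text \<open>\<open>J\<close> is the annihilator of the representation for \<open>m = 1\<close>. The
  elements \<open>to_v p * from_v q\<close> act as all the matrix units, so modulo \<open>J\<close>
  they span.\<close>

theorem fin_dim_quotient: "has_nonzero_fin_dim_quotient (LPA :: ('k::field, _) module)"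
proof -
  interpret L: field_algebra "LPA :: ('k, _) module" by (rule leavitt_field_algebra)
  interpret R: branching_system G "D (Suc 0)" "F (Suc 0)" by (rule branching) simp
  define K where "K = {f \<in> (nonunital :: (_ \<Rightarrow>\<^sub>0 'k) set). \<forall>\<phi>. R.action f \<phi> = (\<lambda>x. 0)}"
  define J where "J = leavitt_class ` K"
  note ops = leavitt_ops[where ?'k = 'k]
  have J_iff: "leavitt_class f \<in> J \<longleftrightarrow> (\<forall>\<phi>. R.action f \<phi> = (\<lambda>x. 0))" if f: "f \<in> nonunital" for f
  proof
    assume "leavitt_class f \<in> J"
    then obtain g where g: "g \<in> K" "leavitt_class f = leavitt_class g" by (auto simp: J_def)
    then have "f \<approx> g" using ops(7)[OF f, of g] by (simp add: K_def)
    then show "\<forall>\<phi>. R.action f \<phi> = (\<lambda>x. 0)" using g(1) R.action_cong[OF \<open>f \<approx> g\<close>] by (simp add: K_def)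
  qed (use f in \<open>auto simp: J_def K_def\<close>)
  have minus: "\<ominus>\<^bsub>LPA\<^esub> leavitt_class f = leavitt_class (- f)" if "f \<in> nonunital" for f :: "_ \<Rightarrow>\<^sub>0 'k"
    using that N_closed(5)[OF that]
    by (intro L.A.minus_equality) (auto simp: ops(3,5) leavitt_class_nonunital)
  have car: "\<exists>f\<in>nonunital. x = leavitt_class f" if "x \<in> carrier (LPA :: ('k, _) module)" for x
    using that by (auto simp: ops(1))
  have J: "ideal J (LPA :: ('k, _) module)"
  proof (rule idealI[OF L.A.ring_axioms L.A.add.subgroupI])
    show "J \<subseteq> carrier LPA" by (auto simp: J_def K_def leavitt_class_nonunital)
    have "leavitt_class 0 \<in> J" by (simp add: J_iff N_closed R.action_zero)
    then show "J \<noteq> {}" by blast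
  next
    fix x assume "x \<in> J"
    then obtain f where f: "f \<in> K" "x = leavitt_class f" by (auto simp: J_def)
    then have "R.action (- f) \<phi> = (\<lambda>x. 0)" for \<phi>
      using R.action_diff[of 0 f \<phi>] by (simp add: K_def R.action_zero)
    then show "\<ominus>\<^bsub>LPA\<^esub> x \<in> J" using f by (simp add: minus J_iff N_closed K_def)
  next
    fix x y assume "x \<in> J" "y \<in> J"
    then obtain f g where "f \<in> K" "x = leavitt_class f" "g \<in> K" "y = leavitt_class g" by (auto simp: J_def)
    then show "x \<oplus>\<^bsub>LPA\<^esub> y \<in> J" by (simp add: K_def ops(5) J_iff N_closed R.action_add)
  next
    fix x y assume "x \<in> J" "y \<in> carrier (LPA :: ('k, _) module)"
    then obtain f g where "f \<in> K" "x = leavitt_class f" "g \<in> nonunital" "y = leavitt_class g"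
      using car[of y] by (auto simp: J_def)
    then show "y \<otimes>\<^bsub>LPA\<^esub> x \<in> J" "x \<otimes>\<^bsub>LPA\<^esub> y \<in> J"
      by (simp_all add: K_def ops(4) J_iff N_closed R.action_mult R.action_zero_arg)
  qed
  let ?I = "arrivals \<times> arrivals"
  let ?E = "\<lambda>(p, q). to_v p * from_v q :: _ \<Rightarrow>\<^sub>0 'k"
  have E: "?E i \<in> nonunital" if "i \<in> ?I" for i using that by (auto intro: nonunital_matrix_unit)
  define X where "X = leavitt_class ` ?E ` ?I"
  have fin: "finite ?I" using finite_arrivals by simp
  have X: "finite X" "X \<subseteq> carrier LPA"
    unfolding X_def using fin E leavitt_class_nonunital by blast+
  show ?thesis
  proof (rule L.fin_dim_quotientI[OF J _ X])
    have one: "R.action (\<Sum>u\<in>verts G. vert u) (delta ([], 0)) ([], 0) = (1 :: 'k)"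
      by (subst act_unit) simp_all
    have "R.action (\<Sum>u\<in>verts G. vert u) (delta ([], 0)) \<noteq> (\<lambda>x. 0 :: 'k)"
    proof
      assume "R.action (\<Sum>u\<in>verts G. vert u) (delta ([], 0)) = (\<lambda>x. 0 :: 'k)"
      from fun_cong[OF this, of "([], 0)"] have "1 = (0 :: 'k)" unfolding one .
      then show False by simp
    qed
    then show "\<one>\<^bsub>LPA\<^esub> \<notin> J" using J_iff[OF U_in(1)] unfolding ops(2) by blast
  next
    fix x assume "x \<in> carrier (LPA :: ('k, _) module)"
    then obtain f where f: "f \<in> nonunital" "x = leavitt_class f" using car by blast
    \<comment> \<open>The matrix entry of \<open>f\<close> in row \<open>p\<close> and column
      \<open>q\<close>.\<close>
    define c where "c = (\<lambda>(p, q). R.action f (delta (q, 0)) (p, 0 :: nat))"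
    define g where "g = (\<Sum>i\<in>?I. Poly_Mapping.single 0 (c i) * ?E i)"
    have gN: "g \<in> nonunital" unfolding g_def by (intro nonunital_sum N_closed(6) E)
    have "R.action g \<phi> z = R.action f \<phi> z" for \<phi> z
    proof -
      have "R.action g \<phi> z = (\<Sum>i\<in>?I. c i * R.action (?E i) \<phi> z)"
        by (simp add: g_def R.action_sum R.action_scalar)
      also have "\<dots> = (\<Sum>(p, q)\<in>?I. if p = fst z then (if snd z < Suc 0 then c (p, q) * \<phi> (q, 0) else 0) else 0)"
        by (intro sum.cong refl) (auto simp: act_matrix_unit)
      also have "\<dots> = (\<Sum>p\<in>arrivals. \<Sum>q\<in>arrivals. if p = fst z then (if snd z < Suc 0 then c (p, q) * \<phi> (q, 0) else 0) else 0)"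
        by (rule sum.cartesian_product[symmetric])
      also have "\<dots> = (\<Sum>p\<in>arrivals. if p = fst z then (\<Sum>q\<in>arrivals. if snd z < Suc 0 then c (p, q) * \<phi> (q, 0) else 0) else 0)"
        by (intro sum.cong refl) auto
      also have "\<dots> = (if fst z \<in> arrivals \<and> snd z < Suc 0 then \<Sum>q\<in>arrivals. \<phi> (q, 0) * c (fst z, q) else 0)"
        using finite_arrivals by (auto simp: mult.commute)
      also have "\<dots> = (if fst z \<in> arrivals \<and> snd z < Suc 0 then \<Sum>q\<in>arrivals. \<phi> (q, 0) * R.action f (delta (q, 0)) z else 0)"
        by (cases z) (auto simp: c_def)
      also have "\<dots> = R.action f \<phi> z" by (rule act_expand[OF f(1), symmetric])
      finally show ?thesis .
    qed
    then have "R.action (f - g) \<phi> = (\<lambda>x. 0)" for \<phi> by (simp add: R.action_diff)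
    moreover have "f - g \<in> nonunital" using N_closed(2)[OF f(1) N_closed(5)[OF gN]] by simp
    ultimately have "leavitt_class (f - g) \<in> J" using J_iff by blast
    moreover have "leavitt_class f \<ominus>\<^bsub>LPA\<^esub> leavitt_class g = leavitt_class (f - g)"
      using f(1) gN by (simp add: a_minus_def minus ops(5) N_closed)
    moreover have "leavitt_class g \<in> L.span X"
    proof -
      have "leavitt_class g = (\<Oplus>\<^bsub>LPA\<^esub>i\<in>?I. c i \<odot>\<^bsub>LPA\<^esub> leavitt_class (?E i))"
        unfolding g_def by (rule leavitt_class_sum[OF fin E, symmetric])
      also have "\<dots> \<in> L.span X"
      proof (rule L.subspace_finsum[OF L.span_is_subspace[OF X(2)] fin])
        fix i assume "i \<in> ?I"
        then have "leavitt_class (?E i) \<in> L.span X" using L.in_own_span[OF X(2)] unfolding X_def by blast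
        then show "c i \<odot>\<^bsub>LPA\<^esub> leavitt_class (?E i) \<in> L.span X"
          by (rule L.subspaceD(4)[OF L.span_is_subspace[OF X(2)]])
      qed
      finally show ?thesis .
    qed
    ultimately show "\<exists>y\<in>L.span X. x \<ominus>\<^bsub>LPA\<^esub> y \<in> J" using f(2) by metis
  qed
qed

end

section \<open>Algebraic amenability\<close>

context good_vertex
begin

text \<open>The value 0 at a sink is a dummy: its power with exponent 0 is still 1, and at a sink
  only that exponent will be used.\<close>

definition return_elem :: "('a, 'b) generator free_word \<Rightarrow>\<^sub>0 'k::field" where
  "return_elem = (if out_arcs G v = {} then 0 else path_elem v (SOME c. first_return G v c))"

lemma return_elem_decomp:
  assumes "out_arcs G v \<noteq> {}"
  obtains f q where "f \<in> arcs G" "q \<in> arrivals" "start q = head G f" "tail G f = v"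
    "return_elem = (path_elem v (f # q) :: _ \<Rightarrow>\<^sub>0 'k::field)" "first_return G v (f # q)"
proof -
  have r: "first_return G v (SOME c. first_return G v c)" using return_exists[OF assms] by (rule someI_ex)
  then obtain f q where fq: "(SOME c. first_return G v c) = f # q"
    by (cases "SOME c. first_return G v c") (auto simp: first_return_def)
  show ?thesis
    using r unfolding fq return_Cons_iff
    by (intro that[of f q]) (simp_all add: return_elem_def assms fq return_Cons_iff)
qed

lemma return_elem_nonunital [simp]: "return_elem \<in> nonunital"
proof (cases "out_arcs G v = {}")
  case False
  then obtain f q where q: "f \<in> arcs G" "q \<in> arrivals"
    "(return_elem :: _ \<Rightarrow>\<^sub>0 'c) = path_elem v (f # q)"
    by (rule return_elem_decomp)
  have "set (f # q) \<subseteq> arcs G" using q(1) arrival_arcs[OF q(2)] by simp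
  then show ?thesis unfolding q(3) using v_vert by simp
qed (simp add: return_elem_def N_closed)

definition orbit_elem :: "'b list \<Rightarrow> nat \<Rightarrow> ('a, 'b) generator free_word \<Rightarrow>\<^sub>0 'k::field" where
  "orbit_elem p k = to_v p * return_elem ^ k"

lemma return_power_free [simp]: "return_elem ^ k \<in> free_carrier"
  by (induction k) (simp_all add: nonunital_free)

lemma orbit_elem_nonunital [simp]:
  "p \<in> arrivals \<Longrightarrow> orbit_elem p k \<in> (nonunital :: (_ \<Rightarrow>\<^sub>0 'k::field) set)"
proof (induction k)
  case (Suc k)
  then have "orbit_elem p k * return_elem \<in> (nonunital :: (_ \<Rightarrow>\<^sub>0 'k) set)" by (intro N_closed) simp_all
  then show ?case unfolding orbit_elem_def power_Suc2 mult.assoc .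
qed (simp add: orbit_elem_def)

text \<open>The element \<open>orbit_elem [] k\<close> carries an additional letter \<open>v\<close>
  in front, which a first return absorbs. For \<open>k = 0\<close> the power is the unit of the free
  algebra and cannot absorb it.\<close>

lemma orbit_elem_Nil_Suc: "orbit_elem [] k \<approx> (return_elem ^ k :: _ \<Rightarrow>\<^sub>0 'k::field)"
  if k: "k > 0" and ne: "out_arcs G v \<noteq> {}"
proof -
  obtain f q where q: "f \<in> arcs G" "q \<in> arrivals" "start q = head G f" "tail G f = v"
    "(return_elem :: _ \<Rightarrow>\<^sub>0 'k) = path_elem v (f # q)"
    using ne by (rule return_elem_decomp)
  obtain j where j: "k = Suc j" using k by (cases k) auto
  have c: "set (f # q) \<subseteq> arcs G" using q(1) arrival_arcs[OF q(2)] by simp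
  have "vert v * return_elem \<approx> (return_elem :: _ \<Rightarrow>\<^sub>0 'k)"
    unfolding q(5) using vert_path_elem[OF v_vert v_vert c] by simp
  then have "vert v * return_elem * return_elem ^ j \<approx> (return_elem * return_elem ^ j :: _ \<Rightarrow>\<^sub>0 'k)"
    by (intro leavitt_eq_mult_right) simp_all
  then show ?thesis by (simp add: orbit_elem_def path_elem_def j mult.assoc)
qed

text \<open>The exceptional value \<open>h\<close> is common to all elements of the orbit, so for a
  given generator it costs one dimension at most.\<close>

definition stays_in_orbit ::
  "nat \<Rightarrow> (('a, 'b) generator free_word \<Rightarrow>\<^sub>0 'k::field) \<Rightarrow> (('a, 'b) generator free_word \<Rightarrow>\<^sub>0 'k) \<Rightarrow> bool" where
  "stays_in_orbit n h f \<longleftrightarrow> f \<approx> 0 \<or> (\<exists>p\<in>arrivals. \<exists>k<n. f \<approx> orbit_elem p k) \<or>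
     (out_arcs G v \<noteq> {} \<and> f \<approx> h)"

lemma stays_in_orbitI:
  "f \<approx> 0 \<Longrightarrow> stays_in_orbit n h f"
  "f \<approx> orbit_elem p k \<Longrightarrow> p \<in> arrivals \<Longrightarrow> k < n \<Longrightarrow> stays_in_orbit n h f"
  "f \<approx> h \<Longrightarrow> out_arcs G v \<noteq> {} \<Longrightarrow> stays_in_orbit n h f"
  by (auto simp: stays_in_orbit_def)

lemma times_orbit_elem:
  "g * to_v p \<approx> f \<Longrightarrow> g * orbit_elem p k \<approx> f * return_elem ^ k"
  using leavitt_eq_mult_right[of "g * to_v p" f "return_elem ^ k"] by (simp add: orbit_elem_def mult.assoc)

lemma times_orbit_elem_zero: "g * to_v p \<approx> 0 \<Longrightarrow> g * orbit_elem p k \<approx> 0"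
  using times_orbit_elem[of g p 0 k] by simp

lemma times_orbit_elem_to_v: "g * to_v p \<approx> to_v q \<Longrightarrow> g * orbit_elem p k \<approx> orbit_elem q k"
  using times_orbit_elem[of g p "to_v q" k] by (simp add: orbit_elem_def)

lemma vert_orbit_elem:
  assumes u: "u \<in> verts G" and p: "p \<in> arrivals" and k: "k < n"
  shows "stays_in_orbit n h (vert u * orbit_elem p k :: _ \<Rightarrow>\<^sub>0 'k::field)"
proof (cases "u = start p")
  case True
  have "vert u * to_v p \<approx> (to_v p :: _ \<Rightarrow>\<^sub>0 'k)"
    using vert_path_elem[OF u start_vert[OF p] arrival_arcs[OF p]] True by simp
  from times_orbit_elem_to_v[OF this] show ?thesis using p k by (rule stays_in_orbitI)
next
  case False
  have "vert u * to_v p \<approx> (0 :: _ \<Rightarrow>\<^sub>0 'k)"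
    using vert_path_elem[OF u start_vert[OF p] arrival_arcs[OF p]] False by simp
  from times_orbit_elem_zero[OF this] show ?thesis by (rule stays_in_orbitI)
qed

text \<open>The exponent grows only where the arc completes a first return; the exception is the
  overflow from \<open>n - 1\<close> to \<open>n\<close>.\<close>

lemma arc_orbit_elem:
  assumes e: "e \<in> arcs G" and p: "p \<in> arrivals" and k: "k < n"
  shows "stays_in_orbit n (orbit_elem [] n) (arc_letter e * orbit_elem p k :: _ \<Rightarrow>\<^sub>0 'k::field)"
proof -
  note Cons = leavitt_eq_sym[OF path_elem_Cons[OF e arrival_arcs[OF p]]]
  consider "head G e \<noteq> start p" | "head G e = start p" "tail G e \<noteq> v" | "head G e = start p" "tail G e = v"
    by blast
  then show ?thesis
  proof cases
    case 1
    have "arc_letter e * to_v p \<approx> (0 :: _ \<Rightarrow>\<^sub>0 'k)"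
      using 1 by (rule arc_path_elem_zero[OF e start_vert[OF p] arrival_arcs[OF p]])
    from times_orbit_elem_zero[OF this] show ?thesis by (rule stays_in_orbitI)
  next
    case 2
    then have ep: "e # p \<in> arrivals" using e p by (simp add: arrival_Cons_iff)
    have "arc_letter e * to_v p \<approx> (to_v (e # p) :: _ \<Rightarrow>\<^sub>0 'k)" using Cons 2(1) by simp
    from times_orbit_elem_to_v[OF this] show ?thesis using ep k by (rule stays_in_orbitI)
  next
    case 3
    then have r: "first_return G v (e # p)" using e p by (simp add: return_Cons_iff)
    have ne: "out_arcs G v \<noteq> {}" using 3(2) e by auto
    obtain f q where q: "(return_elem :: _ \<Rightarrow>\<^sub>0 'k) = path_elem v (f # q)" "first_return G v (f # q)"
      using ne by (rule return_elem_decomp)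
    then have C: "(return_elem :: _ \<Rightarrow>\<^sub>0 'k) = path_elem v (e # p)" using unique_return[OF r q(2)] by simp
    have "arc_letter e * to_v p \<approx> (return_elem :: _ \<Rightarrow>\<^sub>0 'k)" unfolding C using Cons 3 by simp
    from times_orbit_elem[OF this] have "arc_letter e * orbit_elem p k \<approx> (return_elem ^ Suc k :: _ \<Rightarrow>\<^sub>0 'k)"
      by simp
    also have "\<dots> \<approx> orbit_elem [] (Suc k)" using ne by (intro leavitt_eq_sym[OF orbit_elem_Nil_Suc]) simp_all
    finally have step: "arc_letter e * orbit_elem p k \<approx> (orbit_elem [] (Suc k) :: _ \<Rightarrow>\<^sub>0 'k)" .
    show ?thesis
    proof (cases "Suc k = n")
      case True
      show ?thesis using step[unfolded True] ne by (rule stays_in_orbitI)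
    next
      case False
      then show ?thesis using k by (intro stays_in_orbitI(2)[OF step Nil_arrival]) simp
    qed
  qed
qed

text \<open>A ghost strips a leading arc. At the empty arrival this arc is taken from a return and
  the exponent drops; the exception is \<open>k = 0\<close>, where no arc is left.\<close>

lemma ghost_orbit_elem:
  assumes e: "e \<in> arcs G" and p: "p \<in> arrivals" and k: "k < n"
  shows "stays_in_orbit n (ghost_letter e * orbit_elem [] 0) (ghost_letter e * orbit_elem p k :: _ \<Rightarrow>\<^sub>0 'k::field)"
proof (cases p)
  case (Cons f q)
  then have f: "f \<in> arcs G" "q \<in> arrivals" "start q = head G f" using p by (simp_all add: arrival_Cons_iff)
  have ghost: "ghost_letter e * to_v p \<approx> (if e = f then to_v q else 0 :: _ \<Rightarrow>\<^sub>0 'k)"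
    using ghost_path_elem_Cons[OF e f(1) arrival_arcs[OF f(2)]] f(3) by (cases "e = f") (simp_all add: Cons)
  show ?thesis
  proof (cases "e = f")
    case True
    then have "ghost_letter e * to_v p \<approx> (to_v q :: _ \<Rightarrow>\<^sub>0 'k)" using ghost by simp
    from times_orbit_elem_to_v[OF this] show ?thesis using f(2) k by (rule stays_in_orbitI)
  next
    case False
    then have "ghost_letter e * to_v p \<approx> (0 :: _ \<Rightarrow>\<^sub>0 'k)" using ghost by simp
    from times_orbit_elem_zero[OF this] show ?thesis by (rule stays_in_orbitI)
  qed
next
  case Nil
  show ?thesis
  proof (cases "tail G e = v")
    case False
    then have "ghost_letter e * to_v p \<approx> (0 :: _ \<Rightarrow>\<^sub>0 'k)"
      using ghost_path_elem_zero[OF e v_vert, of "[]"] by (simp add: Nil)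
    from times_orbit_elem_zero[OF this] show ?thesis by (rule stays_in_orbitI)
  next
    case True
    then have ne: "out_arcs G v \<noteq> {}" using e by auto
    show ?thesis
    proof (cases k)
      case 0
      have "(ghost_letter e * orbit_elem p k :: _ \<Rightarrow>\<^sub>0 'k) \<approx> ghost_letter e * orbit_elem [] 0"
        unfolding Nil 0 using e by (intro leavitt_eq_refl free_carrier_closed(1) nonunital_free[OF orbit_elem_nonunital]) simp_all
      then show ?thesis using ne by (rule stays_in_orbitI)
    next
      case (Suc j)
      obtain f q where q: "f \<in> arcs G" "q \<in> arrivals" "start q = head G f" "tail G f = v"
        "(return_elem :: _ \<Rightarrow>\<^sub>0 'k) = path_elem v (f # q)"
        using ne by (rule return_elem_decomp)
      have ghost: "ghost_letter e * path_elem v (f # q) \<approx> (if e = f then to_v q else 0 :: _ \<Rightarrow>\<^sub>0 'k)"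
        using ghost_path_elem_Cons[OF e q(1) arrival_arcs[OF q(2)]] q(3,4) by (cases "e = f") simp_all
      have "ghost_letter e * orbit_elem p k \<approx> ghost_letter e * (return_elem ^ k :: _ \<Rightarrow>\<^sub>0 'k)"
        unfolding Nil using e ne by (intro leavitt_eq_mult_left orbit_elem_Nil_Suc) (simp_all add: Suc)
      also have "\<dots> = (ghost_letter e * path_elem v (f # q)) * return_elem ^ j"
        unfolding Suc power_Suc q(5) by (simp only: mult.assoc)
      also have "\<dots> \<approx> (if e = f then to_v q else 0) * return_elem ^ j"
        by (rule leavitt_eq_mult_right[OF ghost]) simp
      finally have eq: "ghost_letter e * orbit_elem p k \<approx> ((if e = f then to_v q else 0) * return_elem ^ j :: _ \<Rightarrow>\<^sub>0 'k)" .
      show ?thesis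
      proof (cases "e = f")
        case True
        have "ghost_letter e * orbit_elem p k \<approx> (orbit_elem q j :: _ \<Rightarrow>\<^sub>0 'k)"
          using eq True by (simp add: orbit_elem_def)
        then show ?thesis using q(2) k Suc by (intro stays_in_orbitI(2)[of _ q j]) simp_all
      next
        case False
        then have "ghost_letter e * orbit_elem p k \<approx> (0 :: _ \<Rightarrow>\<^sub>0 'k)" using eq by simp
        then show ?thesis by (rule stays_in_orbitI)
      qed
    qed
  qed
qed

text \<open>
  Multiplication by a generator permutes the paths \<open>p c\<^sup>k\<close> into \<open>v\<close>, up to one exception at each
  end of the range of \<open>k\<close>; for a sink \<open>v\<close>, where only \<open>k = 0\<close> is used, there is no exception.
\<close>

lemma generator_orbit_elem:
  assumes x: "x \<in> generators G"
  obtains h where "h \<in> (nonunital :: (_ \<Rightarrow>\<^sub>0 'k::field) set)"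
    "\<forall>p\<in>arrivals. \<forall>k<n. stays_in_orbit n h (letter x * orbit_elem p k)"
proof -
  consider u where "u \<in> verts G" "x = Vert u" | e where "e \<in> arcs G" "x = Arc e" | e where "e \<in> arcs G" "x = Ghost e"
    using x unfolding generators_def by blast
  then show ?thesis
  proof cases
    case 1
    show ?thesis by (rule that[of 0]) (simp_all add: 1 vert_orbit_elem N_closed(4))
  next
    case 2
    show ?thesis by (rule that[of "orbit_elem [] n"]) (simp_all add: 2 arc_orbit_elem)
  next
    case 3
    have "ghost_letter e \<in> (nonunital :: (_ \<Rightarrow>\<^sub>0 'k) set)" using 3(1) by (simp add: nonunital_part_def)
    then have "ghost_letter e * orbit_elem [] 0 \<in> (nonunital :: (_ \<Rightarrow>\<^sub>0 'k) set)"
      by (rule N_closed(3)) simp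
    then show ?thesis by (rule that) (simp add: 3 ghost_orbit_elem)
  qed
qed

section \<open>Defect and dimension of the orbit\<close>

definition orbit :: "nat \<Rightarrow> (('a, 'b) generator free_word \<Rightarrow>\<^sub>0 'k::field) set set" where
  "orbit n = (\<lambda>(p, k). leavitt_class (orbit_elem p k)) ` (arrivals \<times> {..<n})"

lemma orbit_finite: "finite (orbit n)" and orbit_carrier: "orbit n \<subseteq> carrier LPA"
  using finite_arrivals by (auto simp: orbit_def intro!: leavitt_class_nonunital)

text \<open>At a sink there are no powers with which \<open>n\<close> could grow and dilute an
  error. There \<open>n = 1\<close> already gives an invariant space, which is recorded as defect
  0.\<close>

definition defect :: nat where "defect = (if out_arcs G v = {} then 0 else 1)"

definition admissible :: "nat \<Rightarrow> bool" where
  "admissible n \<longleftrightarrow> n > 0 \<and> (out_arcs G v = {} \<longrightarrow> n = 1)"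

lemma generator_almost_invariant:
  assumes x: "x \<in> generators G"
  shows "field_algebra.almost_invariant (LPA :: ('k::field, _) module) (orbit n) defect (leavitt_class (letter x))"
proof -
  interpret L: field_algebra "LPA :: ('k, _) module" by (rule leavitt_field_algebra)
  note ops = leavitt_ops[where ?'k = 'k]
  obtain h where h: "h \<in> (nonunital :: (_ \<Rightarrow>\<^sub>0 'k) set)"
    and cases: "\<forall>p\<in>arrivals. \<forall>k<n. stays_in_orbit n h (letter x * orbit_elem p k)"
    by (rule generator_orbit_elem[OF x])
  define Y where "Y = (if out_arcs G v = {} then {} else {leavitt_class h})"
  have Y: "finite Y" "Y \<subseteq> carrier LPA" "card Y \<le> defect"
    using leavitt_class_nonunital[OF h] by (auto simp: Y_def defect_def)
  have xN: "letter x \<in> (nonunital :: (_ \<Rightarrow>\<^sub>0 'k) set)"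
    using x by (simp add: nonunital_part_def free_algebra_letter)
  have C: "orbit n \<union> Y \<subseteq> carrier LPA" using orbit_carrier Y by blast
  note own = L.in_own_span[OF C] and zero = L.subspaceD(2)[OF L.span_is_subspace[OF C]]
  have "leavitt_class (letter x) \<otimes>\<^bsub>LPA\<^esub> y \<in> L.span (orbit n \<union> Y)" if y: "y \<in> orbit n" for y
  proof -
    obtain p k where p: "p \<in> arrivals" "k < n" "y = leavitt_class (orbit_elem p k)"
      using y by (auto simp: orbit_def)
    have N: "orbit_elem p k \<in> (nonunital :: (_ \<Rightarrow>\<^sub>0 'k) set)" using p by simp
    have N': "letter x * orbit_elem p k \<in> (nonunital :: (_ \<Rightarrow>\<^sub>0 'k) set)" by (rule N_closed(3)[OF xN N])
    have eq: "leavitt_class (letter x) \<otimes>\<^bsub>LPA\<^esub> y = leavitt_class (letter x * orbit_elem p k)"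
      unfolding p(3) by (rule ops(4)[OF xN N])
    note cls = iffD2[OF ops(7)[OF N']]
    from cases[rule_format, OF p(1,2)] show ?thesis
      unfolding stays_in_orbit_def
    proof (elim disjE bexE exE conjE)
      assume "letter x * orbit_elem p k \<approx> (0 :: _ \<Rightarrow>\<^sub>0 'k)"
      then have "leavitt_class (letter x) \<otimes>\<^bsub>LPA\<^esub> y = \<zero>\<^bsub>LPA\<^esub>"
        unfolding eq ops(3) by (intro cls N_closed)
      then show ?thesis using zero by simp
    next
      fix p' k' assume p': "p' \<in> arrivals" "k' < n" "letter x * orbit_elem p k \<approx> (orbit_elem p' k' :: _ \<Rightarrow>\<^sub>0 'k)"
      then have "leavitt_class (letter x) \<otimes>\<^bsub>LPA\<^esub> y = leavitt_class (orbit_elem p' k')"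
        unfolding eq by (intro cls) simp_all
      also have "\<dots> \<in> orbit n" unfolding orbit_def using p'(1,2) by force
      finally show ?thesis using own by blast
    next
      assume "out_arcs G v \<noteq> {}" "letter x * orbit_elem p k \<approx> h"
      then have "leavitt_class (letter x) \<otimes>\<^bsub>LPA\<^esub> y \<in> Y"
        unfolding eq Y_def using cls[OF h] by simp
      then show ?thesis using own by blast
    qed
  qed
  then show ?thesis unfolding L.almost_invariant_def using Y by blast
qed

text \<open>Each letter costs at most \<open>defect\<close> extra vectors, so the bound depends on
  the length of the word but not on \<open>n\<close>.\<close>

lemma word_almost_invariant:
  assumes "xs \<noteq> []" "set xs \<subseteq> generators G"
  shows "field_algebra.almost_invariant (LPA :: ('k::field, _) module) (orbit n) (length xs * defect)
    (leavitt_class (Poly_Mapping.single (Word xs) 1))"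
  using assms(1,2)
proof (induction xs rule: list_nonempty_induct)
  case (single x)
  then show ?case using generator_almost_invariant[of x n] by (simp add: letter_def)
next
  case (cons x xs)
  interpret L: field_algebra "LPA :: ('k, _) module" by (rule leavitt_field_algebra)
  let ?w = "Poly_Mapping.single (Word xs) 1 :: ('a, 'b) generator free_word \<Rightarrow>\<^sub>0 'k"
  have xN: "letter x \<in> (nonunital :: (_ \<Rightarrow>\<^sub>0 'k) set)"
    using cons.prems by (simp add: nonunital_part_def free_algebra_letter)
  have wN: "?w \<in> nonunital"
    using cons by (auto simp: nonunital_part_def carrier_free_algebra lookup_single when_def zero_free_word_def)
  have "Poly_Mapping.single (Word (x # xs)) 1 = letter x * ?w"
    by (simp add: letter_def mult_single plus_free_word_def)
  then have "leavitt_class (Poly_Mapping.single (Word (x # xs)) 1) = leavitt_class (letter x) \<otimes>\<^bsub>LPA\<^esub> leavitt_class ?w"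
    using leavitt_ops(4)[OF xN wN] by simp
  moreover have "L.almost_invariant (orbit n) (defect + length xs * defect) (leavitt_class (letter x) \<otimes>\<^bsub>LPA\<^esub> leavitt_class ?w)"
    using cons.prems
    by (intro L.almost_invariant_mult[OF generator_almost_invariant cons.IH orbit_carrier
          leavitt_class_nonunital[OF xN] leavitt_class_nonunital[OF wN]]) simp_all
  ultimately show ?case by simp
qed

text \<open>The order of the quantifiers matters: \<open>K\<close>, which the induction builds as
  the total length of the words in \<open>f\<close>, is fixed before \<open>n\<close>, so the
  relative error shrinks as \<open>n\<close> grows.\<close>

lemma element_almost_invariant:
  assumes f: "f \<in> (nonunital :: (_ \<Rightarrow>\<^sub>0 'k::field) set)"
  shows "\<exists>K. \<forall>n. admissible n \<longrightarrow>
    field_algebra.almost_invariant (LPA :: ('k, _) module) (orbit n) (K * defect) (leavitt_class f)"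
proof -
  interpret L: field_algebra "LPA :: ('k, _) module" by (rule leavitt_field_algebra)
  let ?s = "\<lambda>w. Poly_Mapping.single w 1 :: _ \<Rightarrow>\<^sub>0 'k"
  let ?g = "\<lambda>S. \<Sum>w\<in>S. Poly_Mapping.single 0 (Poly_Mapping.lookup f w) * ?s w"
  have w: "set (letters w) \<subseteq> generators G" "letters w \<noteq> []" if w: "w \<in> Poly_Mapping.keys f" for w
  proof -
    show "set (letters w) \<subseteq> generators G"
      using f w by (simp add: nonunital_part_def carrier_free_algebra)
    show "letters w \<noteq> []"
    proof
      assume "letters w = []"
      then have "w = 0" by (cases w) (simp add: zero_free_word_def)
      then show False using f w by (simp add: nonunital_part_def in_keys_iff)
    qed
  qed
  have sN: "?s w \<in> nonunital" if "w \<in> Poly_Mapping.keys f" for w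
    using w[OF that] by (auto simp: nonunital_part_def carrier_free_algebra lookup_single when_def)
  have "\<exists>K. \<forall>n. admissible n \<longrightarrow> L.almost_invariant (orbit n) (K * defect) (leavitt_class (?g S))"
    if "finite S" "S \<subseteq> Poly_Mapping.keys f" for S
    using that
  proof (induction S rule: finite_induct)
    case empty
    have "L.almost_invariant (orbit n) 0 \<zero>\<^bsub>LPA\<^esub>" for n
    proof -
      have "\<zero>\<^bsub>LPA\<^esub> \<otimes>\<^bsub>LPA\<^esub> x = \<zero>\<^bsub>LPA\<^esub>" if "x \<in> orbit n" for x :: "(_ \<Rightarrow>\<^sub>0 'k) set"
        using subsetD[OF orbit_carrier that] by simp
      then show ?thesis
        unfolding L.almost_invariant_def
        using L.subspaceD(2)[OF L.span_is_subspace[OF orbit_carrier[of n]]]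
        by (intro exI[of _ "{}"]) simp
    qed
    then show ?case by (intro exI[of _ 0]) (simp add: leavitt_ops(3))
  next
    case (insert w S)
    have "S \<subseteq> Poly_Mapping.keys f" using insert.prems by simp
    from insert.IH[OF this] obtain K
      where K: "\<forall>n. admissible n \<longrightarrow> L.almost_invariant (orbit n) (K * defect) (leavitt_class (?g S))" ..
    have wk: "w \<in> Poly_Mapping.keys f" using insert by simp
    have gN: "?g S \<in> nonunital" using insert.prems by (intro nonunital_sum N_closed(6) sN) blast
    have tN: "Poly_Mapping.single 0 (Poly_Mapping.lookup f w) * ?s w \<in> nonunital" by (rule N_closed(6)[OF sN[OF wk]])
    have "L.almost_invariant (orbit n) ((length (letters w) + K) * defect) (leavitt_class (?g (insert w S)))"
      if n: "admissible n" for n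
    proof -
      have "L.almost_invariant (orbit n) (length (letters w) * defect) (leavitt_class (?s w))"
        using word_almost_invariant[OF w(2,1)[OF wk]] by simp
      then have "L.almost_invariant (orbit n) (length (letters w) * defect)
        (Poly_Mapping.lookup f w \<odot>\<^bsub>LPA\<^esub> leavitt_class (?s w))"
        by (rule L.almost_invariant_smult[OF _ orbit_carrier leavitt_class_nonunital[OF sN[OF wk]]])
      then have "L.almost_invariant (orbit n) (length (letters w) * defect + K * defect)
        (Poly_Mapping.lookup f w \<odot>\<^bsub>LPA\<^esub> leavitt_class (?s w) \<oplus>\<^bsub>LPA\<^esub> leavitt_class (?g S))"
        by (rule L.almost_invariant_add[OF _ K[rule_format, OF n] orbit_carrier
              L.smult_in_carrier[OF leavitt_class_nonunital[OF sN[OF wk]]] leavitt_class_nonunital[OF gN]])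
      moreover have "Poly_Mapping.lookup f w \<odot>\<^bsub>LPA\<^esub> leavitt_class (?s w) \<oplus>\<^bsub>LPA\<^esub> leavitt_class (?g S) =
        leavitt_class (?g (insert w S))"
        using insert.hyps by (simp add: leavitt_ops(6)[OF sN[OF wk]] leavitt_ops(5)[OF tN gN])
      ultimately show ?thesis by (simp add: algebra_simps)
    qed
    then show ?case by blast
  qed
  from this[of "Poly_Mapping.keys f"]
  have "\<exists>K. \<forall>n. admissible n \<longrightarrow> L.almost_invariant (orbit n) (K * defect) (leavitt_class (?g (Poly_Mapping.keys f)))"
    by simp
  moreover have "?g (Poly_Mapping.keys f) = f"
    by (intro poly_mapping_eqI) (simp add: lookup_sum_word lookup_single when_def in_keys_iff mult_single)
  ultimately show ?thesis by simp
qed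

text \<open>In the system with \<open>m\<close> turns the first \<open>m\<close> powers of the
  return move one point to \<open>m\<close> different points, which separates them.\<close>

lemma act_orbit_elem:
  assumes "admissible m" "k < m"
  shows "act m (orbit_elem [] k :: _ \<Rightarrow>\<^sub>0 'k::field) (delta ([], 0)) = delta ([], k)"
proof -
  have m: "m > 0" using assms(1) by (simp add: admissible_def)
  interpret R: branching_system G "D m" "F m" by (rule branching[OF m])
  have step: "R.action (return_elem :: _ \<Rightarrow>\<^sub>0 'k) (delta ([], j)) = delta ([], Suc j)" if j: "Suc j < m" for j
  proof -
    \<comment> \<open>\<open>Suc j < m\<close> forces \<open>m\<close> to be at least 2, which
      admissibility excludes at a sink.\<close>
    have "out_arcs G v \<noteq> {}" using assms(1) j by (auto simp: admissible_def)
    then obtain f q where q: "f \<in> arcs G" "q \<in> arrivals" "start q = head G f" "tail G f = v"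
      "(return_elem :: _ \<Rightarrow>\<^sub>0 'k) = path_elem v (f # q)"
      by (rule return_elem_decomp)
    have qD: "(q, j) \<in> D m (head G f)" using q j by (simp add: D_def)
    have Ff: "F m f (q, j) = ([], Suc j)" using q(4) j by (simp add: F_def)
    have a: "R.action (to_v q) (delta ([], j)) = (delta (q, j) :: _ \<Rightarrow> 'k)"
      using j by (auto simp: act_to_v[OF m q(2)] fun_eq_iff)
    have b: "(return_elem :: _ \<Rightarrow>\<^sub>0 'k) \<approx> arc_letter f * to_v q"
      using path_elem_Cons[OF q(1) arrival_arcs[OF q(2)]] q(3-5) by simp
    have "R.action (return_elem :: _ \<Rightarrow>\<^sub>0 'k) (delta ([], j)) = R.action (arc_letter f * to_v q) (delta ([], j))"
      by (rule R.action_cong[OF b])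
    also have "\<dots> = R.gen_op (Arc f) (delta (q, j))"
      unfolding R.action_mult R.action_letter a by (rule refl)
    also have "\<dots> = (delta ([], Suc j) :: _ \<Rightarrow> 'k)"
    proof
      fix z
      show "R.gen_op (Arc f) (delta (q, j)) z = (delta ([], Suc j) z :: 'k)"
      proof (cases "z \<in> F m f ` D m (head G f)")
        case True
        then obtain y where y: "z = F m f y" "y \<in> D m (head G f)" by blast
        then have "z = ([], Suc j) \<longleftrightarrow> y = (q, j)"
          using Ff qD inj_onD[OF R.F_inj[OF q(1)], of y "(q, j)"] by auto
        then show ?thesis using y R.inv_F[OF q(1) y(2)] by auto
      next
        case False
        moreover have "([], Suc j) \<in> F m f ` D m (head G f)"
          using Ff[symmetric] qD by (rule image_eqI)
        ultimately have "z \<noteq> ([], Suc j)" by blast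
        then show ?thesis using False by simp
      qed
    qed
    finally show ?thesis .
  qed
  have pow: "R.action (return_elem ^ k :: _ \<Rightarrow>\<^sub>0 'k) (delta ([], 0)) = delta ([], k)" if "k < m" for k
    using that
  proof (induction k)
    case 0
    have one: "(1 :: ('a, 'b) generator free_word \<Rightarrow>\<^sub>0 'k) = Poly_Mapping.single 0 1" by simp
    show ?case unfolding power_0 one R.action_single by (simp add: R.word_op_def)
  next
    case (Suc k)
    then show ?case using step[of k] by (simp add: R.action_mult)
  qed
  have "R.action (orbit_elem [] k :: _ \<Rightarrow>\<^sub>0 'k) (delta ([], 0)) = R.action (to_v []) (delta ([], k))"
    by (simp add: orbit_elem_def R.action_mult pow[OF assms(2)])
  also have "\<dots> = delta ([], k)"
    unfolding act_to_v[OF m Nil_arrival] using assms(2) by (auto simp: fun_eq_iff)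
  finally show ?thesis .
qed

text \<open>Only the elements with empty arrival are counted. Applied to one \<open>delta\<close>
  function they yield different ones, hence are independent, and a bound that grows with
  \<open>n\<close> is all that is needed.\<close>

lemma orbit_dim:
  assumes n: "admissible n"
  shows "n \<le> dim_on (LPA :: ('k::field, _) module) (module.span class_ring LPA (orbit n))"
proof -
  interpret L: field_algebra "LPA :: ('k, _) module" by (rule leavitt_field_algebra)
  have m: "n > 0" using n by (simp add: admissible_def)
  interpret R: branching_system G "D n" "F n" by (rule branching[OF m])
  let ?o = "\<lambda>k. orbit_elem [] k :: _ \<Rightarrow>\<^sub>0 'k"
  define z where "z k = leavitt_class (?o k)" for k
  have indep: "c k = 0" if c: "(\<Oplus>\<^bsub>LPA\<^esub>i\<in>{..<n}. c i \<odot>\<^bsub>LPA\<^esub> z i) = \<zero>\<^bsub>LPA\<^esub>" and k: "k < n" for c k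
  proof -
    let ?f = "\<Sum>i<n. Poly_Mapping.single 0 (c i) * ?o i"
    have "?f \<in> nonunital" by (intro nonunital_sum N_closed(6)) simp
    moreover have "leavitt_class ?f = leavitt_class 0"
      using c leavitt_class_sum[of "{..<n}" ?o c] by (simp add: z_def leavitt_ops(3))
    ultimately have "?f \<approx> 0" using leavitt_ops(7) N_closed(4) by blast
    then have "R.action ?f (delta ([], 0)) = R.action 0 (delta ([], 0))" by (rule R.action_cong)
    then have "0 = R.action ?f (delta ([], 0)) ([], k)" by (simp add: R.action_zero)
    also have "\<dots> = (\<Sum>i<n. c i * delta ([], i) ([], k))"
      unfolding R.action_sum R.action_scalar
      by (intro sum.cong refl) (simp add: act_orbit_elem[OF n])
    also have "\<dots> = (\<Sum>i<n. if i = k then c i else 0)" by (intro sum.cong) auto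
    also have "\<dots> = c k" using k by simp
    finally show ?thesis by simp
  qed
  have inj: "inj_on z {..<n}"
  proof (rule inj_onI)
    fix i j assume ij: "i \<in> {..<n}" "j \<in> {..<n}" "z i = z j"
    have "?o i \<in> nonunital" "?o j \<in> nonunital" by simp_all
    then have "?o i \<approx> ?o j" using ij(3) leavitt_ops(7) unfolding z_def by blast
    then have "R.action (?o i) (delta ([], 0)) = R.action (?o j) (delta ([], 0))" by (rule R.action_cong)
    then have "delta ([], i) = (delta ([], j) :: _ \<Rightarrow> 'k)"
      using ij(1,2) unfolding lessThan_iff by (simp only: act_orbit_elem[OF n])
    from fun_cong[OF this, of "([], i)"] show "i = j" by (simp split: if_splits)
  qed
  have sub: "z ` {..<n} \<subseteq> orbit n" by (force simp: z_def orbit_def)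
  have "L.lin_indpt (z ` {..<n})"
  proof (rule L.finite_lin_indpt2)
    show "z ` {..<n} \<subseteq> carrier LPA" using sub orbit_carrier by blast
    fix a assume "L.lincomb a (z ` {..<n}) = \<zero>\<^bsub>LPA\<^esub>"
    moreover have "L.lincomb a (z ` {..<n}) = (\<Oplus>\<^bsub>LPA\<^esub>i\<in>{..<n}. a (z i) \<odot>\<^bsub>LPA\<^esub> z i)"
      unfolding L.lincomb_def using inj sub orbit_carrier
      by (intro L.A.finsum_reindex) (auto intro!: L.smult_in_carrier)
    ultimately have "(\<Oplus>\<^bsub>LPA\<^esub>i\<in>{..<n}. a (z i) \<odot>\<^bsub>LPA\<^esub> z i) = \<zero>\<^bsub>LPA\<^esub>" by (rule trans[OF sym, rotated])
    from indep[of "\<lambda>i. a (z i)", OF this] show "\<forall>v\<in>z ` {..<n}. a v = \<zero>\<^bsub>class_ring\<^esub>" by auto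
  qed simp
  moreover have "z ` {..<n} \<subseteq> L.span (orbit n)" using sub L.in_own_span[OF orbit_carrier] by blast
  ultimately have "card (z ` {..<n}) \<le> dim_on LPA (L.span (orbit n))"
    using L.lin_indpt_card_le_dim_on(2)[OF L.span_is_subspace[OF orbit_carrier] L.dim_on_span(1)[OF orbit_finite orbit_carrier]]
    by blast
  then show ?thesis using inj by (simp add: card_image)
qed

theorem amenable: "algebraically_amenable (LPA :: ('k::field, _) module)"
  unfolding algebraically_amenable_def
proof (intro allI impI)
  interpret L: field_algebra "LPA :: ('k, _) module" by (rule leavitt_field_algebra)
  fix e :: real and S :: "(('a, 'b) generator free_word \<Rightarrow>\<^sub>0 'k) set set"
  assume "e > 0 \<and> finite S \<and> S \<subseteq> carrier (LPA :: ('k, _) module)"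
  then have e: "e > 0" and S: "finite S" "S \<subseteq> carrier (LPA :: ('k, _) module)" by auto
  define Q where "Q a K \<longleftrightarrow> (\<forall>n. admissible n \<longrightarrow> L.almost_invariant (orbit n) (K * defect) a)" for a K
  have "\<forall>a\<in>S. \<exists>K. Q a K"
  proof
    fix a assume "a \<in> S"
    then obtain f where "f \<in> nonunital" "a = leavitt_class f" using S(2) by (auto simp: leavitt_ops(1))
    then show "\<exists>K. Q a K" unfolding Q_def using element_almost_invariant by blast
  qed
  then obtain K where "\<forall>a\<in>S. Q a (K a)" using bchoice[of S Q] by blast
  then have K: "L.almost_invariant (orbit n) (K a * defect) a" if "a \<in> S" "admissible n" for a n
    using that unfolding Q_def by blast
  \<comment> \<open>\<open>M\<close> bounds all \<open>K a\<close> at once, and away from sinks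
    \<open>n\<close> exceeds \<open>M / e\<close>, so that every error is at most
    \<open>e * n\<close> and hence at most \<open>e\<close> times the dimension.\<close>
  define M where "M = (\<Sum>a\<in>S. K a)"
  define n where "n = (if out_arcs G v = {} then 1 else Suc (nat \<lceil>real M / e\<rceil>))"
  have n: "admissible n" by (simp add: admissible_def n_def)
  let ?W = "L.span (orbit n)"
  have W: "VectorSpace.subspace class_ring ?W LPA" using orbit_carrier by (rule L.span_is_subspace)
  note fd = L.dim_on_span(1)[OF orbit_finite orbit_carrier, of n]
  have dim: "n \<le> dim_on LPA ?W" by (rule orbit_dim[OF n])
  have nz: "?W \<noteq> {\<zero>\<^bsub>LPA\<^esub>}"
  proof
    assume eq: "?W = {\<zero>\<^bsub>LPA\<^esub>}"
    then have "L.span {} = ?W"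
      using L.subspaceD(2)[OF L.span_is_subspace[of "{}"]] L.span_subset[OF W, of "{}"] by auto
    then have "dim_on LPA ?W \<le> 0" using L.dim_on_span(2)[of "{}"] by simp
    then show False using dim n by (simp add: admissible_def)
  qed
  have bound: "real (dim_on LPA ((a <#\<^bsub>LPA\<^esub> ?W) <+>\<^bsub>LPA\<^esub> ?W)) \<le> (1 + e) * real (dim_on LPA ?W)"
    if a: "a \<in> S" for a
  proof -
    have "dim_on LPA ((a <#\<^bsub>LPA\<^esub> ?W) <+>\<^bsub>LPA\<^esub> ?W) \<le> dim_on LPA ?W + K a * defect"
      by (rule L.almost_invariant_dim[OF K[OF a n] orbit_finite orbit_carrier subsetD[OF S(2) a]])
    then have "real (dim_on LPA ((a <#\<^bsub>LPA\<^esub> ?W) <+>\<^bsub>LPA\<^esub> ?W)) \<le> real (dim_on LPA ?W) + real (K a * defect)"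
      by linarith
    also have "real (K a * defect) \<le> e * real (dim_on LPA ?W)"
    proof (cases "out_arcs G v = {}")
      case True
      then show ?thesis using e by (simp add: defect_def)
    next
      case False
      have "K a \<le> M" unfolding M_def using S(1) a by (intro member_le_sum) auto
      then have "real (K a * defect) \<le> real M" using False by (simp add: defect_def)
      also have "\<dots> = e * (real M / e)" using e by simp
      also have "\<dots> \<le> e * real n"
      proof (intro mult_left_mono)
        have "real M / e \<le> real (nat \<lceil>real M / e\<rceil>)" by (rule real_nat_ceiling_ge)
        then show "real M / e \<le> real n" using False by (simp add: n_def)
      qed (use e in simp)
      also have "\<dots> \<le> e * real (dim_on LPA ?W)" using dim e by (intro mult_left_mono) auto
      finally show ?thesis .
    qed
    finally show ?thesis by (simp add: algebra_simps)
  qed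
  show "\<exists>W. VectorSpace.subspace class_ring W (LPA :: ('k, _) module) \<and> W \<noteq> {\<zero>\<^bsub>LPA\<^esub>} \<and> fin_dim_on LPA W \<and>
      (\<forall>a\<in>S. real (dim_on LPA ((a <#\<^bsub>LPA\<^esub> W) <+>\<^bsub>LPA\<^esub> W)) \<le> (1 + e) * real (dim_on LPA W))"
    using bound by (intro exI[of _ ?W] conjI W nz fd ballI)
qed

end

lemma (in fin_digraph) ex_good_vertex:
  assumes "\<exists>u. maximal_in G u"
  obtains v where "good_vertex G v"
proof -
  obtain u where "maximal_in G u" using assms by blast
  then obtain v where "v \<in> verts G" "finite (first_arrivals G v)"
    "\<And>c d. first_return G v c \<Longrightarrow> first_return G v d \<Longrightarrow> c = d"
    "out_arcs G v \<noteq> {} \<Longrightarrow> \<exists>c. first_return G v c"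
    using maximal_imp_good_vertex by metis
  then have "good_vertex G v"
    by (intro good_vertex.intro good_vertex_axioms.intro fin_digraph_axioms)
  then show ?thesis by (rule that)
qed

theorem corollary6p7:
  fixes G :: "('v, 'e) pre_digraph"
  fixes L :: "('k::field, (('v, 'e) generator free_word \<Rightarrow>\<^sub>0 'k) set) module"
  assumes "fin_digraph G"
  defines "L \<equiv> leavitt_path_algebra G"
  shows
    "((\<exists>u. maximal_in G u) \<longleftrightarrow> UGN L) \<and>
     ((\<exists>u. maximal_in G u) \<longleftrightarrow> algebraically_amenable L) \<and>
     ((\<exists>u. maximal_in G u) \<longleftrightarrow> has_nonzero_fin_dim_quotient L) \<and>
     ((\<exists>u. maximal_in G u) \<longleftrightarrow>
       \<not> (\<exists>N. right_submodule L N (regular_module L) \<and>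
              right_module_iso L (module_sum (regular_module L) (regular_module L))
                (quotient_module (regular_module L) N)))"
proof -
  interpret fin_digraph G by fact
  interpret A: field_algebra L unfolding L_def by (rule leavitt_field_algebra)
  have amenable: "algebraically_amenable L" and quotient: "has_nonzero_fin_dim_quotient L" if max: "\<exists>u. maximal_in G u"
  proof -
    obtain v where "good_vertex G v" using ex_good_vertex[OF max] .
    then interpret good_vertex G v .
    show "algebraically_amenable L" "has_nonzero_fin_dim_quotient L"
      unfolding L_def by (rule amenable, rule fin_dim_quotient)
  qed
  have doubling: "doubling L" if "\<nexists>u. maximal_in G u"
    unfolding L_def using that by (rule no_maximal_imp_doubling)
  have rank: "rank_condition L" if "algebraically_amenable L \<or> has_nonzero_fin_dim_quotient L"
    using that A.amenable_imp_rank_condition A.fin_dim_quotient_imp_rank_condition by blast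
  \<comment> \<open>A maximal sink or cycle gives amenability and the quotient, hence the rank
    condition, hence UGN and no doubling. Without one there is doubling, which refutes UGN and,
    through the rank condition, also amenability and the quotient.\<close>
  show ?thesis
    using amenable quotient doubling rank A.A.rank_condition_imp_not_doubling A.A.rank_condition_imp_UGN
      A.A.doubling_imp_not_UGN A.A.doubling_iff_square_is_quotient by blast
qed

end
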